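(* Let $a\in\mathbb{D}$, $a\neq 0$. Then the C$^*$-algebra $\mathcal{C}^*(C_a)\subset\mathcal{B}(H^2)$ generated by $C_a$ is $*$-isomorphic to $$ \left\{\left(\alpha,\begin{pmatrix} f_{00}(H) & f_{01}(H)\\ f_{10}(H) & f_{11}(H)\end{pmatrix}\right):\ \alpha\in\mathbb{C},\ f_{ij}\in C([1-|a|^2,1]),\ f_{00}(1)=\alpha,\ f_{01}(1)=f_{10}(1)=0\right\}, $$ with the operations inherited from $\mathbb{C}\oplus\mathcal{B}(\mathcal{J}\times\mathcal{J})$, where $H=\sin(X)^2\in\mathcal{B}(\mathcal{J})$ is the positive operator attached to the pair of projections $P_{N(C_a-I)}$, $P_{N(C_a+I)}$ as described in the context, and $f_{ij}(H)$ is given by the continuous functional calculus.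
   Context: $\mathbb{D}$ is the open unit disk and $H^2=H^2(\mathbb{D})$ the Hardy space. For $a\in\mathbb{D}$, $\varphi_a(z)=\frac{a-z}{1-\bar a z}$ and $C_a:H^2\to H^2$ is the composition operator $C_af=f\circ\varphi_a$; it is bounded and $C_a^2=I$. $N(T)$ denotes the null space of $T$, and $P_{\mathcal{S}}$ the orthogonal projection onto a closed subspace $\mathcal{S}$. $\mathcal{C}^*(C_a)$ is the C$^*$-subalgebra of $\mathcal{B}(H^2)$ generated by $C_a$ (it contains $I=C_a^2$). Put $\mathcal{L}=N(C_a-I)$, $\mathcal{N}=N(C_a+I)$, and let $\mathcal{H}_0$ be the orthogonal complement in $H^2$ of $(\mathcal{L}\cap\mathcal{N})\oplus(\mathcal{L}\cap\mathcal{N}^\perp)\oplus(\mathcal{L}^\perp\cap\mathcal{N})\oplus(\mathcal{L}^\perp\cap\mathcal{N}^\perp)$ (the generic part), which reduces $P_{\mathcal{L}}$ and $P_{\mathcal{N}}$. By Halmos' theorem there are a Hilbert space $\mathcal{J}$, a positive operator $X\in\mathcal{B}(\mathcal{J})$ with $\|X\|\le\pi/2$ and $N(X)=\{0\}$, and a unitary isomorphism $\mathcal{H}_0\simeq\mathcal{J}\times\mathcal{J}$ carrying $P_{\mathcal{L}}|_{\mathcal{H}_0}$ and $P_{\mathcal{N}}|_{\mathcal{H}_0}$ respectively to $$\begin{pmatrix} I&0\\0&0\end{pmatrix},\qquad \begin{pmatrix} C^2& CS\\ CS& S^2\end{pmatrix},\qquad C=\cos(X),\ S=\sin(X).$$ One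 sets $H=\sin(X)^2$; its spectrum is $[1-|a|^2,1]$. *)

theory Defs
  imports "HOL-Complex_Analysis.Complex_Analysis"
begin

class scaleC =
  fixes scaleC :: "complex \<Rightarrow> 'a \<Rightarrow> 'a" (infixr \<open>*\<^sub>C\<close> 75)

text \<open>The inner product is linear in its first argument.  Building on \<^class>\<open>real_inner\<close> makes the
  norm, the topology and the bounded operators of the library available.\<close>

class complex_inner = real_inner + scaleC +
  fixes cinner :: "'a \<Rightarrow> 'a \<Rightarrow> complex"
  assumes scaleC_add_right: "c *\<^sub>C (x + y) = c *\<^sub>C x + c *\<^sub>C y"
    and scaleC_add_left: "(c + d) *\<^sub>C x = c *\<^sub>C x + d *\<^sub>C x"
    and scaleC_scaleC: "c *\<^sub>C d *\<^sub>C x = (c * d) *\<^sub>C x"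
    and scaleR_scaleC: "r *\<^sub>R x = of_real r *\<^sub>C x"
    and cinner_commute: "cinner x y = cnj (cinner y x)"
    and cinner_add_left: "cinner (x + y) z = cinner x z + cinner y z"
    and cinner_scaleC_left: "cinner (c *\<^sub>C x) y = c * cinner x y"
    and inner_eq_Re_cinner: "inner x y = Re (cinner x y)"

class chilbert_space = complex_inner + complete_space
begin
subclass banach ..
end

lemma norm_scaleC: "norm (c *\<^sub>C x) = cmod c * norm (x :: 'a :: complex_inner)"
proof -
  have "cinner (c *\<^sub>C x) (c *\<^sub>C x) = c * cnj (c * cinner x x)"
    by (metis cinner_commute cinner_scaleC_left)
  also have "\<dots> = of_real ((cmod c)\<^sup>2) * cnj (cinner x x)"
    by (simp add: complex_norm_square del: of_real_power)
  finally have "inner (c *\<^sub>C x) (c *\<^sub>C x) = (cmod c)\<^sup>2 * inner x x"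
    by (simp add: inner_eq_Re_cinner)
  then show ?thesis
    by (simp add: norm_eq_sqrt_inner real_sqrt_mult)
qed

lemma bounded_linear_scaleC: "bounded_linear ((*\<^sub>C) c :: 'a :: complex_inner \<Rightarrow> 'a)"
proof (rule bounded_linear_intro[where K = "cmod c"])
  show "c *\<^sub>C (r *\<^sub>R x) = r *\<^sub>R (c *\<^sub>C x)" for r and x :: 'a
    by (simp add: scaleR_scaleC scaleC_scaleC mult.commute)
qed (simp_all add: scaleC_add_right norm_scaleC)

instantiation complex :: complex_inner
begin
definition scaleC_complex :: "complex \<Rightarrow> complex \<Rightarrow> complex" where "scaleC_complex c z = c * z"
definition cinner_complex :: "complex \<Rightarrow> complex \<Rightarrow> complex" where "cinner_complex z w = z * cnj w"
instance
  by standard (auto simp: scaleC_complex_def cinner_complex_def algebra_simps inner_complex_def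
      scaleR_conv_of_real)
end

instantiation prod :: (scaleC, scaleC) scaleC
begin
definition scaleC_prod :: "complex \<Rightarrow> 'a \<times> 'b \<Rightarrow> 'a \<times> 'b"
  where "scaleC_prod c x = (c *\<^sub>C fst x, c *\<^sub>C snd x)"
instance ..
end

instantiation prod :: (complex_inner, complex_inner) complex_inner
begin
definition cinner_prod :: "'a \<times> 'b \<Rightarrow> 'a \<times> 'b \<Rightarrow> complex"
  where "cinner_prod x y = cinner (fst x) (fst y) + cinner (snd x) (snd y)"
instance
proof
  show "cinner x y = cnj (cinner y x)" for x y :: "'a \<times> 'b"
    unfolding cinner_prod_def by (metis cinner_commute complex_cnj_add)
qed (auto simp: scaleC_prod_def cinner_prod_def prod_eq_iff scaleC_add_right scaleC_add_left
      scaleC_scaleC scaleR_scaleC cinner_add_left cinner_scaleC_left inner_eq_Re_cinner algebra_simps)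
end

instance prod :: (chilbert_space, chilbert_space) chilbert_space ..

instantiation blinfun :: (real_normed_vector, complex_inner) scaleC
begin
lift_definition scaleC_blinfun :: "complex \<Rightarrow> ('a \<Rightarrow>\<^sub>L 'b) \<Rightarrow> ('a \<Rightarrow>\<^sub>L 'b)" is "\<lambda>c T x. c *\<^sub>C T x"
  by (rule bounded_linear_compose[OF bounded_linear_scaleC])
instance ..
end

text \<open>The elements of \<^typ>\<open>'a \<Rightarrow>\<^sub>L 'b\<close> are only real linear; \<open>bop\<close> is the set of the complex linear
  ones.\<close>

definition bop :: "('a::complex_inner \<Rightarrow>\<^sub>L 'b::complex_inner) set"
  where "bop = {T :: 'a \<Rightarrow>\<^sub>L 'b. \<forall>c x. T (c *\<^sub>C x) = c *\<^sub>C T x}"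

text \<open>The description determines the adjoint of a \<open>bop\<close> on a Hilbert space.\<close>

definition cadj :: "('a::complex_inner \<Rightarrow>\<^sub>L 'b::complex_inner) \<Rightarrow> ('b \<Rightarrow>\<^sub>L 'a)"
  where "cadj T = (THE S :: 'b \<Rightarrow>\<^sub>L 'a. \<forall>x y. cinner (T x) y = cinner x (S y))"

definition positive_op :: "('a::complex_inner \<Rightarrow>\<^sub>L 'a) \<Rightarrow> bool"
  where "positive_op T \<longleftrightarrow> T \<in> bop \<and> (\<forall>x. cinner (T x) x \<in> \<real>\<^sub>\<ge>\<^sub>0)"

definition null_space :: "('a::complex_inner \<Rightarrow>\<^sub>L 'b::complex_inner) \<Rightarrow> 'a set"
  where "null_space T = {x. T x = 0}"

definition ocompl :: "'a::complex_inner set \<Rightarrow> 'a set"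
  where "ocompl M = {x. \<forall>y\<in>M. cinner x y = 0}"

definition orth_proj :: "'a::complex_inner set \<Rightarrow> 'a \<Rightarrow> 'a"
  where "orth_proj M x = (THE y. y \<in> M \<and> x - y \<in> ocompl M)"

definition spectrum :: "('a::complex_inner \<Rightarrow>\<^sub>L 'a) \<Rightarrow> complex set"
  where "spectrum T = {l. \<not> (\<exists>S\<in>bop. S o\<^sub>L (l *\<^sub>C id_blinfun - T) = id_blinfun \<and>
                                    (l *\<^sub>C id_blinfun - T) o\<^sub>L S = id_blinfun)}"

definition poly_op :: "complex poly \<Rightarrow> ('a::complex_inner \<Rightarrow>\<^sub>L 'a) \<Rightarrow> ('a \<Rightarrow>\<^sub>L 'a)"
  where "poly_op p T = (\<Sum>i\<le>degree p. coeff p i *\<^sub>C (((o\<^sub>L) T) ^^ i) id_blinfun)"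

text \<open>Continuous functional calculus of a selfadjoint operator: \<open>cfc T f\<close> is the norm limit of
  \<open>p\<^sub>n(T)\<close> for polynomials \<open>p\<^sub>n\<close> converging to \<open>f\<close> uniformly on the (real) spectrum of \<open>T\<close>.
  Only the values of \<open>f\<close> on the spectrum matter.\<close>

definition cfc :: "('a::complex_inner \<Rightarrow>\<^sub>L 'a) \<Rightarrow> (real \<Rightarrow> complex) \<Rightarrow> ('a \<Rightarrow>\<^sub>L 'a)"
  where "cfc T f = (THE A. \<forall>p :: nat \<Rightarrow> complex poly.
           uniform_limit {t. of_real t \<in> spectrum T} (\<lambda>n t. poly (p n) (of_real t)) f sequentially
           \<longrightarrow> (\<lambda>n. poly_op (p n) T) \<longlonglongrightarrow> A)"

definition cos_op :: "('a::complex_inner \<Rightarrow>\<^sub>L 'a) \<Rightarrow> ('a \<Rightarrow>\<^sub>L 'a)"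
  where "cos_op X = cfc X (\<lambda>t. of_real (cos t))"

definition sin_op :: "('a::complex_inner \<Rightarrow>\<^sub>L 'a) \<Rightarrow> ('a \<Rightarrow>\<^sub>L 'a)"
  where "sin_op X = cfc X (\<lambda>t. of_real (sin t))"

definition block_op :: "('j::complex_inner \<Rightarrow>\<^sub>L 'j) \<Rightarrow> ('j \<Rightarrow>\<^sub>L 'j) \<Rightarrow> ('j \<Rightarrow>\<^sub>L 'j) \<Rightarrow> ('j \<Rightarrow>\<^sub>L 'j)
    \<Rightarrow> (('j \<times> 'j) \<Rightarrow>\<^sub>L ('j \<times> 'j))"
  where "block_op A B C D = Blinfun (\<lambda>(x, y). (A x + B y, C x + D y))"

lemma block_op_apply: "block_op A B C D (x, y) = (A x + B y, C x + D y)"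
proof -
  have "bounded_linear (\<lambda>z. (A (fst z) + B (snd z), C (fst z) + D (snd z)))"
    by (intro bounded_linear_Pair bounded_linear_add
        bounded_linear_compose[OF blinfun.bounded_linear_right bounded_linear_fst]
        bounded_linear_compose[OF blinfun.bounded_linear_right bounded_linear_snd])
  then show ?thesis
    by (simp add: block_op_def case_prod_unfold bounded_linear_Blinfun_apply)
qed

definition cstar_subalgebra :: "('a::chilbert_space \<Rightarrow>\<^sub>L 'a) set \<Rightarrow> bool"
  where "cstar_subalgebra A \<longleftrightarrow> A \<subseteq> bop \<and> closed A \<and> 0 \<in> A \<and>
    (\<forall>S\<in>A. \<forall>T\<in>A. S + T \<in> A \<and> S o\<^sub>L T \<in> A) \<and>
    (\<forall>c. \<forall>T\<in>A. c *\<^sub>C T \<in> A) \<and> (\<forall>T\<in>A. cadj T \<in> A)"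

definition cstar_generated :: "('a::chilbert_space \<Rightarrow>\<^sub>L 'a) \<Rightarrow> ('a \<Rightarrow>\<^sub>L 'a) set"
  where "cstar_generated T = \<Inter>{A. cstar_subalgebra A \<and> T \<in> A}"

definition star_isomorphic ::
  "'x::{plus,scaleC} set \<Rightarrow> ('x \<Rightarrow> 'x \<Rightarrow> 'x) \<Rightarrow> ('x \<Rightarrow> 'x) \<Rightarrow>
   'y::{plus,scaleC} set \<Rightarrow> ('y \<Rightarrow> 'y \<Rightarrow> 'y) \<Rightarrow> ('y \<Rightarrow> 'y) \<Rightarrow> bool"
  where "star_isomorphic A mulA starA B mulB starB \<longleftrightarrow>
    (\<exists>\<Phi>. bij_betw \<Phi> A B \<and>
      (\<forall>S\<in>A. \<forall>T\<in>A. \<Phi> (S + T) = \<Phi> S + \<Phi> T \<and> \<Phi> (mulA S T) = mulB (\<Phi> S) (\<Phi> T)) \<and>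
      (\<forall>c. \<forall>S\<in>A. \<Phi> (c *\<^sub>C S) = c *\<^sub>C \<Phi> S) \<and>
      (\<forall>S\<in>A. \<Phi> (starA S) = starB (\<Phi> S)))"

definition pair_mult ::
  "complex \<times> ('a::complex_inner \<Rightarrow>\<^sub>L 'a) \<Rightarrow> complex \<times> ('a \<Rightarrow>\<^sub>L 'a) \<Rightarrow> complex \<times> ('a \<Rightarrow>\<^sub>L 'a)"
  where "pair_mult S T = (fst S * fst T, snd S o\<^sub>L snd T)"

definition pair_star :: "complex \<times> ('a::complex_inner \<Rightarrow>\<^sub>L 'a) \<Rightarrow> complex \<times> ('a \<Rightarrow>\<^sub>L 'a)"
  where "pair_star S = (cnj (fst S), cadj (snd S))"

text \<open>Here \<open>+\<close> is the elementwise sum of sets; no closure is needed, as the sum and its closure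
  have the same orthogonal complement.\<close>

definition generic_part :: "'a::complex_inner set \<Rightarrow> 'a set \<Rightarrow> 'a set"
  where "generic_part L N = ocompl
    ((L \<inter> N) + (L \<inter> ocompl N) + (ocompl L \<inter> N) + (ocompl L \<inter> ocompl N))"

definition unitary_iso_on :: "'a::complex_inner set \<Rightarrow> ('a \<Rightarrow> 'b::complex_inner) \<Rightarrow> bool"
  where "unitary_iso_on M U \<longleftrightarrow> bij_betw U M UNIV \<and>
    (\<forall>x\<in>M. \<forall>y\<in>M. U (x + y) = U x + U y) \<and> (\<forall>c. \<forall>x\<in>M. U (c *\<^sub>C x) = c *\<^sub>C U x) \<and>
    (\<forall>x\<in>M. \<forall>y\<in>M. cinner (U x) (U y) = cinner x y)"

text \<open>The data of Halmos' two projections theorem for the subspaces \<open>L\<close> and \<open>N\<close>.  Only the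
  restriction of \<open>U\<close> to the generic part is meaningful.\<close>

definition halmos_model ::
  "'a::complex_inner set \<Rightarrow> 'a set \<Rightarrow> ('j::chilbert_space \<Rightarrow>\<^sub>L 'j) \<Rightarrow> ('a \<Rightarrow> 'j \<times> 'j) \<Rightarrow> bool"
  where "halmos_model L N X U \<longleftrightarrow>
    positive_op X \<and> norm X \<le> pi / 2 \<and> null_space X = {0} \<and>
    unitary_iso_on (generic_part L N) U \<and>
    (\<forall>x\<in>generic_part L N.
      U (orth_proj L x) = block_op id_blinfun 0 0 0 (U x) \<and>
      U (orth_proj N x) = block_op (cos_op X o\<^sub>L cos_op X) (cos_op X o\<^sub>L sin_op X)
                                   (cos_op X o\<^sub>L sin_op X) (sin_op X o\<^sub>L sin_op X) (U x))"

definition halmos_H :: "('j::complex_inner \<Rightarrow>\<^sub>L 'j) \<Rightarrow> ('j \<Rightarrow>\<^sub>L 'j)"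
  where "halmos_H X = sin_op X o\<^sub>L sin_op X"

abbreviation taylor_coeff :: "(complex \<Rightarrow> complex) \<Rightarrow> nat \<Rightarrow> complex"
  where "taylor_coeff f n \<equiv> fps_nth (fps_expansion f 0) n"

text \<open>Functions on the disk are represented as total functions vanishing off the disk.\<close>

typedef hardy = "{f. f holomorphic_on ball 0 1 \<and> (\<forall>z. z \<notin> ball 0 1 \<longrightarrow> f z = 0) \<and>
    summable (\<lambda>n. (cmod (taylor_coeff f n))\<^sup>2)}"
  morphisms hardy_fun Abs_hardy
  by (rule exI[of _ "\<lambda>_. 0"]) (simp add: fps_expansion_def)

setup_lifting type_definition_hardy

abbreviation hcoeff :: "hardy \<Rightarrow> nat \<Rightarrow> complex"
  where "hcoeff f \<equiv> taylor_coeff (hardy_fun f)"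

lemma taylor_coeff_add:
  assumes "f holomorphic_on ball 0 1" "g holomorphic_on ball 0 1"
  shows "taylor_coeff (\<lambda>z. f z + g z) n = taylor_coeff f n + taylor_coeff g n"
  using higher_deriv_add[OF assms, of 0 n] by (simp add: fps_expansion_def add_divide_distrib)

lemma taylor_coeff_cmult:
  assumes "f holomorphic_on ball 0 1"
  shows "taylor_coeff (\<lambda>z. c * f z) n = c * taylor_coeff f n"
  using higher_deriv_cmult[OF assms, of 0 n] by (simp add: fps_expansion_def)

lemma norm_square_add_le: "(norm (x + y))\<^sup>2 \<le> 2 * (norm x)\<^sup>2 + 2 * (norm y)\<^sup>2"
  for x y :: complex
proof -
  have "(norm (x + y))\<^sup>2 \<le> (norm x + norm y)\<^sup>2"
    by (simp add: norm_triangle_ineq power_mono)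
  also have "\<dots> \<le> 2 * (norm x)\<^sup>2 + 2 * (norm y)\<^sup>2"
    using sum_squares_bound[of "norm x" "norm y"] by (simp add: power2_sum)
  finally show ?thesis .
qed

lemma summable_norm_square_add:
  fixes a b :: "nat \<Rightarrow> complex"
  assumes "summable (\<lambda>n. (cmod (a n))\<^sup>2)" "summable (\<lambda>n. (cmod (b n))\<^sup>2)"
  shows "summable (\<lambda>n. (cmod (a n + b n))\<^sup>2)"
  by (rule summable_comparison_test'[of "\<lambda>n. 2 * (cmod (a n))\<^sup>2 + 2 * (cmod (b n))\<^sup>2" 0])
     (use assms norm_square_add_le in \<open>auto intro!: summable_add summable_mult\<close>)

lemma summable_mult_cnj:
  fixes a b :: "nat \<Rightarrow> complex"
  assumes "summable (\<lambda>n. (cmod (a n))\<^sup>2)" "summable (\<lambda>n. (cmod (b n))\<^sup>2)"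
  shows "summable (\<lambda>n. a n * cnj (b n))"
proof (rule summable_comparison_test'[of "\<lambda>n. (cmod (a n))\<^sup>2 + (cmod (b n))\<^sup>2" 0])
  show "norm (a n * cnj (b n)) \<le> (cmod (a n))\<^sup>2 + (cmod (b n))\<^sup>2" for n
  proof -
    have "0 \<le> cmod (a n) * cmod (b n)" by simp
    then show ?thesis
      using sum_squares_bound[of "cmod (a n)" "cmod (b n)"]
      unfolding norm_mult complex_mod_cnj by linarith
  qed
qed (use assms in \<open>auto intro: summable_add\<close>)

lemma suminf_mult_cnj_self:
  fixes a :: "nat \<Rightarrow> complex"
  assumes "summable (\<lambda>n. (cmod (a n))\<^sup>2)"
  shows "(\<Sum>n. a n * cnj (a n)) = of_real (\<Sum>n. (cmod (a n))\<^sup>2)"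
  unfolding complex_norm_square[symmetric] by (rule suminf_of_real[OF assms, symmetric])

lemma summable_hcoeff: "summable (\<lambda>n. (cmod (hcoeff f n))\<^sup>2)"
  using hardy_fun[of f] by simp

lemma holomorphic_hardy_fun: "hardy_fun f holomorphic_on ball 0 1"
  using hardy_fun[of f] by simp

lemma hardy_fun_outside: "z \<notin> ball 0 1 \<Longrightarrow> hardy_fun f z = 0"
  using hardy_fun[of f] by simp

lemma hardy_eqI:
  assumes "\<And>n. hcoeff f n = hcoeff g n"
  shows "f = g"
proof -
  have "hardy_fun f z = hardy_fun g z" for z
  proof (cases "z \<in> ball 0 1")
    case True
    have fps: "fps_expansion (hardy_fun f) 0 = fps_expansion (hardy_fun g) 0"
      using assms by (simp add: fps_eq_iff)
    have "hardy_fun h z = eval_fps (fps_expansion (hardy_fun h) 0) z" for h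
    proof -
      have "hardy_fun h holomorphic_on eball 0 (ereal 1)"
        using holomorphic_hardy_fun[of h] by (simp add: one_ereal_def ball_eball_mono)
      from eval_fps_expansion'[OF this, of z] True show ?thesis by simp
    qed
    then show ?thesis using fps by metis
  qed (simp add: hardy_fun_outside)
  then show ?thesis by (simp add: hardy_fun_inject[symmetric] fun_eq_iff)
qed

instantiation hardy :: "{ab_group_add, scaleC}"
begin

lift_definition zero_hardy :: hardy is "\<lambda>_. 0"
  by (simp add: fps_expansion_def)

lift_definition plus_hardy :: "hardy \<Rightarrow> hardy \<Rightarrow> hardy" is "\<lambda>f g z. f z + g z"
  by (auto simp: taylor_coeff_add intro: holomorphic_on_add summable_norm_square_add)

lift_definition scaleC_hardy :: "complex \<Rightarrow> hardy \<Rightarrow> hardy" is "\<lambda>c f z. c * f z"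
  by (auto simp: taylor_coeff_cmult norm_mult power_mult_distrib
      intro: holomorphic_on_mult holomorphic_on_const summable_mult)

definition uminus_hardy :: "hardy \<Rightarrow> hardy" where "uminus_hardy f = (-1) *\<^sub>C f"
definition minus_hardy :: "hardy \<Rightarrow> hardy \<Rightarrow> hardy" where "minus_hardy f g = f + (-1) *\<^sub>C g"

instance
proof
  fix a b c :: hardy
  show "a + b + c = a + (b + c)" "a + b = b + a" "0 + a = a"
    by (transfer; simp add: algebra_simps)+
  show "- a + a = 0" unfolding uminus_hardy_def by (transfer; simp)
  show "a - b = a + - b" unfolding uminus_hardy_def minus_hardy_def ..
qed

end

lemma hcoeff_add [simp]: "hcoeff (f + g) n = hcoeff f n + hcoeff g n"
  by (simp add: plus_hardy.rep_eq taylor_coeff_add holomorphic_hardy_fun)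

lemma hcoeff_scaleC [simp]: "hcoeff (c *\<^sub>C f) n = c * hcoeff f n"
  by (simp add: scaleC_hardy.rep_eq taylor_coeff_cmult holomorphic_hardy_fun)

lemma hcoeff_0 [simp]: "hcoeff 0 n = 0"
  by (simp add: zero_hardy.rep_eq fps_expansion_def)

lemma hcoeff_diff [simp]: "hcoeff (f - g) n = hcoeff f n - hcoeff g n"
  by (simp add: minus_hardy_def)

instantiation hardy :: real_vector
begin

definition scaleR_hardy :: "real \<Rightarrow> hardy \<Rightarrow> hardy"
  where "scaleR_hardy r f = of_real r *\<^sub>C f"

instance
proof
  fix x y :: hardy and r s :: real
  show "r *\<^sub>R (x + y) = r *\<^sub>R x + r *\<^sub>R y" "(r + s) *\<^sub>R x = r *\<^sub>R x + s *\<^sub>R x"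
    "r *\<^sub>R s *\<^sub>R x = (r * s) *\<^sub>R x" "1 *\<^sub>R x = x"
    unfolding scaleR_hardy_def by (rule hardy_eqI; simp add: algebra_simps)+
qed

end

instantiation hardy :: complex_inner
begin

definition cinner_hardy :: "hardy \<Rightarrow> hardy \<Rightarrow> complex"
  where "cinner_hardy f g = (\<Sum>n. hcoeff f n * cnj (hcoeff g n))"

definition inner_hardy :: "hardy \<Rightarrow> hardy \<Rightarrow> real"
  where "inner_hardy f g = Re (cinner f g)"

definition norm_hardy :: "hardy \<Rightarrow> real"
  where "norm_hardy f = sqrt (inner f f)"

definition sgn_hardy :: "hardy \<Rightarrow> hardy"
  where "sgn_hardy f = f /\<^sub>R norm f"

definition dist_hardy :: "hardy \<Rightarrow> hardy \<Rightarrow> real"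
  where "dist_hardy f g = norm (f - g)"

definition uniformity_hardy :: "(hardy \<times> hardy) filter"
  where [code del]: "uniformity_hardy = (INF e\<in>{0<..}. principal {(x, y). dist x y < e})"

definition open_hardy :: "hardy set \<Rightarrow> bool"
  where [code del]: "open_hardy S = (\<forall>x\<in>S. \<forall>\<^sub>F (x', y) in uniformity. x' = x \<longrightarrow> y \<in> S)"

instance
proof
  fix x y z :: hardy and c d :: complex and r :: real
  have sm: "summable (\<lambda>n. hcoeff f n * cnj (hcoeff g n))" for f g
    by (intro summable_mult_cnj summable_hcoeff)
  have sq: "cinner x x = of_real (\<Sum>n. (cmod (hcoeff x n))\<^sup>2)"
    unfolding cinner_hardy_def by (rule suminf_mult_cnj_self[OF summable_hcoeff])
  show "c *\<^sub>C (x + y) = c *\<^sub>C x + c *\<^sub>C y" "(c + d) *\<^sub>C x = c *\<^sub>C x + d *\<^sub>C x"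
    by (rule hardy_eqI; simp add: algebra_simps)+
  show "c *\<^sub>C d *\<^sub>C x = (c * d) *\<^sub>C x" by (rule hardy_eqI; simp add: algebra_simps)
  show "r *\<^sub>R x = of_real r *\<^sub>C x" by (simp add: scaleR_hardy_def)
  show comm: "cinner x y = cnj (cinner y x)" for x y :: hardy
    unfolding cinner_hardy_def by (simp add: bounded_linear.suminf[OF bounded_linear_cnj sm] mult.commute)
  show add: "cinner (x + y) z = cinner x z + cinner y z"
    unfolding cinner_hardy_def by (simp add: suminf_add[OF sm sm] algebra_simps)
  show scale: "cinner (c *\<^sub>C x) y = c * cinner x y" for c
    unfolding cinner_hardy_def by (simp add: suminf_mult[OF sm] mult.assoc)
  show "inner x y = Re (cinner x y)" by (simp add: inner_hardy_def)
  show "sgn x = x /\<^sub>R norm x" "dist x y = norm (x - y)" "norm x = sqrt (inner x x)"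
    by (simp_all add: sgn_hardy_def dist_hardy_def norm_hardy_def)
  show "uniformity = (INF e\<in>{0<..}. principal {(x :: hardy, y). dist x y < e})"
    by (rule uniformity_hardy_def)
  show "open S = (\<forall>x\<in>S. \<forall>\<^sub>F (x', y) in uniformity. x' = x \<longrightarrow> y \<in> S)" for S :: "hardy set"
    by (rule open_hardy_def)
  show "inner x y = inner y x"
    unfolding inner_hardy_def using comm[of x y] by simp
  show "inner (x + y) z = inner x z + inner y z" by (simp add: inner_hardy_def add)
  show "inner (r *\<^sub>R x) y = r * inner x y" by (simp add: inner_hardy_def scaleR_hardy_def scale)
  show "0 \<le> inner x x" by (simp add: inner_hardy_def sq suminf_nonneg summable_hcoeff)
  show "inner x x = 0 \<longleftrightarrow> x = 0"
  proof
    assume "inner x x = 0"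
    then have "\<And>n. hcoeff x n = 0"
      using suminf_eq_zero_iff[OF summable_hcoeff[of x]] by (simp add: inner_hardy_def sq)
    then show "x = 0" by (intro hardy_eqI) simp
  qed (simp add: inner_hardy_def cinner_hardy_def)
qed

end

lemma norm_hardy_square: "(norm f)\<^sup>2 = (\<Sum>n. (cmod (hcoeff f n))\<^sup>2)"
proof -
  have "cinner f f = of_real (\<Sum>n. (cmod (hcoeff f n))\<^sup>2)"
    unfolding cinner_hardy_def by (rule suminf_mult_cnj_self[OF summable_hcoeff])
  then have "inner f f = (\<Sum>n. (cmod (hcoeff f n))\<^sup>2)" by (simp add: inner_eq_Re_cinner)
  then show ?thesis by (simp add: power2_norm_eq_inner)
qed

lemma sum_hcoeff_le: "(\<Sum>n<N. (cmod (hcoeff f n))\<^sup>2) \<le> (norm f)\<^sup>2"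
  unfolding norm_hardy_square by (intro sum_le_suminf summable_hcoeff) auto

lemma hcoeff_le: "cmod (hcoeff f n) \<le> norm f"
proof -
  have "(cmod (hcoeff f n))\<^sup>2 \<le> (\<Sum>k<Suc n. (cmod (hcoeff f k))\<^sup>2)"
    by (simp add: sum_nonneg)
  also have "\<dots> \<le> (norm f)\<^sup>2" by (rule sum_hcoeff_le)
  finally show ?thesis by (rule power2_le_imp_le) simp
qed

lemma hardy_of_coeffs:
  assumes c: "summable (\<lambda>n. (cmod (c n))\<^sup>2)"
  shows "\<exists>f. \<forall>n. hcoeff f n = c n"
proof -
  have "eventually (\<lambda>n. (cmod (c n))\<^sup>2 < 1) sequentially"
    using summable_LIMSEQ_zero[OF c] by (rule order_tendstoD) simp
  then have ev: "eventually (\<lambda>n. cmod (c n) \<le> 1) sequentially"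
    by eventually_elim (metis abs_norm_cancel abs_square_less_1 less_imp_le)
  have rad: "fps_conv_radius (Abs_fps c) \<ge> 1"
    unfolding fps_conv_radius_def
  proof (rule conv_radius_geI_ex')
    fix r :: real assume r: "0 < r" "ereal r < 1"
    show "summable (\<lambda>n. fps_nth (Abs_fps c) n * of_real r ^ n)"
    proof (rule summable_comparison_test_ev)
      show "summable (\<lambda>n. r ^ n)" using r by (simp add: summable_geometric)
      show "\<forall>\<^sub>F n in sequentially. norm (fps_nth (Abs_fps c) n * of_real r ^ n) \<le> r ^ n"
        using ev by eventually_elim
          (use r in \<open>auto simp: norm_mult norm_power intro!: mult_left_le_one_le\<close>)
    qed
  qed
  define g where "g = (\<lambda>z. if z \<in> ball 0 1 then eval_fps (Abs_fps c) z else 0)"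
  have sub: "ball (0 :: complex) 1 \<subseteq> eball 0 (fps_conv_radius (Abs_fps c))"
  proof
    fix z :: complex assume "z \<in> ball 0 1"
    then have "ereal (norm z) < 1" by (simp add: one_ereal_def)
    then show "z \<in> eball 0 (fps_conv_radius (Abs_fps c))"
      using less_le_trans[OF _ rad] by (simp add: in_eball_iff)
  qed
  have "eval_fps (Abs_fps c) holomorphic_on ball 0 1"
    by (rule holomorphic_on_eval_fps[OF sub])
  then have hol: "g holomorphic_on ball 0 1"
    by (rule holomorphic_transform) (simp add: g_def)
  have "g has_fps_expansion Abs_fps c"
    unfolding has_fps_expansion_def
  proof
    show "fps_conv_radius (Abs_fps c) > 0" using rad by (rule less_le_trans[rotated]) simp
    have "eventually (\<lambda>z. z \<in> ball 0 1) (nhds (0::complex))"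
      by (rule eventually_nhds_in_open) auto
    then show "\<forall>\<^sub>F z in nhds 0. eval_fps (Abs_fps c) z = g z"
      by eventually_elim (simp add: g_def)
  qed
  from fps_nth_fps_expansion[OF this] have co: "taylor_coeff g n = c n" for n
    by (simp add: fps_expansion_def)
  have "hardy_fun (Abs_hardy g) = g"
    by (rule Abs_hardy_inverse) (use hol co c in \<open>auto simp: g_def\<close>)
  then show ?thesis using co by metis
qed

instance hardy :: chilbert_space
proof
  fix X :: "nat \<Rightarrow> hardy" assume X: "Cauchy X"
  have "Cauchy (\<lambda>k. hcoeff (X k) n)" for n
  proof (rule metric_CauchyI)
    fix e :: real assume "e > 0"
    then obtain M where M: "\<And>m k. m \<ge> M \<Longrightarrow> k \<ge> M \<Longrightarrow> dist (X m) (X k) < e"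
      using metric_CauchyD[OF X] by blast
    have "dist (hcoeff (X m) n) (hcoeff (X k) n) < e" if "m \<ge> M" "k \<ge> M" for m k
      using hcoeff_le[of "X m - X k" n] M[OF that] by (simp add: dist_norm)
    then show "\<exists>M. \<forall>m\<ge>M. \<forall>k\<ge>M. dist (hcoeff (X m) n) (hcoeff (X k) n) < e" by blast
  qed
  then have "\<forall>n. \<exists>l. (\<lambda>k. hcoeff (X k) n) \<longlonglongrightarrow> l"
    by (simp add: Cauchy_convergent_iff convergent_def)
  then obtain c where c: "\<And>n. (\<lambda>k. hcoeff (X k) n) \<longlonglongrightarrow> c n" by metis
  have bound: "\<exists>M. \<forall>m\<ge>M. \<forall>N. (\<Sum>n<N. (cmod (hcoeff (X m) n - c n))\<^sup>2) \<le> e\<^sup>2" if "e > 0" for e :: real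
  proof -
    obtain M where M: "\<And>m k. m \<ge> M \<Longrightarrow> k \<ge> M \<Longrightarrow> dist (X m) (X k) < e"
      using metric_CauchyD[OF X \<open>e > 0\<close>] by blast
    have "(\<Sum>n<N. (cmod (hcoeff (X m) n - c n))\<^sup>2) \<le> e\<^sup>2" if m: "m \<ge> M" for m N
    proof (rule LIMSEQ_le_const2)
      show "(\<lambda>k. \<Sum>n<N. (cmod (hcoeff (X m) n - hcoeff (X k) n))\<^sup>2)
              \<longlonglongrightarrow> (\<Sum>n<N. (cmod (hcoeff (X m) n - c n))\<^sup>2)"
        by (intro tendsto_intros c)
      have "(\<Sum>n<N. (cmod (hcoeff (X m) n - hcoeff (X k) n))\<^sup>2) \<le> e\<^sup>2" if "k \<ge> M" for k
      proof -
        have "(\<Sum>n<N. (cmod (hcoeff (X m - X k) n))\<^sup>2) \<le> (norm (X m - X k))\<^sup>2"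
          by (rule sum_hcoeff_le)
        also have "\<dots> \<le> e\<^sup>2"
          using M[OF m that] by (intro power_mono) (auto simp: dist_norm)
        finally show ?thesis by simp
      qed
      then show "\<exists>K. \<forall>k\<ge>K. (\<Sum>n<N. (cmod (hcoeff (X m) n - hcoeff (X k) n))\<^sup>2) \<le> e\<^sup>2" by blast
    qed
    then show ?thesis by blast
  qed
  obtain M where M: "\<And>N. (\<Sum>n<N. (cmod (hcoeff (X M) n - c n))\<^sup>2) \<le> 1"
    using bound[of 1] by auto
  have "summable (\<lambda>n. (cmod (hcoeff (X M) n - c n))\<^sup>2)"
    by (rule summableI_nonneg_bounded[OF _ M]) simp
  then have "summable (\<lambda>n. (cmod (c n - hcoeff (X M) n))\<^sup>2)"
    by (simp add: norm_minus_commute)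
  from summable_norm_square_add[OF this summable_hcoeff[of "X M"]]
  have "summable (\<lambda>n. (cmod (c n))\<^sup>2)" by simp
  then obtain f where f: "\<And>n. hcoeff f n = c n" using hardy_of_coeffs by blast
  have "X \<longlonglongrightarrow> f"
  proof (rule metric_LIMSEQ_I)
    fix e :: real assume e: "e > 0"
    then obtain M where M: "\<And>m N. m \<ge> M \<Longrightarrow> (\<Sum>n<N. (cmod (hcoeff (X m) n - c n))\<^sup>2) \<le> (e/2)\<^sup>2"
      using bound[of "e/2"] by auto
    have "dist (X m) f < e" if "m \<ge> M" for m
    proof -
      have "(norm (X m - f))\<^sup>2 \<le> (e/2)\<^sup>2"
        unfolding norm_hardy_square
        by (rule suminf_le_const[OF summable_hcoeff]) (use M[OF that] f in simp)
      then have "norm (X m - f) \<le> e/2" by (rule power2_le_imp_le) (use e in simp)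
      then show ?thesis using e by (simp add: dist_norm)
    qed
    then show "\<exists>M. \<forall>m\<ge>M. dist (X m) f < e" by blast
  qed
  then show "convergent X" by (rule convergentI)
qed

definition disk_involution :: "complex \<Rightarrow> complex \<Rightarrow> complex"
  where "disk_involution a z = (a - z) / (1 - cnj a * z)"

text \<open>For \<open>cmod a < 1\<close> the composed function lies in the Hardy space again and the operator is
  bounded (Littlewood), so that neither \<open>Abs_hardy\<close> nor \<open>Blinfun\<close> is applied outside its range.\<close>

definition comp_op :: "complex \<Rightarrow> hardy \<Rightarrow>\<^sub>L hardy"
  where "comp_op a = Blinfun (\<lambda>f. Abs_hardy
    (\<lambda>z. if z \<in> ball 0 1 then hardy_fun f (disk_involution a z) else 0))"

text \<open>The spectrum of \<open>H\<close> is the interval \<open>[1 - \<bar>a\<bar>\<^sup>2, 1]\<close>, so \<open>cfc H f\<close> only depends on the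
  values of \<open>f\<close> there.\<close>

definition model_algebra ::
  "complex \<Rightarrow> ('j::complex_inner \<Rightarrow>\<^sub>L 'j) \<Rightarrow> (complex \<times> (('j \<times> 'j) \<Rightarrow>\<^sub>L ('j \<times> 'j))) set"
  where "model_algebra a H =
    {(\<alpha>, block_op (cfc H f00) (cfc H f01) (cfc H f10) (cfc H f11)) | \<alpha> f00 f01 f10 f11.
      (\<forall>f\<in>{f00, f01, f10, f11}. continuous_on {1 - (cmod a)\<^sup>2..1} f) \<and>
      f00 1 = \<alpha> \<and> f01 1 = 0 \<and> f10 1 = 0}"

end

theory Submission
  imports Defs "HOL-Computational_Algebra.Fundamental_Theorem_Algebra"
begin

text \<open>Multiplied by the weight \<open>\<surd>(1 - \<bar>a\<bar>\<^sup>2) / (1 - cnj a * z)\<close>, the operator \<open>f \<mapsto> f \<circ> \<phi>\<close> becomes a selfadjoint unitary.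
  Hence \<open>\<parallel>C\<^sub>a\<parallel>\<^sup>2 \<le> (1 + \<bar>a\<bar>) / (1 - \<bar>a\<bar>)\<close>, and \<open>\<langle>C\<^sub>a f, C\<^sub>a g\<rangle> = \<langle>f, g\<rangle>\<close> for all \<open>g\<close> becomes a three-term
  recurrence for Taylor coefficients without square summable solutions, so the generic part is all of
  \<open>H\<^sup>2\<close>.  In Halmos' coordinates \<open>C\<^sub>a\<close> is the block matrix with rows \<open>(1, -2K)\<close> and \<open>(0, -1)\<close>, where
  \<open>K = cot X\<close> is the continuous function \<open>\<surd>((1 - t) / t)\<close> of \<open>H\<close>.  The norm bound says
  \<open>H \<ge> 1 - \<bar>a\<bar>\<^sup>2\<close>; reproducing kernels at points tending to a suitable boundary point show that
  \<open>C\<^sub>a - C\<^sub>a\<^sup>*\<close> is not bounded below, so that \<open>1\<close> is in the spectrum of \<open>H\<close>.  The block matrix generates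
  all \<open>f(H)\<close> on the diagonal and, off the diagonal, exactly the \<open>f(H)\<close> with \<open>f 1 = 0\<close>, since \<open>K\<close> vanishes
  only there.  As \<open>1\<close> is in the spectrum, the scalar \<open>\<alpha>\<close> is determined by the block operator.\<close>

section \<open>Complex inner product spaces\<close>

text \<open>The norm bound and the recurrence have one source: the operator is the weighted one
  followed by multiplication by \<open>(1 - cnj a * z) / sqrt s\<close> with
  \<open>s = 1 - (cmod a)\<^sup>2\<close>. That multiplier has norm at most
  \<open>(1 + cmod a) / sqrt s\<close>, and its Gram operator is tridiagonal. The block matrix
  arises because the operator is the identity on the vectors \<open>(p, 0)\<close> of
  \<open>L\<close> and minus the identity on the vectors \<open>(C w, S w)\<close> of
  \<open>N\<close>. The lower bound on \<open>H\<close> says that the cosine of the angle between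
  \<open>L\<close> and \<open>N\<close> is at most \<open>cmod a\<close>; it makes cot X a
  continuous function of \<open>H\<close>. The difference of the operator and its adjoint is
  off-diagonal with entries -2K and 2K, so its failure to be bounded below passes to
  \<open>K\<close>. The obstacle is that f(H) fixes \<open>f\<close> only on the spectrum of
  \<open>H\<close>, while the model algebra speaks of functions on the whole interval. Hence the
  isomorphism is built on block operators, with the scalar recovered afterwards, and closedness of
  the model requires an extension of functions from the spectrum to the interval.\<close>

lemma scaleC_one [simp]: "1 *\<^sub>C x = (x :: 'a::complex_inner)"
  using scaleR_scaleC[of 1 x] by simp

lemma scaleC_zero_left [simp]: "0 *\<^sub>C x = (0 :: 'a::complex_inner)"
  using scaleR_scaleC[of 0 x] by simp

lemma scaleC_zero_right [simp]: "c *\<^sub>C (0 :: 'a::complex_inner) = 0"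
  using scaleC_add_right[of c 0 "0::'a"] by simp

lemma scaleC_minus_left [simp]: "(- c) *\<^sub>C x = - (c *\<^sub>C (x :: 'a::complex_inner))"
  using scaleC_add_left[of c "- c" x] by (simp add: eq_neg_iff_add_eq_0 add.commute)

lemma scaleC_minus_right [simp]: "c *\<^sub>C (- x) = - (c *\<^sub>C (x :: 'a::complex_inner))"
  using scaleC_add_right[of c x "- x"] by (simp add: eq_neg_iff_add_eq_0 add.commute)

lemma scaleC_diff_left: "(c - d) *\<^sub>C x = c *\<^sub>C x - d *\<^sub>C (x :: 'a::complex_inner)"
  using scaleC_add_left[of c "- d" x] by simp

lemma scaleC_diff_right: "c *\<^sub>C (x - y) = c *\<^sub>C x - c *\<^sub>C (y :: 'a::complex_inner)"
  using scaleC_add_right[of c x "- y"] by simp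

lemma scaleC_sum_right: "c *\<^sub>C sum f A = (\<Sum>i\<in>A. c *\<^sub>C (f i :: 'a::complex_inner))"
  by (rule linear_sum[OF bounded_linear.linear[OF bounded_linear_scaleC]])

lemmas scaleC_simps = scaleC_add_left scaleC_add_right scaleC_diff_left scaleC_diff_right scaleC_scaleC

lemma cinner_add_right: "cinner x (y + z) = cinner x y + cinner x (z :: 'a::complex_inner)"
  by (metis cinner_add_left cinner_commute complex_cnj_add)

lemma cinner_scaleC_right: "cinner x (c *\<^sub>C y) = cnj c * cinner x (y :: 'a::complex_inner)"
  by (metis cinner_commute cinner_scaleC_left complex_cnj_mult)

lemma cinner_zero_left [simp]: "cinner 0 (y :: 'a::complex_inner) = 0"
  using cinner_scaleC_left[of 0 0 y] by simp

lemma cinner_zero_right [simp]: "cinner x (0 :: 'a::complex_inner) = 0"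
  using cinner_scaleC_right[of x 0 0] by simp

lemma cinner_minus_left [simp]: "cinner (- x) y = - cinner x (y :: 'a::complex_inner)"
  using cinner_scaleC_left[of "-1" x y] by simp

lemma cinner_minus_right [simp]: "cinner x (- y) = - cinner x (y :: 'a::complex_inner)"
  using cinner_scaleC_right[of x "-1" y] by simp

lemma cinner_diff_left: "cinner (x - y) z = cinner x z - cinner y (z :: 'a::complex_inner)"
  using cinner_add_left[of x "- y" z] by simp

lemma cinner_diff_right: "cinner x (y - z) = cinner x y - cinner x (z :: 'a::complex_inner)"
  using cinner_add_right[of x y "- z"] by simp

lemmas cinner_simps = cinner_add_left cinner_add_right cinner_diff_left cinner_diff_right
  cinner_scaleC_left cinner_scaleC_right

lemma cinner_norm: "cinner x x = of_real ((norm (x :: 'a::complex_inner))\<^sup>2)"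
proof -
  have "Im (cinner x x) = 0" using arg_cong[OF cinner_commute[of x x], of Im] by simp
  moreover have "Re (cinner x x) = (norm x)\<^sup>2"
    by (simp add: power2_norm_eq_inner inner_eq_Re_cinner)
  ultimately show ?thesis by (simp add: complex_eq_iff)
qed

text \<open>The real part of \<open>cinner x (\<i> *\<^sub>C y)\<close> is the imaginary part of
  \<open>cinner x y\<close>. Continuity and orthogonality thereby reduce to the real inner
  product.\<close>

lemma cinner_eq_inner:
  "cinner x y = Complex (inner x y) (inner x (\<i> *\<^sub>C (y :: 'a::complex_inner)))"
  by (simp add: complex_eq_iff inner_eq_Re_cinner cinner_scaleC_right)

lemma cinner_ext: "(\<And>x. cinner x y = cinner x z) \<Longrightarrow> y = (z :: 'a::complex_inner)"
proof -
  assume "\<And>x. cinner x y = cinner x z"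
  then have "cinner (y - z) (y - z) = 0" by (simp add: cinner_diff_right)
  then show "y = z" by (simp add: cinner_norm)
qed

text \<open>A unimodular multiple of \<open>x\<close> makes the product real and nonnegative, where
  the real Cauchy-Schwarz inequality applies.\<close>

lemma cmod_cinner_le: "cmod (cinner x y) \<le> norm x * norm (y :: 'a::complex_inner)"
proof (cases "cinner x y = 0")
  case False
  define c where "c = cnj (cinner x y) / cmod (cinner x y)"
  have c: "cmod c = 1" using False by (simp add: c_def norm_divide)
  have "cmod (cinner x y) = Re (cinner (c *\<^sub>C x) y)"
    using False unfolding c_def cinner_scaleC_left
    by (simp add: mult.commute[of "cnj _"] complex_norm_square[symmetric] power2_eq_square)
  also have "\<dots> = inner (c *\<^sub>C x) y" by (simp add: inner_eq_Re_cinner)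
  also have "\<dots> \<le> norm (c *\<^sub>C x) * norm y" by (rule norm_cauchy_schwarz)
  finally show ?thesis by (simp add: norm_scaleC c)
qed simp

lemma norm_add_square: "(norm (x + y))\<^sup>2 = (norm x)\<^sup>2 + (norm y)\<^sup>2 + 2 * Re (cinner x (y :: 'a::complex_inner))"
  by (simp add: power2_norm_eq_inner inner_add_left inner_add_right inner_commute[of y x] flip: inner_eq_Re_cinner)

lemma norm_diff_square: "(norm (x - y))\<^sup>2 = (norm x)\<^sup>2 + (norm y)\<^sup>2 - 2 * Re (cinner x (y :: 'a::complex_inner))"
  using norm_add_square[of x "- y"] by simp

lemma cinner_eq_zero_if_inner:
  assumes "\<And>c y. y \<in> M \<Longrightarrow> c *\<^sub>C y \<in> M" "\<And>y. y \<in> M \<Longrightarrow> inner x y = 0" "y \<in> M"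
  shows "cinner x (y :: 'a::complex_inner) = 0"
  using assms by (simp add: cinner_eq_inner complex_eq_iff)

section \<open>Projection theorem, Riesz representation and adjoints\<close>

text \<open>A minimizing sequence for the distance to \<open>x\<close> is Cauchy, and the first
  variation at its limit vanishes. For sets closed under complex scalars,
  \<open>cinner_eq_zero_if_inner\<close> upgrades the orthogonality.\<close>

lemma projection_exists:
  fixes x :: "'a::{real_inner,complete_space}"
  assumes "subspace M" "closed M"
  shows "\<exists>y\<in>M. \<forall>m\<in>M. inner (x - y) m = 0"
proof -
  define d where "d = (INF m\<in>M. (norm (x - m))\<^sup>2)"
  have ne: "M \<noteq> {}" using subspace_0[OF \<open>subspace M\<close>] by blast
  have bdd: "bdd_below ((\<lambda>m. (norm (x - m))\<^sup>2) ` M)" by (rule bdd_belowI[of _ 0]) auto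
  have d: "d \<le> (norm (x - m))\<^sup>2" if "m \<in> M" for m
    unfolding d_def by (rule cINF_lower[OF bdd that])
  have "\<exists>m\<in>M. (norm (x - m))\<^sup>2 < d + 1 / real (Suc n)" for n
    using cINF_less_iff[OF ne bdd, of "d + 1 / real (Suc n)"] by (simp add: d_def)
  then obtain m where m: "\<And>n. m n \<in> M" "\<And>n. (norm (x - m n))\<^sup>2 < d + 1 / real (Suc n)" by metis
  \<comment> \<open>The midpoint \<open>h\<close> stays in \<open>M\<close>, so the parallelogram
    law turns near-minimality of \<open>m i\<close> and \<open>m j\<close> into their
    closeness.\<close>
  have par: "(norm (m i - m j))\<^sup>2 \<le> 2 / real (Suc i) + 2 / real (Suc j)" for i j
  proof -
    define h where "h = (1/2) *\<^sub>R (m i + m j)"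
    have "h \<in> M" unfolding h_def by (intro subspace_scale subspace_add assms m)
    have "m i - m j = (x - m j) - (x - m i)" by simp
    moreover have "(norm ((x - m j) - (x - m i)))\<^sup>2 + (norm ((x - m j) + (x - m i)))\<^sup>2
        = 2 * (norm (x - m j))\<^sup>2 + 2 * (norm (x - m i))\<^sup>2"
      by (simp add: power2_norm_eq_inner inner_simps inner_commute)
    moreover have "(x - m j) + (x - m i) = 2 *\<^sub>R (x - h)"
      unfolding h_def by (simp add: scaleR_2 algebra_simps)
    ultimately have "(norm (m i - m j))\<^sup>2 = 2 * (norm (x - m j))\<^sup>2 + 2 * (norm (x - m i))\<^sup>2 - 4 * (norm (x - h))\<^sup>2"
      by (simp add: power_mult_distrib)
    then show ?thesis using m(2)[of i] m(2)[of j] d[OF \<open>h \<in> M\<close>] by simp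
  qed
  have "Cauchy m"
  proof (rule metric_CauchyI)
    fix e :: real assume e: "e > 0"
    obtain N where N: "4 / e\<^sup>2 < real N" using reals_Archimedean2 by blast
    have "dist (m i) (m j) < e" if "i \<ge> N" "j \<ge> N" for i j
    proof -
      have N0: "real N > 0" using N e by (meson less_trans divide_pos_pos zero_less_numeral zero_less_power)
      have "2 / real (Suc i) \<le> 2 / real N" "2 / real (Suc j) \<le> 2 / real N"
        using that N0 by (auto intro!: divide_left_mono)
      moreover have "4 / real N < e\<^sup>2" using N N0 e by (simp add: field_simps)
      ultimately have "(norm (m i - m j))\<^sup>2 < e\<^sup>2" using par[of i j] by linarith
      then show ?thesis using e by (simp add: dist_norm power_less_imp_less_base)
    qed
    then show "\<exists>N. \<forall>i\<ge>N. \<forall>j\<ge>N. dist (m i) (m j) < e" by blast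
  qed
  then obtain y where y: "m \<longlonglongrightarrow> y" using Cauchy_convergent convergent_def by blast
  have "y \<in> M" using closed_sequentially[OF \<open>closed M\<close> _ y] m by blast
  have lim: "(\<lambda>n. d + 1 / real (Suc n)) \<longlonglongrightarrow> d"
    using tendsto_add[OF tendsto_const LIMSEQ_inverse_real_of_nat, of d] by (simp add: inverse_eq_divide)
  have "(\<lambda>n. (norm (x - m n))\<^sup>2) \<longlonglongrightarrow> (norm (x - y))\<^sup>2" by (intro tendsto_intros y)
  then have yd: "(norm (x - y))\<^sup>2 \<le> d"
    by (rule LIMSEQ_le[OF _ lim]) (use m(2) less_imp_le in blast)
  have "inner (x - y) z = 0" if "z \<in> M" for z
  proof (rule ccontr)
    assume nz: "inner (x - y) z \<noteq> 0"
    then have z: "z \<noteq> 0" by auto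
    \<comment> \<open>This \<open>t\<close> minimizes the distance from \<open>x\<close> along the
      line through \<open>y\<close> in direction \<open>z\<close>; a nonzero inner product would
      push it below the infimum.\<close>
    define t where "t = inner (x - y) z / (norm z)\<^sup>2"
    have "y + t *\<^sub>R z \<in> M" by (intro subspace_add subspace_scale assms \<open>y \<in> M\<close> that)
    from d[OF this] yd have "(norm (x - y))\<^sup>2 \<le> (norm (x - (y + t *\<^sub>R z)))\<^sup>2" by (rule order_trans[rotated])
    also have "x - (y + t *\<^sub>R z) = (x - y) - t *\<^sub>R z" by simp
    also have "(norm \<dots>)\<^sup>2 = (norm (x - y))\<^sup>2 - 2 * t * inner (x - y) z + t\<^sup>2 * (norm z)\<^sup>2"
      unfolding power2_norm_eq_inner
      by (simp add: inner_diff_left inner_diff_right inner_commute algebra_simps power2_eq_square)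
    also have "\<dots> = (norm (x - y))\<^sup>2 - (inner (x - y) z)\<^sup>2 / (norm z)\<^sup>2"
      using z by (simp add: t_def field_simps power2_eq_square)
    finally have "(inner (x - y) z)\<^sup>2 / (norm z)\<^sup>2 \<le> 0" by simp
    then show False using nz z by (simp add: divide_le_0_iff)
  qed
  then show ?thesis using \<open>y \<in> M\<close> by blast
qed

lemma subspace_eq_UNIV:
  fixes M :: "'a::{real_inner,complete_space} set"
  assumes "subspace M" "closed M" "\<And>x. (\<And>m. m \<in> M \<Longrightarrow> inner x m = 0) \<Longrightarrow> x = 0"
  shows "M = UNIV"
proof -
  have "x \<in> M" for x
  proof -
    obtain y where y: "y \<in> M" "\<And>m. m \<in> M \<Longrightarrow> inner (x - y) m = 0"
      using projection_exists[OF assms(1,2), of x] by blast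
    then have "x - y = 0" using assms(3) by blast
    then show ?thesis using y by simp
  qed
  then show ?thesis by blast
qed

text \<open>The vector \<open>e\<close> is orthogonal to the kernel, and subtracting
  \<open>(f x / f e) *\<^sub>R e\<close> from \<open>x\<close> lands in the kernel.\<close>

lemma riesz_representation:
  fixes f :: "'a::{real_inner,complete_space} \<Rightarrow> real"
  assumes "bounded_linear f"
  shows "\<exists>y. \<forall>x. f x = inner x y"
proof (cases "\<exists>x. f x \<noteq> 0")
  case True
  then obtain x0 where x0: "f x0 \<noteq> 0" by blast
  interpret bounded_linear f by fact
  define M where "M = {x. f x = 0}"
  have "subspace M" by (auto simp: subspace_def M_def add scale zero)
  moreover have "closed M" unfolding M_def by (intro closed_Collect_eq continuous_on continuous_on_const) auto
  ultimately obtain y where y: "y \<in> M" "\<And>m. m \<in> M \<Longrightarrow> inner (x0 - y) m = 0"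
    using projection_exists by blast
  define e where "e = x0 - y"
  have fe: "f e = f x0" using y(1) by (simp add: e_def diff M_def)
  then have e0: "e \<noteq> 0" using x0 zero by auto
  have "f x = inner x ((f e / (norm e)\<^sup>2) *\<^sub>R e)" for x
  proof -
    have "x - (f x / f e) *\<^sub>R e \<in> M" using fe x0 by (simp add: M_def diff scale)
    from y(2)[OF this] have "inner x e = f x / f e * (norm e)\<^sup>2"
      unfolding e_def[symmetric]
      by (simp add: inner_diff_right inner_commute power2_norm_eq_inner)
    then show ?thesis using e0 fe x0 by simp
  qed
  then show ?thesis by blast
qed (auto intro: exI[of _ 0])

lemma blinfun_scaleC_apply [simp]: "blinfun_apply (c *\<^sub>C T) x = c *\<^sub>C T x"
  by (simp add: scaleC_blinfun.rep_eq)

lemma bopD: "T \<in> bop \<Longrightarrow> blinfun_apply T (c *\<^sub>C x) = c *\<^sub>C T x"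
  by (simp add: bop_def)

lemma bop_scaleC: "T \<in> bop \<Longrightarrow> c *\<^sub>C T \<in> bop"
  and bop_add: "T \<in> bop \<Longrightarrow> S \<in> bop \<Longrightarrow> T + S \<in> bop"
  and bop_diff: "T \<in> bop \<Longrightarrow> S \<in> bop \<Longrightarrow> T - S \<in> bop"
  and bop_uminus: "T \<in> bop \<Longrightarrow> - T \<in> bop"
  and bop_compose: "A \<in> bop \<Longrightarrow> B \<in> bop \<Longrightarrow> A o\<^sub>L B \<in> bop"
  and bop_zero: "0 \<in> bop"
  and bop_id: "id_blinfun \<in> bop"
  by (auto simp: bop_def blinfun.add_left blinfun.diff_left blinfun.minus_left scaleC_simps mult.commute)

lemmas bop_intros = bop_scaleC bop_add bop_diff bop_uminus bop_compose bop_zero bop_id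

lemma closed_bop: "closed (bop :: ('a::complex_inner \<Rightarrow>\<^sub>L 'b::complex_inner) set)"
proof -
  have "bop = (\<Inter>c. \<Inter>x. {T :: 'a \<Rightarrow>\<^sub>L 'b. T (c *\<^sub>C x) = c *\<^sub>C T x})" by (auto simp: bop_def)
  also have "closed \<dots>"
    by (intro closed_INT ballI closed_Collect_eq
        bounded_linear.continuous_on[OF bounded_linear_scaleC] continuous_intros)
  finally show ?thesis .
qed

lemma cadj_eqI:
  fixes T :: "'a::complex_inner \<Rightarrow>\<^sub>L 'b::complex_inner"
  assumes "\<And>x y. cinner (T x) y = cinner x (blinfun_apply S y)"
  shows "cadj T = S"
  unfolding cadj_def
proof (rule the_equality)
  fix R :: "'b \<Rightarrow>\<^sub>L 'a" assume R: "\<forall>x y. cinner (T x) y = cinner x (R y)"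
  show "R = S"
    by (rule blinfun_eqI, rule cinner_ext) (use R assms in metis)
qed (use assms in blast)

text \<open>Riesz representation yields the adjoint for the real inner product; multiplying
  \<open>x\<close> by \<open>- \<i>\<close>, which commutes with \<open>T\<close>, supplies the
  imaginary part.\<close>

lemma adjoint_exists:
  fixes T :: "'a::chilbert_space \<Rightarrow>\<^sub>L 'b::complex_inner"
  assumes T: "T \<in> bop"
  shows "\<exists>S\<in>bop. \<forall>x y. cinner (T x) y = cinner x (blinfun_apply S y)"
proof -
  have "\<exists>z. \<forall>x. inner (T x) y = inner x z" for y
    by (rule riesz_representation)
       (intro bounded_linear_compose[OF bounded_linear_inner_left] blinfun.bounded_linear_right)
  then obtain S where S: "\<And>x y. inner (T x) y = inner x (S y)" by metis
  have CS: "cinner (T x) y = cinner x (S y)" for x y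
  proof -
    have "cinner u v = Complex (inner u v) (inner (- (\<i> *\<^sub>C u)) v)" for u v :: "'c::complex_inner"
      by (simp add: complex_eq_iff inner_eq_Re_cinner cinner_scaleC_left)
    note this[of "T x" y] this[of x "S y"]
    moreover have "- (\<i> *\<^sub>C T x) = T (- (\<i> *\<^sub>C x))"
      by (simp add: blinfun.minus_right bopD[OF T])
    ultimately show ?thesis using S by simp
  qed
  have add: "S (y + z) = S y + S z" for y z
    by (rule cinner_ext) (simp add: CS[symmetric] cinner_simps)
  have scale: "S (c *\<^sub>C y) = c *\<^sub>C S y" for c y
    by (rule cinner_ext) (simp add: CS[symmetric] cinner_simps)
  have bnd: "norm (S y) \<le> norm y * norm T" for y
  proof (cases "S y = 0")
    case False
    have "norm (S y) * norm (S y) = inner (T (S y)) y"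
      by (simp add: S power2_norm_eq_inner[symmetric] power2_eq_square)
    also have "\<dots> \<le> norm (T (S y)) * norm y" by (rule norm_cauchy_schwarz)
    also have "\<dots> \<le> norm T * norm (S y) * norm y" by (intro mult_right_mono norm_blinfun) simp
    also have "\<dots> = (norm y * norm T) * norm (S y)" by simp
    finally show ?thesis using False by (simp only: mult_le_cancel_right) simp
  qed simp
  have "bounded_linear S"
    by (rule bounded_linear_intro[where K = "norm T"]) (use add scale bnd in \<open>auto simp: scaleR_scaleC\<close>)
  then have "Blinfun S y = S y" for y by (simp add: bounded_linear_Blinfun_apply)
  then show ?thesis using CS scale by (intro bexI[of _ "Blinfun S"]) (auto simp: bop_def)
qed

lemma
  fixes T :: "'a::chilbert_space \<Rightarrow>\<^sub>L 'b::complex_inner"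
  assumes T: "T \<in> bop"
  shows cinner_cadj: "cinner (T x) y = cinner x (cadj T y)" and bop_cadj: "cadj T \<in> bop"
proof -
  obtain S where S: "S \<in> bop" "\<And>x y. cinner (T x) y = cinner x (blinfun_apply S y)"
    using adjoint_exists[OF T] by blast
  then have "cadj T = S" by (intro cadj_eqI)
  then show "cinner (T x) y = cinner x (cadj T y)" "cadj T \<in> bop" using S by auto
qed

lemma cinner_cadj': "T \<in> bop \<Longrightarrow> cinner x (T y) = cinner (cadj T x) (y :: 'a::chilbert_space)"
  by (metis cinner_cadj cinner_commute)

lemma cadj_cadj: "T \<in> bop \<Longrightarrow> cadj (cadj T) = (T :: 'a::chilbert_space \<Rightarrow>\<^sub>L 'b::chilbert_space)"
  by (rule cadj_eqI) (simp add: cinner_cadj')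

text \<open>The lower bound gives injectivity and a closed range; a vector orthogonal to the range
  lies in the kernel of the adjoint, so the range is everything.\<close>

lemma invertible_if_bounded_below:
  fixes T :: "'a::chilbert_space \<Rightarrow>\<^sub>L 'b::chilbert_space"
  assumes T: "T \<in> bop" and d: "d > 0" "\<And>x. d * norm x \<le> norm (T x)"
    and inj: "\<And>y. cadj T y = 0 \<Longrightarrow> y = 0"
  shows "\<exists>R\<in>bop. R o\<^sub>L T = id_blinfun \<and> T o\<^sub>L R = id_blinfun"
proof -
  have sub: "subspace (range T)"
    by (rule linear_subspace_image) (auto simp: bounded_linear.linear blinfun.bounded_linear_right)
  have "complete (range T)"
    by (rule complete_isometric_image[OF d(1)]) (simp_all add: blinfun.bounded_linear_right complete_UNIV d(2))
  then have cl: "closed (range T)" by (simp add: complete_imp_closed)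
  have "range T = UNIV"
  proof (rule subspace_eq_UNIV[OF sub cl])
    fix y assume y: "\<And>m. m \<in> range T \<Longrightarrow> inner y m = 0"
    have "cinner x (cadj T y) = 0" for x
    proof -
      have "cinner y (T x) = 0"
      proof (rule cinner_eq_zero_if_inner[of "range T"])
        fix c m assume "m \<in> range T"
        then obtain z where "m = T z" by blast
        then have "c *\<^sub>C m = T (c *\<^sub>C z)" by (simp only: bopD[OF T])
        then show "c *\<^sub>C m \<in> range T" by blast
      qed (rule y, assumption, rule rangeI)
      then have "cinner (T x) y = 0" by (metis cinner_commute complex_cnj_zero)
      then show ?thesis by (simp add: cinner_cadj[OF T])
    qed
    then have "cadj T y = 0" using cinner_ext[of "cadj T y" 0] by simp
    then show "y = 0" by (rule inj)
  qed
  then have s: "surj T" .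
  have inj: "inj T"
  proof (rule injI)
    fix x y assume "T x = T y"
    then have "T (x - y) = 0" by (simp add: blinfun.diff_right)
    then have "d * norm (x - y) \<le> 0" using d(2)[of "x - y"] by simp
    then show "x = y" using d(1) by (simp add: mult_le_0_iff)
  qed
  define R where "R = inv T"
  have TR: "T (R y) = y" for y by (simp add: R_def surj_f_inv_f[OF s])
  have RT: "R (T x) = x" for x by (simp add: R_def inv_f_f[OF inj])
  have add: "R (x + y) = R x + R y" for x y by (rule injD[OF inj]) (simp add: TR blinfun.add_right)
  have scale: "R (c *\<^sub>C x) = c *\<^sub>C R x" for c x by (rule injD[OF inj]) (simp add: TR bopD[OF T])
  have "bounded_linear R"
  proof (rule bounded_linear_intro[where K = "1 / d"])
    show "norm (R x) \<le> norm x * (1 / d)" for x using d(2)[of "R x"] d(1) by (simp add: TR field_simps)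
  qed (use add scale in \<open>auto simp: scaleR_scaleC\<close>)
  then have R: "Blinfun R y = R y" for y by (simp add: bounded_linear_Blinfun_apply)
  show ?thesis
    by (rule bexI[of _ "Blinfun R"]) (auto simp: bop_def R scale TR RT intro: blinfun_eqI)
qed

section \<open>Spectrum and functional calculus of selfadjoint operators\<close>

definition selfadj :: "('a::complex_inner \<Rightarrow>\<^sub>L 'a) \<Rightarrow> bool"
  where "selfadj T \<longleftrightarrow> T \<in> bop \<and> (\<forall>x y. cinner (T x) y = cinner x (T y))"

text \<open>For a selfadjoint operator this is the whole spectrum by \<open>spectrum_real\<close>;
  it is also the set over which \<open>cfc\<close> takes uniform limits.\<close>

abbreviation rspec :: "('a::complex_inner \<Rightarrow>\<^sub>L 'a) \<Rightarrow> real set"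
  where "rspec T \<equiv> {t. of_real t \<in> spectrum T}"

lemma norm_cadj_le:
  fixes T :: "'a::chilbert_space \<Rightarrow>\<^sub>L 'b::complex_inner"
  assumes "T \<in> bop"
  shows "norm (cadj T) \<le> norm T"
proof (rule norm_blinfun_bound)
  fix y
  have "norm (cadj T y) * norm (cadj T y) = cmod (cinner (T (cadj T y)) y)"
    by (simp add: cinner_cadj[OF assms] cinner_norm norm_mult power2_eq_square)
  also have "\<dots> \<le> norm (T (cadj T y)) * norm y" by (rule cmod_cinner_le)
  also have "\<dots> \<le> norm T * norm (cadj T y) * norm y" by (intro mult_right_mono norm_blinfun) simp
  finally have "norm (cadj T y) * norm (cadj T y) \<le> (norm T * norm y) * norm (cadj T y)"
    by (simp add: mult_ac)
  then show "norm (cadj T y) \<le> norm T * norm y"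
    by (cases "cadj T y = 0") (simp_all only: mult_le_cancel_right, simp_all)
qed simp

section \<open>Polynomials of an operator\<close>

lemma poly_op_eq_sum:
  "degree p \<le> n \<Longrightarrow> poly_op p T = (\<Sum>i\<le>n. coeff p i *\<^sub>C (((o\<^sub>L) T) ^^ i) id_blinfun)"
  unfolding poly_op_def
  by (rule sum.mono_neutral_left) (auto simp: coeff_eq_0 intro!: blinfun_eqI)

lemma poly_op_0 [simp]: "poly_op 0 T = 0"
  by (rule blinfun_eqI) (simp add: poly_op_def)

lemma poly_op_pCons: 
  fixes T :: "'a::complex_inner \<Rightarrow>\<^sub>L 'a"
  shows "T \<in> bop \<Longrightarrow> poly_op (pCons c p) T = c *\<^sub>C id_blinfun + (T o\<^sub>L poly_op p T)"
proof -
  assume T: "T \<in> bop"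
  have "poly_op (pCons c p) T = (\<Sum>i\<le>Suc (degree p). coeff (pCons c p) i *\<^sub>C (((o\<^sub>L) T) ^^ i) id_blinfun)"
    by (rule poly_op_eq_sum) (simp add: degree_pCons_le)
  also have "\<dots> = c *\<^sub>C id_blinfun + (T o\<^sub>L poly_op p T)"
    unfolding poly_op_def sum.atMost_Suc_shift
    by (rule blinfun_eqI) (simp add: blinfun.add_left blinfun.sum_left blinfun.sum_right bopD[OF T])
  finally show ?thesis .
qed

lemma poly_op_const [simp]: "poly_op [:c:] T = c *\<^sub>C id_blinfun"
  by (rule blinfun_eqI) (simp add: poly_op_def)

lemma poly_op_add: "poly_op (p + q) T = poly_op p T + poly_op q T"
proof -
  define n where "n = max (degree p) (degree q)"
  have "degree p \<le> n" "degree q \<le> n" "degree (p + q) \<le> n"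
    by (auto simp: n_def degree_add_le_max)
  from this[THEN poly_op_eq_sum, of T] show ?thesis
    by (intro blinfun_eqI) (simp add: blinfun.add_left blinfun.sum_left scaleC_simps sum.distrib)
qed

lemma poly_op_smult: "poly_op (smult c p) T = c *\<^sub>C poly_op p T"
  unfolding poly_op_eq_sum[OF degree_smult_le] poly_op_def[of p]
  by (rule blinfun_eqI) (simp add: blinfun.sum_left scaleC_sum_right scaleC_scaleC)

lemma poly_op_diff: "poly_op (p - q) T = poly_op p T - poly_op q T"
  using poly_op_add[of "p - q" q T] by simp

lemma poly_op_mult:
  assumes T: "T \<in> bop"
  shows "poly_op (p * q) T = poly_op p T o\<^sub>L poly_op q T"
proof (induction p)
  case 0
  show ?case by (rule blinfun_eqI) simp
next
  case (pCons c p)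
  have "poly_op (pCons c p * q) T = c *\<^sub>C poly_op q T + (T o\<^sub>L poly_op p T o\<^sub>L poly_op q T)"
    by (rule blinfun_eqI) (simp add: poly_op_add poly_op_smult poly_op_pCons[OF T] pCons.IH blinfun.add_left)
  also have "\<dots> = poly_op (pCons c p) T o\<^sub>L poly_op q T"
    by (rule blinfun_eqI) (simp add: poly_op_pCons[OF T] blinfun.add_left)
  finally show ?case .
qed

lemma bop_poly_op: "T \<in> bop \<Longrightarrow> poly_op p T \<in> bop"
  by (induction p) (auto simp: poly_op_pCons intro!: bop_intros)

lemma selfadj_bop: "selfadj T \<Longrightarrow> T \<in> bop" by (simp add: selfadj_def)

lemma selfadj_cinner: "selfadj T \<Longrightarrow> cinner (T x) y = cinner x (T y)" by (simp add: selfadj_def)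

lemma selfadj_cinner_real:
  assumes "selfadj T"
  shows "cinner (T x) x = of_real (Re (cinner (T x) x))"
proof -
  have "cinner (T x) x = cnj (cinner (T x) x)" using selfadj_cinner[OF assms] cinner_commute by metis
  then show ?thesis by (metis Reals_cnj_iff of_real_Re)
qed

lemma cadj_poly_op:
  fixes T :: "'a::chilbert_space \<Rightarrow>\<^sub>L 'a"
  assumes T: "selfadj T"
  shows "cadj (poly_op p T) = poly_op (map_poly cnj p) T"
proof (rule cadj_eqI)
  note poly_op_pCons[OF selfadj_bop[OF T], simp]
  \<comment> \<open>Adjoints reverse the order of factors; commutativity of polynomial
    multiplication restores it.\<close>
  have comm: "T (poly_op p T x) = poly_op p T (T x)" for p x
  proof -
    have eq: "poly_op [:0, 1:] T = T" by (rule blinfun_eqI) (simp add: blinfun.add_left)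
    have "poly_op [:0, 1:] T o\<^sub>L poly_op p T = poly_op p T o\<^sub>L poly_op [:0, 1:] T"
      by (simp only: poly_op_mult[OF selfadj_bop[OF T], symmetric] mult.commute)
    then show ?thesis unfolding eq by (metis blinfun_apply_blinfun_compose)
  qed
  show "cinner (poly_op p T x) y = cinner x (poly_op (map_poly cnj p) T y)" for x y
  proof (induction p arbitrary: x y)
    case (pCons c p)
    then show ?case
      by (simp add: map_poly_pCons cinner_simps blinfun.add_left selfadj_cinner[OF T] comm)
  qed simp
qed

text \<open>For the vector \<open>A\<close> belonging to the real part of \<open>z\<close>,
  \<open>cinner A x\<close> is real, so the cross term of \<open>A\<close> with an imaginary
  multiple of \<open>x\<close> drops out.\<close>

lemma norm_resolvent:
  assumes T: "selfadj T"
  shows "(norm (z *\<^sub>C x - T x))\<^sup>2 = (norm (of_real (Re z) *\<^sub>C x - T x))\<^sup>2 + (Im z)\<^sup>2 * (norm x)\<^sup>2"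
proof -
  define A where "A = of_real (Re z) *\<^sub>C x - T x"
  have "cinner A x = of_real (Re (cinner A x))"
    unfolding A_def using selfadj_cinner_real[OF T, of x]
    by (simp add: cinner_simps cinner_norm complex_eq_iff)
  then have "Im (cinner A x) = 0" by (metis Im_complex_of_real)
  moreover have "z *\<^sub>C x - T x = A + (\<i> * of_real (Im z)) *\<^sub>C x"
    unfolding A_def by (subst complex_eq[of z]) (simp only: scaleC_add_left, simp)
  ultimately show ?thesis
    by (simp add: norm_add_square cinner_simps norm_scaleC power_mult_distrib norm_mult flip: A_def)
qed

text \<open>By \<open>norm_resolvent\<close> the norm sees the imaginary part of \<open>z\<close>
  only through its square, so the adjoint, which belongs to \<open>cnj z\<close>, inherits the lower
  bound and is injective.\<close>

lemma not_in_spectrum: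
  fixes T :: "'a::chilbert_space \<Rightarrow>\<^sub>L 'a"
  assumes T: "selfadj T" and d: "d > 0" "\<And>x. d * norm x \<le> norm (z *\<^sub>C x - T x)"
  shows "z \<notin> spectrum T"
proof -
  define N where "N = z *\<^sub>C id_blinfun - T"
  have N: "N \<in> bop" unfolding N_def by (intro bop_intros selfadj_bop[OF T])
  have Nx: "N x = z *\<^sub>C x - T x" for x by (simp add: N_def blinfun.diff_left)
  have "cadj N = cnj z *\<^sub>C id_blinfun - T"
    by (rule cadj_eqI) (simp add: N_def blinfun.diff_left cinner_simps selfadj_cinner[OF T])
  then have "(norm (cadj N y))\<^sup>2 = (norm (N y))\<^sup>2" for y
    using norm_resolvent[OF T, of z y] norm_resolvent[OF T, of "cnj z" y]
    by (simp add: Nx blinfun.diff_left)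
  then have "norm (cadj N y) = norm (N y)" for y
    by (rule power2_eq_imp_eq) simp_all
  then have "cadj N y = 0 \<Longrightarrow> y = 0" for y
    using d(2)[of y] d(1) by (metis Nx mult_le_0_iff norm_eq_zero norm_le_zero_iff not_le)
  then show ?thesis
    using invertible_if_bounded_below[OF N d(1)] d(2) unfolding spectrum_def N_def
    by (auto simp: blinfun.diff_left)
qed

lemma spectrum_real:
  fixes T :: "'a::chilbert_space \<Rightarrow>\<^sub>L 'a"
  assumes T: "selfadj T" and z: "z \<in> spectrum T"
  shows "z = of_real (Re z)"
proof (rule ccontr)
  assume "z \<noteq> of_real (Re z)"
  then have "\<bar>Im z\<bar> > 0" by (simp add: complex_eq_iff)
  moreover have "\<bar>Im z\<bar> * norm x \<le> norm (z *\<^sub>C x - T x)" for x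
    by (rule power2_le_imp_le) (simp_all add: norm_resolvent[OF T, of z] power_mult_distrib)
  ultimately show False using not_in_spectrum[OF T] z by blast
qed

text \<open>The contrapositive of \<open>not_in_spectrum\<close>, with the violating vector
  normalized. Together with \<open>in_rspecI\<close> it describes the spectrum by approximate
  eigenvectors.\<close>

lemma approximate_eigenvector:
  fixes T :: "'a::chilbert_space \<Rightarrow>\<^sub>L 'a"
  assumes T: "selfadj T" and t: "t \<in> rspec T" and e: "e > 0"
  shows "\<exists>x. norm x = 1 \<and> norm (T x - t *\<^sub>R x) < e"
proof -
  have "\<not> (\<forall>x. e * norm x \<le> norm (of_real t *\<^sub>C x - T x))"
    using not_in_spectrum[OF T e] t by blast
  then obtain y where y: "norm (T y - t *\<^sub>R y) < e * norm y"
    by (auto simp: not_le norm_minus_commute scaleR_scaleC)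
  then have y0: "norm y > 0" by (metis mult_zero_right norm_ge_zero norm_zero not_le zero_less_norm_iff)
  have "T (y /\<^sub>R norm y) - t *\<^sub>R (y /\<^sub>R norm y) = (T y - t *\<^sub>R y) /\<^sub>R norm y"
    by (simp add: blinfun.scaleR_right scaleR_diff_right mult.commute)
  then have "norm (T (y /\<^sub>R norm y) - t *\<^sub>R (y /\<^sub>R norm y)) = norm (T y - t *\<^sub>R y) / norm y"
    by (simp only: norm_scaleR) (simp add: divide_inverse_commute)
  also have "\<dots> < e" using y y0 by (simp only: pos_divide_less_eq)
  finally have "norm (T (y /\<^sub>R norm y) - t *\<^sub>R (y /\<^sub>R norm y)) < e" .
  then show ?thesis using y0 by (intro exI[of _ "y /\<^sub>R norm y"]) simp
qed

lemma bounded_below_if_left_inverse: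
  assumes "S o\<^sub>L T = id_blinfun"
  shows "\<exists>d>0. \<forall>x. d * norm x \<le> norm (blinfun_apply T x)"
proof (intro exI[of _ "1 / (norm S + 1)"] conjI allI)
  have pos: "norm S + 1 > 0" by (rule add_nonneg_pos) simp_all
  then show "1 / (norm S + 1) > 0" by simp
  fix x
  have "norm x = norm (S (T x))" using assms by (metis blinfun_apply_blinfun_compose id_blinfun.rep_eq id_apply)
  also have "\<dots> \<le> norm S * norm (T x)" by (rule norm_blinfun)
  also have "\<dots> \<le> (norm S + 1) * norm (T x)" by (simp add: mult_right_mono)
  finally have "norm x / (norm S + 1) \<le> norm (T x)"
    using pos by (simp only: pos_divide_le_eq mult.commute)
  then show "1 / (norm S + 1) * norm x \<le> norm (T x)" by simp
qed

lemma in_rspecI: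
  fixes T :: "'a::complex_inner \<Rightarrow>\<^sub>L 'a"
  assumes "\<And>e. e > 0 \<Longrightarrow> \<exists>x. x \<noteq> 0 \<and> norm (T x - t *\<^sub>R x) < e * norm x"
  shows "t \<in> rspec T"
proof (rule ccontr)
  assume "t \<notin> rspec T"
  then obtain S where "S o\<^sub>L (of_real t *\<^sub>C id_blinfun - T) = id_blinfun" by (auto simp: spectrum_def)
  then obtain d where d: "d > 0" "\<And>x. d * norm x \<le> norm (of_real t *\<^sub>C x - T x)"
    using bounded_below_if_left_inverse by (force simp: blinfun.diff_left)
  obtain x where "norm (T x - t *\<^sub>R x) < d * norm x" using assms[OF d(1)] by blast
  with d(2)[of x] show False by (simp add: norm_minus_commute scaleR_scaleC)
qed

text \<open>An approximate eigenvector for a nearby spectral point serves the limit as well, up to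
  the distance of the two points.\<close>

lemma closed_rspec:
  fixes T :: "'a::chilbert_space \<Rightarrow>\<^sub>L 'a"
  assumes T: "selfadj T"
  shows "closed (rspec T)"
proof (rule closed_sequential_limits[THEN iffD2], intro allI impI, elim conjE)
  fix s l assume s: "\<forall>n. s n \<in> rspec T" "s \<longlonglongrightarrow> l"
  show "l \<in> rspec T"
  proof (rule in_rspecI)
    fix e :: real assume e: "e > 0"
    then obtain n where n: "dist (s n) l < e / 2" using metric_LIMSEQ_D[OF s(2), of "e/2"] by auto
    obtain x where x: "norm x = 1" "norm (T x - s n *\<^sub>R x) < e / 2"
      using approximate_eigenvector[OF T, of "s n" "e/2"] s e by auto
    have "norm (T x - l *\<^sub>R x) = norm ((T x - s n *\<^sub>R x) + (s n - l) *\<^sub>R x)" by (simp add: algebra_simps)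
    also have "\<dots> \<le> norm (T x - s n *\<^sub>R x) + norm ((s n - l) *\<^sub>R x)" by (rule norm_triangle_ineq)
    also have "\<dots> < e" using n x by (simp add: dist_real_def)
    finally show "\<exists>x. x \<noteq> 0 \<and> norm (T x - l *\<^sub>R x) < e * norm x" using x by (intro exI[of _ x]) auto
  qed
qed

text \<open>An approximate eigenvector of \<open>T\<close> for \<open>t\<close> is one of p(T) for
  p(t), because \<open>p\<close> minus its value at \<open>t\<close> is divisible by the linear
  polynomial with root \<open>t\<close>.\<close>

lemma cmod_poly_le_norm_poly_op:
  fixes T :: "'a::chilbert_space \<Rightarrow>\<^sub>L 'a"
  assumes T: "selfadj T" and t: "t \<in> rspec T"
  shows "cmod (poly p (of_real t)) \<le> norm (poly_op p T)"
proof (rule field_le_epsilon)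
  fix e :: real assume e: "e > 0"
  note B = selfadj_bop[OF T]
  define c where "c = poly p (of_real t)"
  have "poly (p - [:c:]) (of_real t) = 0" by (simp add: c_def)
  then obtain q where q: "p - [:c:] = q * [:- of_real t, 1:]"
    by (metis poly_eq_0_iff_dvd dvd_def mult.commute)
  then have "poly_op p T = poly_op (q * [:- of_real t, 1:] + [:c:]) T" by (metis diff_add_cancel)
  moreover have "poly_op [:- of_real t, 1:] T x = T x - t *\<^sub>R x" for x
    by (simp add: poly_op_pCons[OF B] blinfun.add_left blinfun.minus_left scaleR_scaleC)
  ultimately have pT: "poly_op p T x = poly_op q T (T x - t *\<^sub>R x) + c *\<^sub>C x" for x
    by (simp only: poly_op_add poly_op_mult[OF B] blinfun.add_left blinfun_apply_blinfun_compose) simp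
  define Q where "Q = norm (poly_op q T)"
  have Q1: "Q + 1 > 0" unfolding Q_def by (rule add_nonneg_pos) simp_all
  obtain x where x: "norm x = 1" "norm (T x - t *\<^sub>R x) < e / (Q + 1)"
    using approximate_eigenvector[OF T t, of "e / (Q + 1)"] e Q1 by auto
  have "cmod c = norm (c *\<^sub>C x)" by (simp add: norm_scaleC x)
  also have "c *\<^sub>C x = poly_op p T x - poly_op q T (T x - t *\<^sub>R x)" by (simp add: pT)
  also have "norm \<dots> \<le> norm (poly_op p T x) + norm (poly_op q T (T x - t *\<^sub>R x))" by (rule norm_triangle_ineq4)
  finally have "cmod c \<le> norm (poly_op p T x) + norm (poly_op q T (T x - t *\<^sub>R x))" .
  moreover have "norm (poly_op p T x) \<le> norm (poly_op p T)" using norm_blinfun[of "poly_op p T" x] x by simp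
  moreover have "norm (poly_op q T (T x - t *\<^sub>R x)) \<le> e"
  proof -
    have "norm (poly_op q T (T x - t *\<^sub>R x)) \<le> Q * norm (T x - t *\<^sub>R x)"
      unfolding Q_def by (rule norm_blinfun)
    also have "\<dots> \<le> (Q + 1) * (e / (Q + 1))"
      by (intro mult_mono) (use x in \<open>auto simp: Q_def\<close>)
    also have "\<dots> = e" using Q1 by simp
    finally show ?thesis .
  qed
  ultimately show "cmod (poly p (of_real t)) \<le> norm (poly_op p T) + e" unfolding c_def by linarith
qed

text \<open>Over the complex numbers \<open>Q\<close> splits into linear factors, each invertible at
  \<open>T\<close>; the induction on the degree removes one root at a time.\<close>

lemma poly_op_left_inverse:
  assumes T: "T \<in> bop" and Q: "Q \<noteq> 0" "\<And>z. poly Q z = 0 \<Longrightarrow> z \<notin> spectrum T"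
  shows "\<exists>R. R o\<^sub>L poly_op Q T = id_blinfun"
  using Q
proof (induction "degree Q" arbitrary: Q)
  case 0
  obtain c where c: "Q = [:c:]" using degree_eq_zeroE[OF 0(1)[symmetric]] by blast
  then have "c \<noteq> 0" using 0 by simp
  then have "((1/c) *\<^sub>C id_blinfun) o\<^sub>L poly_op Q T = id_blinfun"
    by (intro blinfun_eqI) (simp add: scaleC_scaleC c)
  then show ?case by blast
next
  case (Suc n)
  then have "\<not> constant (poly Q)" by (simp add: constant_degree)
  then obtain z where z: "poly Q z = 0" using fundamental_theorem_of_algebra by blast
  then obtain Q' where Q': "Q = [:-z, 1:] * Q'" by (auto simp: poly_eq_0_iff_dvd dvd_def)
  have "Q' \<noteq> 0" using Q' Suc.prems by auto
  then have "degree Q = degree [:-z, 1:] + degree Q'" unfolding Q' by (intro degree_mult_eq) auto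
  then have "n = degree Q'" using Suc.hyps by simp
  then obtain R where R: "R o\<^sub>L poly_op Q' T = id_blinfun"
    using Suc.hyps(1)[of Q'] Suc.prems \<open>Q' \<noteq> 0\<close> Q' by auto
  obtain S where S: "S o\<^sub>L (z *\<^sub>C id_blinfun - T) = id_blinfun"
    using Suc.prems(2)[OF z] by (auto simp: spectrum_def)
  have Sx: "S (T x - z *\<^sub>C x) = - x" for x
  proof -
    have "S (z *\<^sub>C x - T x) = x"
      using arg_cong[OF S, of "\<lambda>A. blinfun_apply A x"] by (simp add: blinfun.diff_left)
    then show ?thesis by (metis blinfun.minus_right minus_diff_eq)
  qed
  have Rx: "R (poly_op Q' T x) = x" for x
    using arg_cong[OF R, of "\<lambda>A. blinfun_apply A x"] by simp
  have "(- (R o\<^sub>L S)) o\<^sub>L poly_op Q T = id_blinfun"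
    unfolding Q' poly_op_mult[OF T]
    by (rule blinfun_eqI) (simp add: poly_op_pCons[OF T] blinfun.add_left blinfun.minus_left Sx Rx blinfun.minus_right
      del: add_uminus_conv_diff add: add.commute[of "- _" "blinfun_apply T _"] diff_conv_add_uminus[symmetric])
  then show ?case by blast
qed

text \<open>With \<open>m = \<parallel>p(T)\<parallel>\<^sup>2\<close>, the operator \<open>p(T)\<^sup>*p(T) - m\<close> is not bounded below, so one of its linear
  factors over the complex numbers is not invertible.\<close>

lemma norm_poly_op_attained:
  fixes T :: "'a::chilbert_space \<Rightarrow>\<^sub>L 'a"
  assumes T: "selfadj T" and p: "poly_op p T \<noteq> 0" "map_poly cnj p * p \<noteq> [:of_real ((norm (poly_op p T))\<^sup>2):]"
  shows "\<exists>t\<in>rspec T. cmod (poly p (of_real t)) = norm (poly_op p T)"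
proof -
  note B = selfadj_bop[OF T]
  define P where "P = poly_op p T"
  define m where "m = (norm P)\<^sup>2"
  have m0: "m > 0" using p by (simp add: m_def P_def)
  have P: "P \<in> bop" unfolding P_def by (rule bop_poly_op[OF B])
  define Q where "Q = map_poly cnj p * p - [:of_real m:]"
  have Qx: "poly_op Q T x = cadj P (P x) - m *\<^sub>R x" for x
    unfolding Q_def P_def cadj_poly_op[OF T]
    by (simp add: poly_op_diff poly_op_mult[OF B] blinfun.diff_left scaleR_scaleC)
  \<comment> \<open>Unit vectors on which \<open>P\<close> nearly attains its norm make the
    right-hand side small, so they are approximate null vectors of
    \<open>poly_op Q T\<close>.\<close>
  have nQ: "(norm (poly_op Q T x))\<^sup>2 \<le> m * (m * (norm x)\<^sup>2 - (norm (P x))\<^sup>2)" for x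
  proof -
    have "norm (cadj P (P x)) \<le> norm (cadj P) * norm (P x)" by (rule norm_blinfun)
    also have "\<dots> \<le> norm P * norm (P x)" by (intro mult_right_mono norm_cadj_le P) simp
    finally have "(norm (cadj P (P x)))\<^sup>2 \<le> (norm P * norm (P x))\<^sup>2" by (intro power_mono) auto
    then have 1: "(norm (cadj P (P x)))\<^sup>2 \<le> m * (norm (P x))\<^sup>2" by (simp add: m_def power_mult_distrib)
    have "(norm (poly_op Q T x))\<^sup>2 = (norm (cadj P (P x)))\<^sup>2 + m\<^sup>2 * (norm x)\<^sup>2 - 2 * m * Re (cinner (cadj P (P x)) x)"
      unfolding Qx norm_diff_square
      by (simp add: scaleR_scaleC cinner_scaleC_right norm_scaleC power_mult_distrib)
    also have "cinner (cadj P (P x)) x = of_real ((norm (P x))\<^sup>2)"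
      by (simp add: cinner_cadj'[OF P, symmetric] cinner_norm)
    finally show ?thesis using 1 by (simp add: algebra_simps power2_eq_square)
  qed
  have "\<not> (\<exists>d>0. \<forall>x. d * norm x \<le> norm (poly_op Q T x))"
  proof
    assume "\<exists>d>0. \<forall>x. d * norm x \<le> norm (poly_op Q T x)"
    then obtain d where d: "d > 0" "\<And>x. d * norm x \<le> norm (poly_op Q T x)" by blast
    \<comment> \<open>A lower bound \<open>d\<close> would make the norm of \<open>P\<close> smaller
      than itself: its square \<open>m\<close> would be at most
      \<open>max 0 (m - d\<^sup>2 / m)\<close>.\<close>
    have le: "(norm (P x))\<^sup>2 \<le> (m - d\<^sup>2 / m) * (norm x)\<^sup>2" for x
    proof -
      have "(d * norm x)\<^sup>2 \<le> (norm (poly_op Q T x))\<^sup>2" using d by (intro power_mono) auto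
      with nQ[of x] have "d\<^sup>2 * (norm x)\<^sup>2 \<le> m * (m * (norm x)\<^sup>2 - (norm (P x))\<^sup>2)"
        by (simp add: power_mult_distrib)
      then show ?thesis using m0 by (simp add: field_simps)
    qed
    define k where "k = max 0 (m - d\<^sup>2 / m)"
    have "norm P \<le> sqrt k"
    proof (rule norm_blinfun_bound)
      show "norm (P x) \<le> sqrt k * norm x" for x
        by (rule power2_le_imp_le)
           (use le[of x] in \<open>auto simp: k_def power_mult_distrib intro: order_trans[OF _ mult_right_mono]\<close>)
    qed (simp add: k_def)
    then have "m \<le> k" using power_mono[of "norm P" "sqrt k" 2] by (simp add: m_def k_def)
    moreover have "d\<^sup>2 / m > 0" using d m0 by simp
    ultimately show False using m0 by (simp add: k_def max_def split: if_splits)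
  qed
  then have "\<not> (\<exists>R. R o\<^sub>L poly_op Q T = id_blinfun)" using bounded_below_if_left_inverse by blast
  moreover have "Q \<noteq> 0" using p(2) by (simp add: Q_def m_def P_def)
  ultimately obtain z where z: "poly Q z = 0" "z \<in> spectrum T"
    using poly_op_left_inverse[OF B] by blast
  define t where "t = Re z"
  have zt: "z = of_real t" using spectrum_real[OF T z(2)] by (simp add: t_def)
  \<comment> \<open>At the real point \<open>t\<close> the product \<open>map_poly cnj p * p\<close>
    takes the value |p(t)|^2.\<close>
  have "poly (map_poly cnj p) (of_real t) = cnj (poly p (of_real t))"
    by (induction p) (simp_all add: map_poly_pCons)
  then have "of_real ((cmod (poly p (of_real t)))\<^sup>2) = (of_real m :: complex)"
    using z(1) by (simp add: Q_def zt complex_norm_square mult.commute del: of_real_power)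
  then have "(cmod (poly p (of_real t)))\<^sup>2 = m" by (simp only: of_real_eq_iff)
  then have "cmod (poly p (of_real t)) = norm P" by (simp add: m_def power2_eq_iff_nonneg)
  then show ?thesis using z(2) zt P_def by auto
qed

text \<open>For \<open>T \<noteq> 0\<close> the identity polynomial attains the norm at a spectral
  point, its product with its conjugate being nonconstant. For \<open>T = 0\<close> the vector
  \<open>x\<close> is an eigenvector.\<close>

lemma rspec_nonempty:
  fixes T :: "'a::chilbert_space \<Rightarrow>\<^sub>L 'a"
  assumes T: "selfadj T" and x: "x \<noteq> (0 :: 'a)"
  shows "rspec T \<noteq> {}"
proof (cases "T = 0")
  case True
  then have "0 \<in> rspec T" by (intro in_rspecI) (use x in auto)
  then show ?thesis by blast
next
  case False
  have "poly_op [:0, 1:] T = T"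
    by (rule blinfun_eqI) (simp add: poly_op_pCons[OF selfadj_bop[OF T]] blinfun.add_left)
  then show ?thesis
    using norm_poly_op_attained[OF T, of "[:0, 1:]"] False by (auto simp: map_poly_pCons)
qed

text \<open>The case left open by \<open>norm_poly_op_attained\<close> is a polynomial of constant
  modulus on the real line; there any single spectral point gives the bound, and a nonzero p(T)
  provides the nonzero vector that guarantees one.\<close>

lemma norm_poly_op_le:
  fixes T :: "'a::chilbert_space \<Rightarrow>\<^sub>L 'a"
  assumes T: "selfadj T" and M: "0 \<le> M" "\<And>t. t \<in> rspec T \<Longrightarrow> cmod (poly p (of_real t)) \<le> M"
  shows "norm (poly_op p T) \<le> M"
proof (cases "poly_op p T = 0")
  case False
  then obtain x where "poly_op p T x \<noteq> 0" by (metis blinfun_eqI zero_blinfun.rep_eq)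
  then have x: "x \<noteq> 0" by (metis blinfun.zero_right)
  show ?thesis
  proof (cases "map_poly cnj p * p = [:of_real ((norm (poly_op p T))\<^sup>2):]")
    case True
    obtain t where t: "t \<in> rspec T" using rspec_nonempty[OF T x] by blast
    have "poly (map_poly cnj p) (of_real t) = cnj (poly p (of_real t))"
      by (induction p) (simp_all add: map_poly_pCons)
    then have "of_real ((cmod (poly p (of_real t)))\<^sup>2) = (of_real ((norm (poly_op p T))\<^sup>2) :: complex)"
      using arg_cong[OF True, of "\<lambda>q. poly q (of_real t)"]
      by (simp add: complex_norm_square mult.commute del: of_real_power)
    then have "(cmod (poly p (of_real t)))\<^sup>2 = (norm (poly_op p T))\<^sup>2" by (simp only: of_real_eq_iff)
    then have "cmod (poly p (of_real t)) = norm (poly_op p T)" by (simp add: power2_eq_iff_nonneg)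
    then show ?thesis using M(2)[OF t] by simp
  next
    case neq: False
    then show ?thesis using norm_poly_op_attained[OF T False] M by force
  qed
qed (use M in simp)

text \<open>The real Stone-Weierstrass theorem treats real and imaginary part separately; on real
  arguments \<open>p + smult \<i> q\<close> recombines the two approximations.\<close>

lemma complex_polynomial_approximation:
  fixes f :: "real \<Rightarrow> complex"
  assumes "compact K" "continuous_on K f"
  shows "\<exists>p. uniform_limit K (\<lambda>n t. poly (p n) (of_real t)) f sequentially"
proof -
  have real: "\<exists>p :: complex poly. \<forall>t\<in>K. cmod (of_real (g t) - poly p (of_real t)) < e"
    if g: "continuous_on K g" "e > 0" for g :: "real \<Rightarrow> real" and e
  proof -
    obtain h where h: "real_polynomial_function h" "\<And>t. t \<in> K \<Longrightarrow> \<bar>g t - h t\<bar> < e"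
      using Stone_Weierstrass_real_polynomial_function[OF assms(1) g] by blast
    obtain a n where an: "h = (\<lambda>x. \<Sum>i\<le>n. a i * x ^ i)"
      using h(1) by (auto simp: real_polynomial_function_iff_sum)
    define p :: "complex poly" where "p = (\<Sum>i\<le>n. monom (of_real (a i)) i)"
    have "poly p (of_real t) = of_real (h t)" for t
      by (simp add: p_def an poly_sum poly_monom)
    then have "cmod (of_real (g t) - poly p (of_real t)) = \<bar>g t - h t\<bar>" for t
      by (simp flip: of_real_diff)
    then have "\<forall>t\<in>K. cmod (of_real (g t) - poly p (of_real t)) < e" using h(2) by simp
    then show ?thesis by (rule exI)
  qed
  have "\<exists>p :: complex poly. \<forall>t\<in>K. cmod (f t - poly p (of_real t)) < e" if e: "e > 0" for e
  proof -
    have cRe: "continuous_on K (\<lambda>t. Re (f t))" and cIm: "continuous_on K (\<lambda>t. Im (f t))"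
      using assms(2) by (auto intro: continuous_intros)
    obtain p where p: "\<And>t. t \<in> K \<Longrightarrow> cmod (of_real (Re (f t)) - poly p (of_real t)) < e / 2"
      using real[OF cRe, of "e/2"] e by auto
    obtain q where q: "\<And>t. t \<in> K \<Longrightarrow> cmod (of_real (Im (f t)) - poly q (of_real t)) < e / 2"
      using real[OF cIm, of "e/2"] e by auto
    have "cmod (f t - poly (p + smult \<i> q) (of_real t)) < e" if t: "t \<in> K" for t
    proof -
      have "f t - poly (p + smult \<i> q) (of_real t) = 
        (of_real (Re (f t)) - poly p (of_real t)) + \<i> * (of_real (Im (f t)) - poly q (of_real t))"
        by (simp add: complex_eq_iff)
      then have "cmod (f t - poly (p + smult \<i> q) (of_real t)) \<le>
          cmod (of_real (Re (f t)) - poly p (of_real t)) + cmod (\<i> * (of_real (Im (f t)) - poly q (of_real t)))"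
        by (metis norm_triangle_ineq)
      then show ?thesis using p[OF t] q[OF t] by (simp add: norm_mult)
    qed
    then show ?thesis by blast
  qed
  then have "\<exists>p :: complex poly. \<forall>t\<in>K. cmod (f t - poly p (of_real t)) < 1 / real (Suc n)" for n
    by simp
  then obtain p where p: "\<And>n t. t \<in> K \<Longrightarrow> cmod (f t - poly (p n) (of_real t)) < 1 / real (Suc n)" by metis
  have "uniform_limit K (\<lambda>n t. poly (p n) (of_real t)) f sequentially"
  proof (rule uniform_limitI)
    fix e :: real assume "e > 0"
    then have "\<forall>\<^sub>F n in sequentially. inverse (real (Suc n)) < e"
      using order_tendstoD(2)[OF LIMSEQ_inverse_real_of_nat] by blast
    then show "\<forall>\<^sub>F n in sequentially. \<forall>t\<in>K. dist (poly (p n) (of_real t)) (f t) < e"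
    proof eventually_elim
      case (elim n)
      then show ?case using p[of _ n] by (force simp: dist_norm norm_minus_commute inverse_eq_divide)
    qed
  qed
  then show ?thesis by blast
qed

text \<open>The set \<open>K\<close> is a compact set around the spectrum. Continuity is required on
  \<open>K\<close>, an explicit interval in the applications, while norms and limits see only the
  spectrum.\<close>

locale selfadj_on =
  fixes T :: "'a::chilbert_space \<Rightarrow>\<^sub>L 'a" and K :: "real set"
  assumes T: "selfadj T" and K: "compact K" and sub: "rspec T \<subseteq> K"
begin

lemma compact_rspec: "compact (rspec T)"
  using compact_Int_closed[OF K closed_rspec[OF T]] sub by (simp add: Int_absorb1)

lemma norm_poly_op_diff_le:
  assumes "\<And>t. t \<in> rspec T \<Longrightarrow> dist (poly p (of_real t)) (poly q (of_real t)) \<le> e" "e \<ge> 0"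
  shows "norm (poly_op p T - poly_op q T) \<le> e"
  unfolding poly_op_diff[symmetric]
  by (rule norm_poly_op_le[OF T assms(2)]) (use assms(1) in \<open>simp add: dist_norm\<close>)

text \<open>\<open>cfc\<close> asks for convergence along every approximating sequence. Two such
  sequences are uniformly close on the spectrum, hence close in norm at \<open>T\<close>, so one
  convergent sequence decides.\<close>

lemma cfc_eq:
  assumes p: "uniform_limit (rspec T) (\<lambda>n t. poly (p n) (of_real t)) f sequentially"
    and A: "(\<lambda>n. poly_op (p n) T) \<longlonglongrightarrow> A"
  shows "cfc T f = A"
  unfolding cfc_def
proof (rule the_equality)
  show "\<forall>q. uniform_limit (rspec T) (\<lambda>n t. poly (q n) (of_real t)) f sequentially \<longrightarrow>
      (\<lambda>n. poly_op (q n) T) \<longlonglongrightarrow> A"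
  proof (intro allI impI)
    fix q assume q: "uniform_limit (rspec T) (\<lambda>n t. poly (q n) (of_real t)) f sequentially"
    have "(\<lambda>n. poly_op (q n) T - poly_op (p n) T) \<longlonglongrightarrow> 0"
    proof (rule tendstoI)
      fix e :: real assume e: "e > 0"
      then have e4: "e / 4 > 0" by simp
      show "\<forall>\<^sub>F n in sequentially. dist (poly_op (q n) T - poly_op (p n) T) 0 < e"
        using uniform_limitD[OF p e4] uniform_limitD[OF q e4]
      proof eventually_elim
        case (elim n)
        have "norm (poly_op (q n) T - poly_op (p n) T) \<le> e / 2"
        proof (rule norm_poly_op_diff_le)
          fix t assume t: "t \<in> rspec T"
          have "dist (poly (q n) (of_real t)) (poly (p n) (of_real t)) \<le>
             dist (poly (q n) (of_real t)) (f t) + dist (poly (p n) (of_real t)) (f t)"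
            by (rule dist_triangle2)
          also have "\<dots> \<le> e / 4 + e / 4" using elim t by (intro add_mono) (auto intro: less_imp_le)
          finally show "dist (poly (q n) (of_real t)) (poly (p n) (of_real t)) \<le> e / 2" by simp
        qed (use e in simp)
        then show ?case using e by simp
      qed
    qed
    from tendsto_add[OF this A] show "(\<lambda>n. poly_op (q n) T) \<longlonglongrightarrow> A" by simp
  qed
  then show "B = A" if "\<forall>q. uniform_limit (rspec T) (\<lambda>n t. poly (q n) (of_real t)) f sequentially \<longrightarrow>
      (\<lambda>n. poly_op (q n) T) \<longlonglongrightarrow> B" for B
    using that p A LIMSEQ_unique by blast
qed

lemma poly_op_tendsto_cfc:
  assumes p: "uniform_limit (rspec T) (\<lambda>n t. poly (p n) (of_real t)) f sequentially"
  shows "(\<lambda>n. poly_op (p n) T) \<longlonglongrightarrow> cfc T f"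
proof -
  have "Cauchy (\<lambda>n. poly_op (p n) T)"
  proof (rule metric_CauchyI)
    fix e :: real assume e: "e > 0"
    obtain N where N: "\<And>n t. n \<ge> N \<Longrightarrow> t \<in> rspec T \<Longrightarrow> dist (poly (p n) (of_real t)) (f t) < e / 4"
      using uniform_limitD[OF p, of "e/4"] e unfolding eventually_sequentially by auto
    have "dist (poly_op (p m) T) (poly_op (p n) T) < e" if "m \<ge> N" "n \<ge> N" for m n
    proof -
      have "norm (poly_op (p m) T - poly_op (p n) T) \<le> e / 2"
      proof (rule norm_poly_op_diff_le)
        fix t assume t: "t \<in> rspec T"
        have "dist (poly (p m) (of_real t)) (poly (p n) (of_real t)) \<le>
           dist (poly (p m) (of_real t)) (f t) + dist (poly (p n) (of_real t)) (f t)"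
          by (rule dist_triangle2)
        also have "\<dots> \<le> e / 4 + e / 4" using N[OF _ t] that by (intro add_mono) (auto intro: less_imp_le)
        finally show "dist (poly (p m) (of_real t)) (poly (p n) (of_real t)) \<le> e / 2" by simp
      qed (use e in simp)
      then show ?thesis using e by (simp add: dist_norm)
    qed
    then show "\<exists>N. \<forall>m\<ge>N. \<forall>n\<ge>N. dist (poly_op (p m) T) (poly_op (p n) T) < e" by blast
  qed
  then obtain A where "(\<lambda>n. poly_op (p n) T) \<longlonglongrightarrow> A" using Cauchy_convergent convergent_def by blast
  then show ?thesis using cfc_eq[OF p] by simp
qed

lemma cfc_cong: "(\<And>t. t \<in> rspec T \<Longrightarrow> f t = g t) \<Longrightarrow> cfc T f = cfc T g"
proof -
  assume "\<And>t. t \<in> rspec T \<Longrightarrow> f t = g t"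
  then have "uniform_limit (rspec T) (\<lambda>n t. poly (p n) (of_real t)) f sequentially \<longleftrightarrow>
      uniform_limit (rspec T) (\<lambda>n t. poly (p n) (of_real t)) g sequentially" for p :: "nat \<Rightarrow> complex poly"
    by (intro uniform_limit_cong') auto
  then show ?thesis unfolding cfc_def by simp
qed

lemma approx:
  fixes f :: "real \<Rightarrow> complex"
  assumes "continuous_on K f"
  obtains p where "uniform_limit K (\<lambda>n t. poly (p n) (of_real t)) f sequentially"
    "uniform_limit (rspec T) (\<lambda>n t. poly (p n) (of_real t)) f sequentially"
  using complex_polynomial_approximation[OF K assms] uniform_limit_on_subset[OF _ sub] by blast

lemma cfc_poly: "cfc T (\<lambda>t. poly p (of_real t)) = poly_op p T"
  by (rule cfc_eq[of "\<lambda>_. p"]) (auto intro: uniform_limit_const)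

lemma cfc_const: "cfc T (\<lambda>_. c) = c *\<^sub>C id_blinfun"
  using cfc_poly[of "[:c:]"] by simp

lemma cfc_add:
  assumes "continuous_on K f" "continuous_on K g"
  shows "cfc T (\<lambda>t. f t + g t) = cfc T f + cfc T g"
proof -
  obtain p q where p: "uniform_limit (rspec T) (\<lambda>n t. poly (p n) (of_real t)) f sequentially"
    and q: "uniform_limit (rspec T) (\<lambda>n t. poly (q n) (of_real t)) g sequentially"
    using approx assms by metis
  show ?thesis
  proof (rule cfc_eq[of "\<lambda>n. p n + q n"])
    show "uniform_limit (rspec T) (\<lambda>n t. poly (p n + q n) (of_real t)) (\<lambda>t. f t + g t) sequentially"
      using uniform_limit_add[OF p q] by simp
    show "(\<lambda>n. poly_op (p n + q n) T) \<longlonglongrightarrow> cfc T f + cfc T g"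
      unfolding poly_op_add by (intro tendsto_add poly_op_tendsto_cfc p q)
  qed
qed

lemma cfc_mult:
  assumes f: "continuous_on K f" and g: "continuous_on K g"
  shows "cfc T (\<lambda>t. f t * g t) = cfc T f o\<^sub>L cfc T g"
proof -
  obtain p q where p: "uniform_limit (rspec T) (\<lambda>n t. poly (p n) (of_real t)) f sequentially"
    and q: "uniform_limit (rspec T) (\<lambda>n t. poly (q n) (of_real t)) g sequentially"
    using approx assms by metis
  have bnd: "bounded (f ` rspec T)" "bounded (g ` rspec T)"
    using f g sub compact_rspec
    by (auto intro!: compact_imp_bounded compact_continuous_image intro: continuous_on_subset)
  show ?thesis
  proof (rule cfc_eq[of "\<lambda>n. p n * q n"])
    show "uniform_limit (rspec T) (\<lambda>n t. poly (p n * q n) (of_real t)) (\<lambda>t. f t * g t) sequentially"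
      using uniform_lim_mult[OF p q bnd] by simp
    show "(\<lambda>n. poly_op (p n * q n) T) \<longlonglongrightarrow> (cfc T f o\<^sub>L cfc T g)"
      unfolding poly_op_mult[OF selfadj_bop[OF T]]
      by (intro bounded_bilinear.tendsto[OF bounded_bilinear_blinfun_compose] poly_op_tendsto_cfc p q)
  qed
qed

lemma cfc_cmult:
  assumes "continuous_on K f"
  shows "cfc T (\<lambda>t. c * f t) = c *\<^sub>C cfc T f"
  using cfc_mult[OF continuous_on_const assms, of c] by (auto simp: cfc_const intro!: blinfun_eqI)

lemma cfc_diff:
  assumes "continuous_on K f" "continuous_on K g"
  shows "cfc T (\<lambda>t. f t - g t) = cfc T f - cfc T g"
  using cfc_add[of "\<lambda>t. f t - g t" g] assms by (simp add: continuous_on_diff)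

lemma bop_cfc:
  assumes "continuous_on K f"
  shows "cfc T f \<in> bop"
proof -
  obtain p where p: "uniform_limit (rspec T) (\<lambda>n t. poly (p n) (of_real t)) f sequentially"
    using approx assms by metis
  show ?thesis
    by (rule closed_sequentially[OF closed_bop _ poly_op_tendsto_cfc[OF p]]) (rule bop_poly_op[OF selfadj_bop[OF T]])
qed

lemma cinner_cfc:
  assumes "continuous_on K f"
  shows "cinner (cfc T f x) y = cinner x (cfc T (\<lambda>t. cnj (f t)) y)"
proof -
  obtain p where p: "uniform_limit (rspec T) (\<lambda>n t. poly (p n) (of_real t)) f sequentially"
    using approx assms by metis
  have eq: "poly (map_poly cnj r) (of_real t) = cnj (poly r (of_real t))" for r t
    by (induction r) (simp_all add: map_poly_pCons)
  have "uniform_limit (rspec T) (\<lambda>n t. poly (map_poly cnj (p n)) (of_real t)) (\<lambda>t. cnj (f t)) sequentially"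
    unfolding eq by (rule bounded_linear.uniform_limit[OF bounded_linear_cnj p])
  note q = poly_op_tendsto_cfc[OF this]
  have c1: "(\<lambda>n. cinner (A n) z) \<longlonglongrightarrow> cinner a z" if "A \<longlonglongrightarrow> a" for A and a z :: 'a
    unfolding cinner_eq_inner using that by (intro tendsto_intros)
  have c2: "(\<lambda>n. cinner z (A n)) \<longlonglongrightarrow> cinner z a" if "A \<longlonglongrightarrow> a" for A and a z :: 'a
    using tendsto_cnj[OF c1[OF that, of z]] by (simp add: cinner_commute[of z])
  have "(\<lambda>n. cinner (poly_op (p n) T x) y) \<longlonglongrightarrow> cinner (cfc T f x) y"
    by (intro c1 blinfun.tendsto poly_op_tendsto_cfc p tendsto_const)
  moreover have "(\<lambda>n. cinner x (poly_op (map_poly cnj (p n)) T y)) \<longlonglongrightarrow> cinner x (cfc T (\<lambda>t. cnj (f t)) y)"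
    by (intro c2 blinfun.tendsto q tendsto_const)
  moreover have "cinner (poly_op (p n) T x) y = cinner x (poly_op (map_poly cnj (p n)) T y)" for n
    using cinner_cadj[OF bop_poly_op[OF selfadj_bop[OF T]]] by (simp add: cadj_poly_op[OF T])
  ultimately show ?thesis by (simp add: LIMSEQ_unique)
qed

lemma cadj_cfc: "continuous_on K f \<Longrightarrow> cadj (cfc T f) = cfc T (\<lambda>t. cnj (f t))"
  by (rule cadj_eqI) (rule cinner_cfc)

lemma selfadj_cfc:
  fixes h :: "real \<Rightarrow> real"
  assumes "continuous_on K h"
  shows "selfadj (cfc T (\<lambda>t. of_real (h t)))"
proof -
  have "continuous_on K (\<lambda>t. complex_of_real (h t))" using assms by (intro continuous_intros)
  then show ?thesis using bop_cfc cinner_cfc by (fastforce simp: selfadj_def)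
qed

lemma norm_cfc_le:
  assumes "continuous_on K f" "M \<ge> 0" "\<And>t. t \<in> rspec T \<Longrightarrow> cmod (f t) \<le> M"
  shows "norm (cfc T f) \<le> M"
proof (rule field_le_epsilon)
  fix e :: real assume e: "e > 0"
  obtain p where p: "uniform_limit (rspec T) (\<lambda>n t. poly (p n) (of_real t)) f sequentially"
    using approx assms by metis
  have "\<forall>\<^sub>F n in sequentially. norm (poly_op (p n) T) \<le> M + e"
    using uniform_limitD[OF p e]
  proof eventually_elim
    case (elim n)
    show ?case
    proof (rule norm_poly_op_le[OF T])
      fix t assume t: "t \<in> rspec T"
      have "cmod (poly (p n) (of_real t)) \<le> cmod (f t) + dist (poly (p n) (of_real t)) (f t)"
        by (simp add: dist_norm norm_triangle_sub)
      then show "cmod (poly (p n) (of_real t)) \<le> M + e" using elim t assms(3)[OF t] by fastforce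
    qed (use assms e in simp)
  qed
  then show "norm (cfc T f) \<le> M + e"
    by (intro tendsto_upperbound[OF tendsto_norm[OF poly_op_tendsto_cfc[OF p]]]) auto
qed

text \<open>With \<open>norm_cfc_le\<close> this makes the calculus isometric on the spectrum. It
  recovers function values from operators: closedness of the range and uniqueness of the scalar rest
  on it.\<close>

lemma cmod_le_norm_cfc:
  assumes f: "continuous_on K f" and t: "t \<in> rspec T"
  shows "cmod (f t) \<le> norm (cfc T f)"
proof -
  obtain p where p: "uniform_limit (rspec T) (\<lambda>n t. poly (p n) (of_real t)) f sequentially"
    using approx assms by metis
  show ?thesis
  proof (rule LIMSEQ_le)
    show "(\<lambda>n. cmod (poly (p n) (of_real t))) \<longlonglongrightarrow> cmod (f t)"
      by (intro tendsto_norm tendsto_uniform_limitI[OF p t])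
    show "(\<lambda>n. norm (poly_op (p n) T)) \<longlonglongrightarrow> norm (cfc T f)"
      by (intro tendsto_norm poly_op_tendsto_cfc p)
  qed (use cmod_poly_le_norm_poly_op[OF T t] in blast)
qed

lemma cfc_tendsto:
  assumes "\<And>n. continuous_on K (f n)" "continuous_on K g" "uniform_limit (rspec T) f g sequentially"
  shows "(\<lambda>n. cfc T (f n)) \<longlonglongrightarrow> cfc T g"
proof (rule tendstoI)
  fix e :: real assume e: "e > 0"
  then have e2: "e / 2 > 0" by simp
  show "\<forall>\<^sub>F n in sequentially. dist (cfc T (f n)) (cfc T g) < e"
    using uniform_limitD[OF assms(3) e2]
  proof eventually_elim
    case (elim n)
    have "norm (cfc T (\<lambda>t. f n t - g t)) \<le> e / 2"
      by (rule norm_cfc_le) (use elim e assms(1,2) in \<open>auto intro!: continuous_intros less_imp_le simp: dist_norm\<close>)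
    then show ?case using e assms(1,2) by (simp add: cfc_diff dist_norm)
  qed
qed

text \<open>Norm convergence of operators gives uniform convergence of the functions on the spectrum
  alone; the limit is extended to \<open>K\<close> by Tietze's theorem. The flag \<open>z\<close>
  switches the condition \<open>f s = 0\<close> on, so that one statement serves diagonal and
  off-diagonal entries; the condition survives the limit because \<open>s\<close> is a spectral
  point.\<close>

lemma closed_range_cfc:
  assumes "s \<in> rspec T"
  shows "closed {cfc T f | f. continuous_on K f \<and> (z \<longrightarrow> f s = 0)}"
proof (rule closed_sequential_limits[THEN iffD2], intro allI impI, elim conjE)
  fix A a assume A: "\<forall>n. A n \<in> {cfc T f | f. continuous_on K f \<and> (z \<longrightarrow> f s = 0)}" and lim: "A \<longlonglongrightarrow> a"
  then obtain f where f: "\<And>n. A n = cfc T (f n)" "\<And>n. continuous_on K (f n)" "\<And>n. z \<Longrightarrow> f n s = 0"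
    by simp metis
  have "uniformly_Cauchy_on (rspec T) f"
  proof (rule uniformly_Cauchy_onI)
    fix e :: real assume "e > 0"
    then obtain N where N: "\<And>m n. m \<ge> N \<Longrightarrow> n \<ge> N \<Longrightarrow> dist (A m) (A n) < e"
      using metric_CauchyD[OF LIMSEQ_imp_Cauchy[OF lim]] by blast
    have "dist (f m t) (f n t) < e" if "t \<in> rspec T" "m \<ge> N" "n \<ge> N" for t m n
    proof -
      have "cmod (f m t - f n t) \<le> norm (cfc T (\<lambda>t. f m t - f n t))"
        using that f by (intro cmod_le_norm_cfc[where f = "\<lambda>t. f m t - f n t"] continuous_intros)
      then show ?thesis using N[OF that(2,3)] f by (simp add: cfc_diff dist_norm)
    qed
    then show "\<exists>M. \<forall>x\<in>rspec T. \<forall>m\<ge>M. \<forall>n\<ge>M. dist (f m x) (f n x) < e" by blast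
  qed
  then obtain g0 where g0: "uniform_limit (rspec T) f g0 sequentially"
    using Cauchy_uniformly_convergent uniformly_convergent_on_def by blast
  have cg0: "continuous_on (rspec T) g0"
    by (rule uniform_limit_theorem[OF _ g0])
       (auto intro!: always_eventually continuous_on_subset[OF f(2) sub])
  have "bounded (g0 ` rspec T)"
    by (intro compact_imp_bounded compact_continuous_image cg0 compact_rspec)
  then obtain B where B: "\<And>t. t \<in> rspec T \<Longrightarrow> norm (g0 t) \<le> B" by (auto simp: bounded_iff)
  then have B0: "0 \<le> B" using assms norm_ge_zero order_trans by blast
  have "closedin (top_of_set K) (rspec T)"
    using sub closed_rspec[OF T] by (simp add: closed_subset)
  from Tietze[OF cg0 this B0 B] obtain g where g: "continuous_on K g" "\<And>t. t \<in> rspec T \<Longrightarrow> g t = g0 t"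
    by metis
  have ul: "uniform_limit (rspec T) f g sequentially"
    by (rule uniform_limit_cong'[THEN iffD1, OF _ _ g0]) (simp_all add: g(2))
  have "g s = 0" if z
    using LIMSEQ_unique[OF tendsto_uniform_limitI[OF ul assms]] f(3)[OF that] by (simp add: tendsto_const_iff)
  moreover have "A \<longlonglongrightarrow> cfc T g" using cfc_tendsto[OF f(2) g(1) ul] by (simp add: f(1)[symmetric])
  ultimately show "a \<in> {cfc T f | f. continuous_on K f \<and> (z \<longrightarrow> f s = 0)}"
    using LIMSEQ_unique[OF lim] g(1) by blast
qed

text \<open>Polynomials of h(T) are functions of \<open>T\<close> by the algebra rules; uniform
  approximation of \<open>g\<close> on \<open>K'\<close> then passes through
  \<open>h\<close>.\<close>

lemma cfc_compose:
  fixes h :: "real \<Rightarrow> real" and g :: "real \<Rightarrow> complex"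
  assumes h: "continuous_on K h" "h ` K \<subseteq> K'" and K': "compact K'"
    and sub': "rspec (cfc T (\<lambda>t. of_real (h t))) \<subseteq> K'" and g: "continuous_on K' g"
  shows "cfc (cfc T (\<lambda>t. of_real (h t))) g = cfc T (\<lambda>t. g (h t))"
proof -
  define B where "B = cfc T (\<lambda>t. of_real (h t))"
  interpret B: selfadj_on B K'
    by unfold_locales (use selfadj_cfc[OF h(1)] K' sub' in \<open>auto simp: B_def\<close>)
  have ch: "continuous_on K (\<lambda>t. complex_of_real (h t))" using h(1) by (intro continuous_intros)
  have cp: "continuous_on K (\<lambda>t. poly p (complex_of_real (h t)))" for p
    using h(1) by (intro continuous_intros)
  have poly: "poly_op p B = cfc T (\<lambda>t. poly p (of_real (h t)))" for p
  proof (induction p)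
    case 0
    show ?case by (rule blinfun_eqI) (simp add: cfc_const)
  next
    case (pCons c p)
    have "cfc T (\<lambda>t. c + of_real (h t) * poly p (of_real (h t))) = c *\<^sub>C id_blinfun + (B o\<^sub>L poly_op p B)"
      unfolding pCons.IH using ch cp
      by (simp add: B_def cfc_add cfc_mult cfc_const continuous_on_mult)
    then show ?case by (simp add: poly_op_pCons[OF selfadj_bop[OF B.T]])
  qed
  obtain p where p: "uniform_limit K' (\<lambda>n t. poly (p n) (of_real t)) g sequentially"
    "uniform_limit (rspec B) (\<lambda>n t. poly (p n) (of_real t)) g sequentially"
    using B.approx[OF g] by blast
  have "uniform_limit K (\<lambda>n t. poly (p n) (of_real (h t))) (\<lambda>t. g (h t)) sequentially"
  proof (rule uniform_limitI)
    fix e :: real assume "e > 0"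
    from uniform_limitD[OF p(1) this]
    show "\<forall>\<^sub>F n in sequentially. \<forall>t\<in>K. dist (poly (p n) (of_real (h t))) (g (h t)) < e"
      by eventually_elim (use h(2) in blast)
  qed
  then have "(\<lambda>n. cfc T (\<lambda>t. poly (p n) (of_real (h t)))) \<longlonglongrightarrow> cfc T (\<lambda>t. g (h t))"
    by (intro cfc_tendsto cp continuous_on_compose2[OF g h] uniform_limit_on_subset[OF _ sub])
  then show ?thesis
    unfolding poly[symmetric] B_def[symmetric]
    by (rule LIMSEQ_unique[OF B.poly_op_tendsto_cfc[OF p(2)]])
qed

end

section \<open>The Hardy space and the composition operator\<close>

lemma hardy_fun_sums:
  assumes "cmod z < 1"
  shows "(\<lambda>n. hcoeff f n * z ^ n) sums hardy_fun f z"
  using holomorphic_power_series[OF holomorphic_hardy_fun, of z f] assms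
  by (simp add: fps_expansion_def)

lemma hardy_fun_eqI:
  assumes "\<And>z. cmod z < 1 \<Longrightarrow> hardy_fun f z = hardy_fun g z"
  shows "f = g"
proof -
  have "hardy_fun f z = hardy_fun g z" for z
    by (cases "cmod z < 1") (simp_all add: assms hardy_fun_outside)
  then show ?thesis by (simp add: hardy_fun_inject[symmetric] fun_eq_iff)
qed

lemma hardy_fun_add [simp]: "hardy_fun (f + g) z = hardy_fun f z + hardy_fun g z"
  by (simp add: plus_hardy.rep_eq)

lemma hardy_fun_scaleC [simp]: "hardy_fun (c *\<^sub>C f) z = c * hardy_fun f z"
  by (simp add: scaleC_hardy.rep_eq)

lemma hardy_fun_diff [simp]: "hardy_fun (f - g) z = hardy_fun f z - hardy_fun g z"
  unfolding minus_hardy_def hardy_fun_add hardy_fun_scaleC by simp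

section \<open>Reproducing kernels, the shift and the monomials\<close>

definition hseries :: "(nat \<Rightarrow> complex) \<Rightarrow> hardy"
  where "hseries c = (SOME f. \<forall>n. hcoeff f n = c n)"

lemma hcoeff_hseries:
  assumes "summable (\<lambda>n. (cmod (c n))\<^sup>2)"
  shows "hcoeff (hseries c) n = c n"
  using someI_ex[OF hardy_of_coeffs[OF assms]] unfolding hseries_def by blast

text \<open>The Szego kernel of the disk, entered through its Taylor coefficients; pairing with it
  evaluates at \<open>w\<close>.\<close>

definition hkernel :: "complex \<Rightarrow> hardy"
  where "hkernel w = hseries (\<lambda>n. cnj w ^ n)"

lemma hcoeff_hkernel:
  assumes "cmod w < 1"
  shows "hcoeff (hkernel w) n = cnj w ^ n"
  unfolding hkernel_def
proof (rule hcoeff_hseries)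
  have "(cmod w)\<^sup>2 < 1" using assms by (simp add: abs_square_less_1)
  moreover have "(cmod (cnj w ^ n))\<^sup>2 = ((cmod w)\<^sup>2) ^ n" for n
    by (simp add: norm_power power_mult[symmetric] mult.commute)
  ultimately show "summable (\<lambda>n. (cmod (cnj w ^ n))\<^sup>2)"
    by (simp add: summable_geometric)
qed

lemma cinner_hkernel: "cmod w < 1 \<Longrightarrow> cinner f (hkernel w) = hardy_fun f w"
  unfolding cinner_hardy_def using sums_unique[OF hardy_fun_sums] by (simp add: hcoeff_hkernel)

lemma hardy_fun_hkernel:
  assumes "cmod w < 1" "cmod z < 1"
  shows "hardy_fun (hkernel w) z = 1 / (1 - cnj w * z)"
proof -
  have "cmod (cnj w * z) < 1" using assms mult_strict_mono[of "cmod w" 1 "cmod z" 1] by (simp add: norm_mult)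
  then have "(\<lambda>n. (cnj w * z) ^ n) sums (1 / (1 - cnj w * z))" by (rule geometric_sums)
  moreover have "(\<lambda>n. (cnj w * z) ^ n) sums hardy_fun (hkernel w) z"
    using hardy_fun_sums[OF assms(2), of "hkernel w"] by (simp add: hcoeff_hkernel assms power_mult_distrib)
  ultimately show ?thesis using sums_unique2 by blast
qed

lemma of_real_cmod_square: "(complex_of_real (cmod z))\<^sup>2 = z * cnj z"
  using complex_norm_square[of z] by simp

lemma norm_hkernel:
  assumes "cmod w < 1"
  shows "(norm (hkernel w))\<^sup>2 = 1 / (1 - (cmod w)\<^sup>2)"
proof -
  have "complex_of_real ((norm (hkernel w))\<^sup>2) = 1 / (1 - cnj w * w)"
    by (simp add: cinner_norm[symmetric] cinner_hkernel hardy_fun_hkernel assms del: of_real_power)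
  also have "\<dots> = of_real (1 / (1 - (cmod w)\<^sup>2))"
    by (simp add: of_real_cmod_square mult.commute)
  finally show ?thesis by (simp only: of_real_eq_iff)
qed

lemma hkernel_total:
  assumes "\<And>w. cmod w < 1 \<Longrightarrow> cinner f (hkernel w) = 0"
  shows "f = 0"
  by (rule hardy_fun_eqI) (use assms in \<open>simp add: cinner_hkernel zero_hardy.rep_eq\<close>)

text \<open>Multiplication by the variable, which acts on the coefficients as the unilateral
  shift.\<close>

definition hshift :: "hardy \<Rightarrow> hardy"
  where "hshift f = hseries (case_nat 0 (hcoeff f))"

lemma hcoeff_hshift: "hcoeff (hshift f) n = (case n of 0 \<Rightarrow> 0 | Suc m \<Rightarrow> hcoeff f m)"
  unfolding hshift_def
proof (rule hcoeff_hseries)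
  have "summable (\<lambda>n. (cmod (case_nat 0 (hcoeff f) (Suc n)))\<^sup>2)" using summable_hcoeff by simp
  then show "summable (\<lambda>n. (cmod (case_nat 0 (hcoeff f) n))\<^sup>2)" by (rule summable_Suc_iff[THEN iffD1])
qed

lemma hardy_fun_hshift:
  assumes "cmod z < 1"
  shows "hardy_fun (hshift f) z = z * hardy_fun f z"
proof -
  have "(\<lambda>n. hcoeff (hshift f) (Suc n) * z ^ Suc n) sums (z * hardy_fun f z)"
    using sums_mult[OF hardy_fun_sums[OF assms], of z f] by (simp add: hcoeff_hshift mult_ac)
  then have "(\<lambda>n. hcoeff (hshift f) n * z ^ n) sums (z * hardy_fun f z)"
    by (subst (asm) sums_Suc_iff) (simp add: hcoeff_hshift)
  then show ?thesis using hardy_fun_sums[OF assms] sums_unique2 by blast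
qed

lemma norm_hshift: "norm (hshift f) = norm f"
proof -
  have "(norm (hshift f))\<^sup>2 = (norm f)\<^sup>2"
    unfolding norm_hardy_square using suminf_split_head[OF summable_hcoeff[of "hshift f"]]
    by (simp add: hcoeff_hshift)
  then show ?thesis by (rule power2_eq_imp_eq) simp_all
qed

definition hunit :: "nat \<Rightarrow> hardy"
  where "hunit n = hseries (\<lambda>k. if k = n then 1 else 0)"

lemma hcoeff_hunit: "hcoeff (hunit n) k = (if k = n then 1 else 0)"
  unfolding hunit_def
  by (rule hcoeff_hseries, rule summable_finite[of "{n}"]) auto

lemma cinner_hunit: "cinner f (hunit n) = hcoeff f n"
proof -
  have "cinner f (hunit n) = (\<Sum>k\<in>{n}. hcoeff f k * cnj (hcoeff (hunit n) k))"
    unfolding cinner_hardy_def by (rule suminf_finite) (auto simp: hcoeff_hunit)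
  then show ?thesis by (simp add: hcoeff_hunit)
qed

lemma hshift_hunit: "hshift (hunit n) = hunit (Suc n)"
  by (rule hardy_eqI) (simp add: hcoeff_hshift hcoeff_hunit split: nat.split)

text \<open>Polarization: the norm of a sum determines the real inner product, and complex linearity
  adds the imaginary part.\<close>

lemma cinner_eq_if_isometric:
  fixes F :: "'a::complex_inner \<Rightarrow> 'b::complex_inner"
  assumes "\<And>x y. F (x + y) = F x + F y" "\<And>c x. F (c *\<^sub>C x) = c *\<^sub>C F x" "\<And>x. norm (F x) = norm x"
  shows "cinner (F x) (F y) = cinner x y"
proof -
  have "inner (F x) (F y) = inner x y" for x y
  proof -
    have "(norm (F x + F y))\<^sup>2 = (norm (x + y))\<^sup>2" by (metis assms(1,3))
    then show ?thesis by (simp only: norm_add_square assms(3) inner_eq_Re_cinner)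
  qed
  then show ?thesis by (simp add: cinner_eq_inner assms(2)[symmetric])
qed

lemma cinner_scaleR_left: "cinner (r *\<^sub>R x) y = of_real r * cinner x (y :: 'a::complex_inner)"
  by (simp add: scaleR_scaleC cinner_scaleC_left)

lemma subspace_closure:
  fixes S :: "'a::real_normed_vector set"
  assumes S: "subspace S"
  shows "subspace (closure S)"
proof (rule subspaceI)
  show "0 \<in> closure S" using subspace_0[OF S] closure_subset by blast
next
  fix x y assume "x \<in> closure S" "y \<in> closure S"
  then obtain u v where "\<And>n. u n \<in> S" "u \<longlonglongrightarrow> x" "\<And>n. v n \<in> S" "v \<longlonglongrightarrow> y"
    unfolding closure_sequential by blast
  then have "\<And>n. u n + v n \<in> S" "(\<lambda>n. u n + v n) \<longlonglongrightarrow> x + y"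
    by (auto intro: subspace_add[OF S] tendsto_add)
  then show "x + y \<in> closure S"
    unfolding closure_sequential by (intro exI[of _ "\<lambda>n. u n + v n"]) simp
next
  fix c x assume "x \<in> closure S"
  then obtain u where "\<And>n. u n \<in> S" "u \<longlonglongrightarrow> x" unfolding closure_sequential by blast
  then have "\<And>n. c *\<^sub>R u n \<in> S" "(\<lambda>n. c *\<^sub>R u n) \<longlonglongrightarrow> c *\<^sub>R x"
    by (auto intro: subspace_scale[OF S] tendsto_scaleR)
  then show "c *\<^sub>R x \<in> closure S"
    unfolding closure_sequential by (intro exI[of _ "\<lambda>n. c *\<^sub>R u n"]) simp
qed

text \<open>\<open>E\<close> below is a conserved quantity of the three-term recurrence with \<open>E 0 = \<bar>x 1\<bar>\<^sup>2\<close>.\<close>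

lemma recurrence_null_sequence:
  fixes a :: complex and x :: "nat \<Rightarrow> complex"
  assumes a0: "a \<noteq> 0" and x0: "x 0 = 0" and lim: "x \<longlonglongrightarrow> 0"
    and rec: "\<And>n. a * x (Suc (Suc n)) + cnj a * x n = 2 * (a * cnj a) * x (Suc n)"
  shows "x n = 0"
proof -
  define E where "E n = (cmod (x (Suc n)))\<^sup>2 + (cmod (x n))\<^sup>2 - 2 * Re (a * x (Suc n) * cnj (x n))" for n
  have step: "E (Suc n) = E n" for n
  proof -
    define u v w where "u = x n" and "v = x (Suc n)" and "w = x (Suc (Suc n))"
    have uvw: "a * w + cnj a * u = 2 * (a * cnj a) * v" using rec[of n] by (simp add: u_def v_def w_def)
    \<comment> \<open>Multiplication by \<open>a * cnj a\<close> produces factors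
      \<open>2 * (a * cnj a) * v\<close>, for which the recurrence substitutes a combination of
      \<open>w\<close> and \<open>u\<close>.\<close>
    have "complex_of_real ((cmod a)\<^sup>2 * 2 * Re (a * w * cnj v - a * v * cnj u))
       = a * cnj a * ((a * w * cnj v - a * v * cnj u) + cnj (a * w * cnj v - a * v * cnj u))"
      by (simp only: complex_add_cnj of_real_mult complex_norm_square) simp
    also have "\<dots> = (a * w * cnj (2 * (a * cnj a) * v) - a * cnj u * (2 * (a * cnj a) * v)
        + cnj (a * w) * (2 * (a * cnj a) * v) - cnj a * u * cnj (2 * (a * cnj a) * v)) / 2"
      by (simp add: algebra_simps)
    also have "\<dots> = a * cnj a * (w * cnj w - u * cnj u)"
      unfolding uvw[symmetric] by (simp add: field_simps)
    also have "\<dots> = of_real ((cmod a)\<^sup>2 * ((cmod w)\<^sup>2 - (cmod u)\<^sup>2))"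
      by (simp only: of_real_mult of_real_diff complex_norm_square)
    finally have "(cmod a)\<^sup>2 * (2 * Re (a * w * cnj v - a * v * cnj u)) = (cmod a)\<^sup>2 * ((cmod w)\<^sup>2 - (cmod u)\<^sup>2)"
      by (simp only: of_real_eq_iff mult.assoc)
    then have "2 * Re (a * w * cnj v - a * v * cnj u) = (cmod w)\<^sup>2 - (cmod u)\<^sup>2" using a0 by simp
    then show ?thesis by (simp add: E_def u_def v_def w_def)
  qed
  have "E n = E 0" for n by (induction n) (simp_all add: step)
  then have E: "E = (\<lambda>_. E 0)" by blast
  have "E \<longlonglongrightarrow> (cmod 0)\<^sup>2 + (cmod 0)\<^sup>2 - 2 * Re (a * 0 * cnj 0)"
    unfolding E_def by (intro tendsto_intros lim LIMSEQ_Suc[OF lim])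
  then have "(\<lambda>_ :: nat. E 0) \<longlonglongrightarrow> 0" by (subst (asm) E) simp
  then have "E 0 = 0" by (simp add: LIMSEQ_const_iff)
  then have x1: "x (Suc 0) = 0" by (simp add: E_def x0)
  have "x n = 0 \<and> x (Suc n) = 0"
  proof (induction n)
    case (Suc n)
    then show ?case using rec[of n] a0 by simp
  qed (use x0 x1 in simp)
  then show ?thesis by blast
qed

section \<open>The disk automorphism, its weighted composition operator and
  \<open>comp_op\<close>\<close>

locale disk_point =
  fixes a :: complex
  assumes a: "cmod a < 1"
begin

abbreviation \<phi> :: "complex \<Rightarrow> complex" where "\<phi> \<equiv> disk_involution a"

definition s :: real where "s = 1 - (cmod a)\<^sup>2"

lemma s_pos: "s > 0"
  using a by (simp add: s_def abs_square_less_1)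

lemma s_eq: "complex_of_real s = 1 - a * cnj a"
  by (simp add: s_def of_real_cmod_square)

lemma denom_nz: "cmod w < 1 \<Longrightarrow> cmod z < 1 \<Longrightarrow> 1 - cnj w * z \<noteq> 0"
proof
  assume *: "cmod w < 1" "cmod z < 1" "1 - cnj w * z = 0"
  then have "cnj w * z = 1" by simp
  then have "cmod (cnj w * z) = 1" by (simp only: norm_one)
  moreover have "cmod (cnj w * z) < 1"
    using *(1,2) mult_strict_mono[of "cmod w" 1 "cmod z" 1] by (simp add: norm_mult)
  ultimately show False by linarith
qed

lemma denom_nz': "cmod z < 1 \<Longrightarrow> 1 - a * cnj z \<noteq> 0"
  using denom_nz[of z a] a by (simp add: mult.commute)

text \<open>The automorphism multiplies the Szego kernel by a factor that separates \<open>w\<close>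
  from \<open>z\<close>. The diagonal case gives invariance of the disk, the general case equality
  of Gram matrices.\<close>

lemma one_minus_involution:
  assumes "cmod w < 1" "cmod z < 1"
  shows "1 - cnj (\<phi> w) * \<phi> z = of_real s * (1 - cnj w * z) / ((1 - a * cnj w) * (1 - cnj a * z))"
proof -
  let ?D = "(1 - a * cnj w) * (1 - cnj a * z)"
  have "?D \<noteq> 0" using denom_nz[OF a assms(2)] denom_nz'[OF assms(1)] by simp
  then have "1 = ?D / ?D" by (rule divide_self[symmetric])
  moreover have "cnj (\<phi> w) * \<phi> z = (cnj a - cnj w) * (a - z) / ?D"
    by (simp add: disk_involution_def)
  ultimately have "1 - cnj (\<phi> w) * \<phi> z = (?D - (cnj a - cnj w) * (a - z)) / ?D"
    by (simp only: diff_divide_distrib)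
  also have "?D - (cnj a - cnj w) * (a - z) = of_real s * (1 - cnj w * z)"
    unfolding s_eq by (simp add: algebra_simps)
  finally show ?thesis .
qed

lemma involution_in_disk:
  assumes "cmod z < 1"
  shows "cmod (\<phi> z) < 1"
proof -
  have "complex_of_real (1 - (cmod (\<phi> z))\<^sup>2) = 1 - cnj (\<phi> z) * \<phi> z"
    by (simp add: of_real_cmod_square mult.commute)
  also have "\<dots> = of_real s * (1 - cnj z * z) / (cnj (1 - cnj a * z) * (1 - cnj a * z))"
    using one_minus_involution[OF assms assms] by simp
  also have "\<dots> = of_real (s * (1 - (cmod z)\<^sup>2) / (cmod (1 - cnj a * z))\<^sup>2)"
    by (simp add: of_real_cmod_square mult.commute)
  finally have "1 - (cmod (\<phi> z))\<^sup>2 = s * (1 - (cmod z)\<^sup>2) / (cmod (1 - cnj a * z))\<^sup>2"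
    by (simp only: of_real_eq_iff)
  also have "\<dots> > 0"
    using s_pos assms denom_nz[OF a assms] by (intro divide_pos_pos mult_pos_pos) (auto simp: abs_square_less_1)
  finally show ?thesis by (simp add: abs_square_less_1)
qed

lemma one_minus_a_involution:
  assumes "cmod z < 1"
  shows "1 - cnj a * \<phi> z = of_real s / (1 - cnj a * z)"
  unfolding disk_involution_def s_eq using denom_nz[OF a assms] by (simp add: field_simps)

lemma involution_involution:
  assumes "cmod z < 1"
  shows "\<phi> (\<phi> z) = z"
proof -
  have "a - \<phi> z = of_real s * z / (1 - cnj a * z)"
    unfolding disk_involution_def s_eq using denom_nz[OF a assms] by (simp add: field_simps)
  then have "\<phi> (\<phi> z) = (of_real s * z / (1 - cnj a * z)) / (of_real s / (1 - cnj a * z))"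
    unfolding disk_involution_def[of a "\<phi> z"] one_minus_a_involution[OF assms] by simp
  also have "\<dots> = z" using s_pos denom_nz[OF a assms] by simp
  finally show ?thesis .
qed

text \<open>The normalized Szego kernel at \<open>a\<close>; its square is minus the derivative of
  \<open>\<phi>\<close>, which is why the weight compensates the change of variables on the
  circle.\<close>

definition weight :: "complex \<Rightarrow> complex"
  where "weight z = of_real (sqrt s) / (1 - cnj a * z)"

lemma sqrt_s_square: "complex_of_real (sqrt s) * of_real (sqrt s) = of_real s"
  using s_pos by (simp flip: of_real_mult)

text \<open>Both sides are the value at \<open>z\<close> of the image of the kernel at
  \<open>w\<close>: the weighted composition takes kernels to multiples of kernels.\<close>

lemma weight_hkernel:
  assumes "cmod w < 1" "cmod z < 1"
  shows "weight z * (1 / (1 - cnj w * \<phi> z)) = cnj (weight w) * (1 / (1 - cnj (\<phi> w) * z))"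
proof -
  have "(1 - cnj a * z) * (1 - cnj w * \<phi> z) = (1 - a * cnj w) * (1 - cnj (\<phi> w) * z)"
    unfolding disk_involution_def using denom_nz[OF a assms(2)] denom_nz'[OF assms(1)] by (simp add: field_simps)
  then show ?thesis unfolding weight_def by simp
qed

text \<open>The factor in \<open>one_minus_involution\<close> is exactly
  \<open>cnj (weight w) * weight v\<close>, so it cancels. Equal Gram matrices are what an isometric
  extension needs.\<close>

lemma gram_identity:
  assumes "cmod w < 1" "cmod v < 1"
  shows "cinner (cnj (weight w) *\<^sub>C hkernel (\<phi> w)) (cnj (weight v) *\<^sub>C hkernel (\<phi> v)) = cinner (hkernel w) (hkernel v)"
proof -
  have "cinner (cnj (weight w) *\<^sub>C hkernel (\<phi> w)) (cnj (weight v) *\<^sub>C hkernel (\<phi> v))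
     = cnj (weight w) * weight v * (1 / (1 - cnj (\<phi> w) * \<phi> v))"
    by (simp add: cinner_simps cinner_hkernel hardy_fun_hkernel assms involution_in_disk)
  also have "\<dots> = 1 / (1 - cnj w * v)"
  proof -
    have "cnj (weight w) * weight v = of_real s / ((1 - a * cnj w) * (1 - cnj a * v))"
      unfolding weight_def by (simp add: sqrt_s_square[symmetric])
    moreover have "complex_of_real s \<noteq> 0" using s_pos by simp
    ultimately show ?thesis
      unfolding one_minus_involution[OF assms]
      using denom_nz[OF a assms(2)] denom_nz'[OF assms(1)] denom_nz[OF assms] by simp
  qed
  finally show ?thesis by (simp add: cinner_hkernel hardy_fun_hkernel assms)
qed

text \<open>The operator \<open>f \<mapsto> weight \<cdot> f \<circ> \<phi>\<close> is defined by isometric extension from the reproducing kernels: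
  the closed span of the graph over the kernels is the graph of an isometry with dense, closed domain.\<close>

lemma weighted_composition_exists:
  "\<exists>y. norm y = norm x \<and> (\<forall>z. cmod z < 1 \<longrightarrow> hardy_fun y z = weight z * hardy_fun x (\<phi> z))"
proof -
  \<comment> \<open>\<open>span\<close> is the real span; the scalar \<open>c\<close> makes it
    complex.\<close>
  define P where "P = {(c *\<^sub>C hkernel w, c *\<^sub>C cnj (weight w) *\<^sub>C hkernel (\<phi> w)) | c w. cmod w < 1}"
  define G where "G = closure (span P)"
  have minimal: "G \<subseteq> S" if "P \<subseteq> S" "subspace S" "closed S" for S
    unfolding G_def by (intro closure_minimal span_minimal that)
  have PP: "inner (fst p) (fst q) = inner (snd p) (snd q)" if pq: "p \<in> P" "q \<in> P" for p q
  proof -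
    obtain c w d v where p: "p = (c *\<^sub>C hkernel w, c *\<^sub>C cnj (weight w) *\<^sub>C hkernel (\<phi> w))" "cmod w < 1"
      and q: "q = (d *\<^sub>C hkernel v, d *\<^sub>C cnj (weight v) *\<^sub>C hkernel (\<phi> v))" "cmod v < 1"
      using pq unfolding P_def by blast
    have "cinner (fst p) (fst q) = cinner (snd p) (snd q)"
      unfolding p(1) q(1) fst_conv snd_conv cinner_scaleC_left[of c] cinner_scaleC_right[of _ d]
        gram_identity[OF p(2) q(2)] ..
    then show ?thesis by (simp add: inner_eq_Re_cinner)
  qed
  \<comment> \<open>Preservation of the inner product is a closed linear condition in each argument,
    so it extends from \<open>P\<close> to \<open>G\<close> one argument at a time.\<close>
  have form: "subspace {p. inner (fst p) (fst q) = inner (snd p) (snd q)}"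
    "closed {p. inner (fst p) (fst q) = inner (snd p) (snd q)}" for q :: "hardy \<times> hardy"
    by (auto simp: subspace_def inner_simps intro!: closed_Collect_eq continuous_intros)
  have GP: "inner (fst p) (fst q) = inner (snd p) (snd q)" if "p \<in> G" "q \<in> P" for p q
    using minimal[OF _ form[of q]] PP that by blast
  have GG: "inner (fst p) (fst q) = inner (snd p) (snd q)" if "p \<in> G" "q \<in> G" for p q
  proof -
    have "P \<subseteq> {q'. inner (fst q') (fst p) = inner (snd q') (snd p)}"
      using GP[OF that(1)] by (auto simp: inner_commute)
    from minimal[OF this form] that(2) show ?thesis by (auto simp: inner_commute)
  qed
  have norm_eq: "norm (snd p) = norm (fst p)" if "p \<in> G" for p
    using GG[OF that that] by (simp add: norm_eq_sqrt_inner)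
  have eval: "hardy_fun (snd p) z = weight z * hardy_fun (fst p) (\<phi> z)" if "p \<in> G" and z: "cmod z < 1" for p z
  proof -
    \<comment> \<open>Evaluation is written as pairing with a kernel, which makes the pointwise
      formula a closed linear condition.\<close>
    let ?S = "{p. cinner (snd p) (hkernel z) = weight z * cinner (fst p) (hkernel (\<phi> z))}"
    have "P \<subseteq> ?S"
    proof
      fix p assume "p \<in> P"
      then obtain c w where p: "p = (c *\<^sub>C hkernel w, c *\<^sub>C cnj (weight w) *\<^sub>C hkernel (\<phi> w))" "cmod w < 1"
        unfolding P_def by blast
      show "p \<in> ?S"
        using z p arg_cong[OF weight_hkernel[OF p(2) z], of "\<lambda>x. c * x"]
        by (simp add: cinner_scaleC_left cinner_hkernel hardy_fun_hkernel involution_in_disk mult_ac)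
    qed
    moreover have "subspace ?S"
      by (auto simp: subspace_def cinner_simps cinner_scaleR_left algebra_simps)
    moreover have "closed ?S"
    proof -
      have "continuous_on UNIV (\<lambda>p :: hardy \<times> hardy. cinner (snd p) k)"
        "continuous_on UNIV (\<lambda>p :: hardy \<times> hardy. cinner (fst p) k)" for k
        unfolding cinner_eq_inner Complex_eq by (intro continuous_intros)+
      then show ?thesis by (intro closed_Collect_eq continuous_intros)
    qed
    ultimately have "p \<in> ?S" using minimal that(1) by blast
    then show ?thesis using z by (simp add: cinner_hkernel involution_in_disk)
  qed
  have subG: "subspace G" unfolding G_def by (intro subspace_closure subspace_span)
  have "complete G" unfolding G_def by (simp add: complete_eq_closed)
  then have "complete (fst ` G)"
  proof (rule complete_isometric_image[OF _ subG bounded_linear_fst, of "1 / sqrt 2", rotated 2])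
    \<comment> \<open>On the graph of an isometry the norm is \<open>sqrt 2\<close> times that of
      the first coordinate; this lower bound makes the domain complete.\<close>
    show "\<forall>p\<in>G. 1 / sqrt 2 * norm p \<le> norm (fst p)"
    proof
      fix p assume "p \<in> G"
      then have "norm p = sqrt 2 * norm (fst p)"
        using norm_eq[of p] by (simp add: norm_prod_def real_sqrt_mult flip: mult_2)
      then show "1 / sqrt 2 * norm p \<le> norm (fst p)" by simp
    qed
  qed simp
  then have "closed (fst ` G)" by (rule complete_imp_closed)
  have "fst ` G = UNIV"
  proof (rule subspace_eq_UNIV)
    show "subspace (fst ` G)"
      by (rule linear_subspace_image[OF bounded_linear.linear[OF bounded_linear_fst] subG])
    fix f assume f: "\<And>m. m \<in> fst ` G \<Longrightarrow> inner f m = 0"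
    have "P \<subseteq> G" unfolding G_def using span_superset closure_subset by blast
    then have "inner f (c *\<^sub>C hkernel w) = 0" if "cmod w < 1" for c w
      using that by (intro f image_eqI[of _ fst "(c *\<^sub>C hkernel w, c *\<^sub>C cnj (weight w) *\<^sub>C hkernel (\<phi> w))"])
        (auto simp: P_def)
    note orth = this
    have "cinner f (hkernel w) = 0" if "cmod w < 1" for w
      by (rule cinner_eq_zero_if_inner[of "range (\<lambda>c. c *\<^sub>C hkernel w)"])
         (use that orth in \<open>auto simp: scaleC_scaleC intro: range_eqI[of _ _ 1]\<close>)
    then show "f = 0" by (rule hkernel_total)
  qed fact
  then obtain p where "p \<in> G" "fst p = x" by (metis UNIV_I imageE)
  then show ?thesis using norm_eq eval by (intro exI[of _ "snd p"]) simp
qed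

definition wcomp :: "hardy \<Rightarrow> hardy"
  where "wcomp x = (SOME y. norm y = norm x \<and> (\<forall>z. cmod z < 1 \<longrightarrow> hardy_fun y z = weight z * hardy_fun x (\<phi> z)))"

lemma norm_wcomp: "norm (wcomp x) = norm x"
  and hardy_fun_wcomp: "cmod z < 1 \<Longrightarrow> hardy_fun (wcomp x) z = weight z * hardy_fun x (\<phi> z)"
  using someI_ex[OF weighted_composition_exists[of x]] unfolding wcomp_def by blast+

lemma wcomp_add: "wcomp (x + y) = wcomp x + wcomp y"
  and wcomp_scaleC: "wcomp (c *\<^sub>C x) = c *\<^sub>C wcomp x"
  by (rule hardy_fun_eqI; simp add: hardy_fun_wcomp algebra_simps)+

lemma cinner_wcomp: "cinner (wcomp x) (wcomp y) = cinner x y"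
  by (rule cinner_eq_if_isometric) (simp_all add: wcomp_add wcomp_scaleC norm_wcomp)

lemma wcomp_wcomp: "wcomp (wcomp x) = x"
proof (rule hardy_fun_eqI)
  fix z :: complex assume z: "cmod z < 1"
  have "weight z * weight (\<phi> z) = 1"
  proof -
    have "weight z * weight (\<phi> z) = (of_real (sqrt s) * of_real (sqrt s)) / ((1 - cnj a * z) * (1 - cnj a * \<phi> z))"
      by (simp add: weight_def)
    also have "\<dots> = 1"
      unfolding sqrt_s_square one_minus_a_involution[OF z] using s_pos denom_nz[OF a z] by simp
    finally show ?thesis .
  qed
  then show "hardy_fun (wcomp (wcomp x)) z = hardy_fun x z"
    using z by (simp add: hardy_fun_wcomp involution_in_disk involution_involution mult.assoc[symmetric])
qed

text \<open>The weight is divided out again: multiplication by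
  \<open>(1 - cnj a * z) / sqrt s\<close>, expressed by the shift.\<close>

definition comp_fun :: "hardy \<Rightarrow> hardy"
  where "comp_fun f = of_real (1 / sqrt s) *\<^sub>C (wcomp f - cnj a *\<^sub>C hshift (wcomp f))"

lemma hardy_fun_comp_fun:
  assumes z: "cmod z < 1"
  shows "hardy_fun (comp_fun f) z = hardy_fun f (\<phi> z)"
proof -
  have "hardy_fun (comp_fun f) z = of_real (1 / sqrt s) * ((1 - cnj a * z) * weight z) * hardy_fun f (\<phi> z)"
  proof -
    have "k * (W * F - b * (z * (W * F))) = k * ((1 - b * z) * W) * F" for k W F b :: complex
      by (simp add: algebra_simps)
    then show ?thesis
      unfolding comp_fun_def hardy_fun_scaleC hardy_fun_diff hardy_fun_hshift[OF z] hardy_fun_wcomp[OF z] .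
  qed
  also have "(1 - cnj a * z) * weight z = of_real (sqrt s)"
    using denom_nz[OF a z] by (simp add: weight_def)
  also have "of_real (1 / sqrt s) * complex_of_real (sqrt s) = 1"
    using s_pos by (simp flip: of_real_mult)
  finally show ?thesis by simp
qed

lemma norm_comp_fun: "norm (comp_fun f) \<le> norm f * ((1 + cmod a) / sqrt s)"
proof -
  have "norm (wcomp f - cnj a *\<^sub>C hshift (wcomp f)) \<le> norm f + cmod a * norm f"
    using norm_triangle_ineq4[of "wcomp f" "cnj a *\<^sub>C hshift (wcomp f)"]
    by (simp add: norm_scaleC norm_hshift norm_wcomp)
  then show ?thesis using s_pos
    by (simp add: comp_fun_def norm_scaleC norm_divide divide_right_mono algebra_simps)
qed

lemma comp_op_eq_comp_fun: "comp_op a f = comp_fun f"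
proof -
  have "Abs_hardy (\<lambda>z. if z \<in> ball 0 1 then hardy_fun f (\<phi> z) else 0) = comp_fun f" for f
  proof -
    have "(\<lambda>z. if z \<in> ball 0 1 then hardy_fun f (\<phi> z) else 0) = hardy_fun (comp_fun f)"
      by (auto simp: fun_eq_iff hardy_fun_comp_fun hardy_fun_outside)
    then show ?thesis by (simp add: hardy_fun_inverse)
  qed
  moreover have "bounded_linear comp_fun"
  proof (rule bounded_linear_intro)
    show "comp_fun (x + y) = comp_fun x + comp_fun y" for x y
      by (rule hardy_fun_eqI) (simp add: hardy_fun_comp_fun)
    show "comp_fun (r *\<^sub>R x) = r *\<^sub>R comp_fun x" for r x
      by (rule hardy_fun_eqI) (simp add: hardy_fun_comp_fun scaleR_scaleC)
  qed (rule norm_comp_fun)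
  ultimately show ?thesis by (simp add: comp_op_def bounded_linear_Blinfun_apply)
qed

lemma hardy_fun_comp_op: "cmod z < 1 \<Longrightarrow> hardy_fun (comp_op a f) z = hardy_fun f (\<phi> z)"
  by (simp add: comp_op_eq_comp_fun hardy_fun_comp_fun)

lemma bop_comp_op: "comp_op a \<in> bop"
  unfolding bop_def by (auto intro!: hardy_fun_eqI simp: hardy_fun_comp_op)

lemma comp_op_comp_op: "comp_op a (comp_op a f) = f"
  by (rule hardy_fun_eqI) (simp add: hardy_fun_comp_op involution_in_disk involution_involution)

text \<open>Since \<open>s\<close> is \<open>(1 + cmod a) * (1 - cmod a)\<close>, a factor
  \<open>1 + cmod a\<close> cancels in the square of \<open>norm_comp_fun\<close>.\<close>

lemma norm_comp_op: "(1 - cmod a) * (norm (comp_op a f))\<^sup>2 \<le> (1 + cmod a) * (norm f)\<^sup>2"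
proof -
  have "(norm (comp_op a f))\<^sup>2 \<le> (norm f * ((1 + cmod a) / sqrt s))\<^sup>2"
    unfolding comp_op_eq_comp_fun by (intro power_mono norm_comp_fun) simp
  also have "\<dots> = (norm f)\<^sup>2 * (1 + cmod a)\<^sup>2 / s"
    using s_pos by (simp add: power_mult_distrib power_divide)
  finally have "s * (norm (comp_op a f))\<^sup>2 \<le> (norm f)\<^sup>2 * (1 + cmod a)\<^sup>2"
    using s_pos by (simp add: pos_le_divide_eq mult.commute)
  moreover have "s = (1 + cmod a) * (1 - cmod a)" by (simp add: s_def power2_eq_square algebra_simps)
  ultimately have "(1 + cmod a) * ((1 - cmod a) * (norm (comp_op a f))\<^sup>2) \<le> (1 + cmod a) * ((1 + cmod a) * (norm f)\<^sup>2)"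
    by (simp add: power2_eq_square mult_ac)
  then show ?thesis by (rule mult_left_le_imp_le) (simp add: add_pos_nonneg)
qed

lemma cadj_comp_op_hkernel:
  assumes "cmod w < 1"
  shows "cadj (comp_op a) (hkernel w) = hkernel (\<phi> w)"
  by (rule cinner_ext)
     (simp add: cinner_cadj[OF bop_comp_op, symmetric] cinner_hkernel assms involution_in_disk hardy_fun_comp_op)

text \<open>With \<open>f\<close> and the test vectors written as images under \<open>wcomp\<close>,
  the hypothesis says that \<open>1 - cnj a * hshift\<close> preserves inner products with
  \<open>h\<close> up to the factor \<open>s\<close>. Testing with monomials gives the recurrence
  for the coefficients of \<open>h\<close>, which tend to 0.\<close>

lemma isometric_vector_zero:
  assumes a0: "a \<noteq> 0" and f: "\<And>g. cinner (comp_op a f) (comp_op a g) = cinner f g"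
  shows "f = 0"
proof -
  define h where "h = wcomp f"
  have inner: "cinner (h - cnj a *\<^sub>C hshift h) (g - cnj a *\<^sub>C hshift g) = of_real s * cinner h g" for g
  proof -
    define k where "k = complex_of_real (1 / sqrt s)"
    have "complex_of_real s * (k * cnj k) = of_real (s * (1 / sqrt s * (1 / sqrt s)))"
      unfolding k_def complex_cnj_complex_of_real of_real_mult ..
    also have "s * (1 / sqrt s * (1 / sqrt s)) = 1" using s_pos by simp
    finally have ks: "complex_of_real s * (k * cnj k) = 1" by simp
    have "cinner (comp_op a f) (comp_op a (wcomp g)) = k * cnj k * cinner (h - cnj a *\<^sub>C hshift h) (g - cnj a *\<^sub>C hshift g)"
      unfolding comp_op_eq_comp_fun comp_fun_def wcomp_wcomp k_def[symmetric] h_def[symmetric]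
        cinner_scaleC_left[of k] cinner_scaleC_right[of _ k] by simp
    moreover have "cinner (comp_op a f) (comp_op a (wcomp g)) = cinner h g"
      unfolding f h_def using cinner_wcomp[of "f" "wcomp g"] by (simp add: wcomp_wcomp)
    ultimately have "of_real s * cinner h g = of_real s * (k * cnj k) * cinner (h - cnj a *\<^sub>C hshift h) (g - cnj a *\<^sub>C hshift g)"
      by (simp only: mult.assoc)
    then show ?thesis unfolding ks by simp
  qed
  \<comment> \<open>The extra 0 in front stands for a coefficient before index 0, so that the
    equation from the constant monomial is an instance of the recurrence too.\<close>
  define x where "x = (\<lambda>n. case n of 0 \<Rightarrow> 0 | Suc m \<Rightarrow> hcoeff h m)"
  have x: "x n = 0" for n
  proof (rule recurrence_null_sequence[OF a0])
    show "x 0 = 0" by (simp add: x_def)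
    have "(\<lambda>n. sqrt ((cmod (hcoeff h n))\<^sup>2)) \<longlonglongrightarrow> sqrt 0"
      by (intro tendsto_real_sqrt summable_LIMSEQ_zero summable_hcoeff)
    then have "hcoeff h \<longlonglongrightarrow> 0" by (simp add: tendsto_norm_zero_iff)
    then have "(\<lambda>n. x (Suc n)) \<longlonglongrightarrow> 0" by (simp add: x_def)
    then show "x \<longlonglongrightarrow> 0" by (rule LIMSEQ_imp_Suc)
    show "a * x (Suc (Suc n)) + cnj a * x n = 2 * (a * cnj a) * x (Suc n)" for n
      using inner[of "hunit n"] unfolding s_eq
      by (simp add: cinner_simps hshift_hunit cinner_hunit hcoeff_hshift x_def algebra_simps)
  qed
  have "hcoeff h n = 0" for n using x[of "Suc n"] by (simp add: x_def)
  then have "h = 0" by (intro hardy_eqI) simp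
  moreover have "wcomp 0 = 0" using wcomp_scaleC[of 0 0] by simp
  ultimately show ?thesis using wcomp_wcomp[of f] by (simp add: h_def)
qed

text \<open>The adjoint maps the test vector \<open>hkernel (\<phi> b)\<close> to
  \<open>hkernel b\<close>; the operator maps it to nearly the same function plus a constant when
  \<open>b\<close> approaches \<open>\<zeta>\<close> radially. The norm of \<open>hkernel b\<close>
  blows up there, so the constant becomes negligible.\<close>

lemma comp_op_minus_adjoint_not_bounded_below:
  assumes a0: "a \<noteq> 0" and d: "d > 0"
  shows "\<exists>f. norm (comp_op a f - cadj (comp_op a) f) < d * norm f"
proof -
  define r where "r = cmod a"
  have r: "0 < r" "r < 1" using a a0 by (auto simp: r_def)
  \<comment> \<open>\<open>u / cnj a\<close> is to be a point of the circle where the derivative of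
    \<open>\<phi>\<close> has modulus 1, that is, |1 - u|^2 = s. With |u| = r this means Re u =
    r^2.\<close>
  define u where "u = Complex (r\<^sup>2) (r * sqrt s)"
  have srs: "s = 1 - r\<^sup>2" by (simp add: s_def r_def)
  have uu: "u * cnj u = a * cnj a"
  proof -
    have "(cmod u)\<^sup>2 = (r\<^sup>2)\<^sup>2 + (r * sqrt s)\<^sup>2" unfolding cmod_power2 u_def by simp
    also have "\<dots> = r\<^sup>2" using s_pos unfolding power_mult_distrib by (simp add: srs power2_eq_square algebra_simps)
    finally show ?thesis unfolding complex_norm_square[symmetric] r_def by simp
  qed
  have u1: "(1 - u) * (1 - cnj u) = of_real s"
  proof -
    have "(1 - u) * (1 - cnj u) = 1 - (u + cnj u) + u * cnj u" by (simp add: algebra_simps)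
    also have "\<dots> = 1 - 2 * (a * cnj a) + a * cnj a"
      unfolding uu complex_add_cnj by (simp add: u_def r_def complex_norm_square[symmetric])
    finally show ?thesis by (simp add: s_eq)
  qed
  define \<zeta> where "\<zeta> = u / cnj a"
  have u0: "u \<noteq> 0" using uu a0 by auto
  have \<zeta>1: "cmod \<zeta> = 1"
  proof -
    have "cmod u * cmod u = r * r" using arg_cong[OF uu, of cmod] by (simp add: norm_mult r_def)
    then have "cmod u = r" using r by (simp add: abs_eq_iff power2_eq_square[symmetric] power2_eq_iff_nonneg)
    then show ?thesis using r by (simp add: \<zeta>_def norm_divide r_def)
  qed
  define C where "C = norm (cadj (comp_op a)) + 1"
  have C: "C > 0" unfolding C_def by (rule add_nonneg_pos) simp_all
  \<comment> \<open>The coefficients of a partial fraction expansion: \<open>\<beta>\<close> belongs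
    to the kernel at \<open>b\<close>, less the 1 contributed by the adjoint, and vanishes at
    \<open>t = 1\<close> by \<open>u1\<close>; \<open>\<kappa>\<close> belongs to the constant
    function.\<close>
  define \<beta> where "\<beta> t = (1 - u / of_real t) * (1 - of_real t * cnj u) / of_real s - 1" for t :: real
  define \<kappa> where "\<kappa> t = u / of_real t * (1 - of_real t * cnj u) / of_real s" for t :: real
  have s0: "complex_of_real s \<noteq> 0" using s_pos by simp
  have key: "comp_op a f - cadj (comp_op a) f = \<beta> t *\<^sub>C hkernel b + \<kappa> t *\<^sub>C hkernel 0"
    if t: "0 < t" "t < 1" and b: "b = of_real t * \<zeta>" and f: "f = hkernel (\<phi> b)" for t b f
  proof (rule hardy_fun_eqI)
    fix z :: complex assume z: "cmod z < 1"
    have b1: "cmod b < 1" using t \<zeta>1 by (simp add: b norm_mult)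
    have acb: "a * cnj b = of_real t * cnj u" using a0 by (simp add: b \<zeta>_def)
    have ca: "cnj a = u / of_real t * cnj b"
    proof -
      have "u / of_real t * cnj b = u * cnj u / a" using t by (simp add: b \<zeta>_def)
      also have "\<dots> = cnj a" unfolding uu using a0 by simp
      finally show ?thesis ..
    qed
    define q where "q = u / complex_of_real t"
    define p where "p = a * cnj b"
    define D where "D = 1 - cnj b * z"
    have D: "D \<noteq> 0" unfolding D_def by (rule denom_nz[OF b1 z])
    \<comment> \<open>Expanding the numerator in the denominator \<open>D\<close> splits the
      quotient into a kernel and a constant.\<close>
    have num: "1 - cnj a * z = (1 - q) + q * D"
      unfolding ca q_def[symmetric] D_def by (simp add: algebra_simps)
    have "hardy_fun (comp_op a f) z = 1 / (1 - cnj (\<phi> b) * \<phi> z)"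
      using z b1 by (simp add: f hardy_fun_comp_op hardy_fun_hkernel involution_in_disk)
    also have "\<dots> = (1 - p) * ((1 - q) + q * D) / (of_real s * D)"
      unfolding one_minus_involution[OF b1 z] D_def[symmetric] num p_def by simp
    finally have "hardy_fun (comp_op a f) z = (1 - p) * ((1 - q) + q * D) / (of_real s * D)" .
    moreover have "hardy_fun (cadj (comp_op a) f) z = 1 / D"
      using z b1 by (simp add: f cadj_comp_op_hkernel involution_in_disk involution_involution hardy_fun_hkernel D_def)
    moreover have "(1 - p) * ((1 - q) + q * D) / (of_real s * D) - 1 / D
        = ((1 - q) * (1 - p) / of_real s - 1) / D + q * (1 - p) / of_real s"
      using D s0 by (simp add: field_simps)
    moreover have "hardy_fun (hkernel b) z = 1 / D" "hardy_fun (hkernel 0) z = 1"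
      using z b1 by (simp_all add: hardy_fun_hkernel D_def)
    ultimately show "hardy_fun (comp_op a f - cadj (comp_op a) f) z
        = hardy_fun (\<beta> t *\<^sub>C hkernel b + \<kappa> t *\<^sub>C hkernel 0) z"
      by (simp add: \<beta>_def \<kappa>_def q_def[symmetric] acb[symmetric] p_def[symmetric])
  qed
  \<comment> \<open>The factor \<open>sqrt (1 - t\<^sup>2)\<close> is the reciprocal of the norm of
    \<open>hkernel b\<close>, so this sum is the size of the difference relative to that
    norm.\<close>
  have "((\<lambda>t. cmod (\<beta> t) + cmod (\<kappa> t) * sqrt (1 - t\<^sup>2)) \<longlongrightarrow>
      cmod ((1 - u / of_real 1) * (1 - of_real 1 * cnj u) / of_real s - 1)
      + cmod (u / of_real 1 * (1 - of_real 1 * cnj u) / of_real s) * sqrt (1 - 1\<^sup>2)) (at_left 1)"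
    unfolding \<beta>_def \<kappa>_def using s0 by (intro tendsto_intros) auto
  then have "((\<lambda>t. cmod (\<beta> t) + cmod (\<kappa> t) * sqrt (1 - t\<^sup>2)) \<longlongrightarrow> 0) (at_left 1)"
    using s0 by (simp add: u1)
  then have "\<forall>\<^sub>F t in at_left 1. cmod (\<beta> t) + cmod (\<kappa> t) * sqrt (1 - t\<^sup>2) < d / C"
    by (rule order_tendstoD) (use d C in simp)
  moreover have "\<forall>\<^sub>F t in at_left (1::real). 0 < t \<and> t < 1"
    using eventually_at_left_real[of 0 "1::real"] by simp
  ultimately have "\<forall>\<^sub>F t in at_left 1. (cmod (\<beta> t) + cmod (\<kappa> t) * sqrt (1 - t\<^sup>2) < d / C) \<and> 0 < t \<and> t < 1"
    by eventually_elim simp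
  then obtain t where t: "cmod (\<beta> t) + cmod (\<kappa> t) * sqrt (1 - t\<^sup>2) < d / C" "0 < t" "t < 1"
    using eventually_happens[of _ "at_left (1::real)"] by (auto simp: trivial_limit_at_left_real)
  define b where "b = of_real t * \<zeta>"
  have b: "cmod b = t" using t \<zeta>1 by (simp add: b_def norm_mult)
  define f where "f = hkernel (\<phi> b)"
  define k where "k = norm (hkernel b)"
  have k2: "k\<^sup>2 = 1 / (1 - t\<^sup>2)" unfolding k_def using norm_hkernel[of b] b t by simp
  have t2: "1 - t\<^sup>2 > 0" using t by (simp add: abs_square_less_1)
  have "k = 1 / sqrt (1 - t\<^sup>2)"
    by (rule power2_eq_imp_eq) (use t2 k2 in \<open>simp_all add: power_divide k_def\<close>)
  then have k: "k > 0" "sqrt (1 - t\<^sup>2) * k = 1" using t2 by auto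
  \<comment> \<open>Boundedness of the adjoint converts the estimate relative to
    \<open>hkernel b\<close> into one relative to \<open>f\<close>.\<close>
  have "k = norm (cadj (comp_op a) f)"
    using b t by (simp add: k_def f_def cadj_comp_op_hkernel involution_in_disk involution_involution)
  also have "\<dots> \<le> norm (cadj (comp_op a)) * norm f" by (rule norm_blinfun)
  also have "\<dots> \<le> C * norm f" unfolding C_def by (simp add: mult_right_mono)
  finally have kf: "k \<le> C * norm f" .
  have n0: "norm (hkernel 0) = 1"
    by (rule power2_eq_imp_eq) (simp_all add: norm_hkernel)
  have "norm (comp_op a f - cadj (comp_op a) f) \<le> cmod (\<beta> t) * k + cmod (\<kappa> t)"
    unfolding key[OF t(2,3) b_def f_def] k_def
    using norm_triangle_ineq[of "\<beta> t *\<^sub>C hkernel b" "\<kappa> t *\<^sub>C hkernel 0"]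
    by (simp add: norm_scaleC n0)
  also have "\<dots> = (cmod (\<beta> t) + cmod (\<kappa> t) * sqrt (1 - t\<^sup>2)) * k"
    using k(2) by (simp add: algebra_simps)
  also have "\<dots> < d / C * k" by (rule mult_strict_right_mono[OF t(1) k(1)])
  also have "\<dots> \<le> d / C * (C * norm f)" by (rule mult_left_mono[OF kf]) (use d C in simp)
  also have "\<dots> = d * norm f" using C by simp
  finally show ?thesis by blast
qed

end

section \<open>The two projections of the composition operator\<close>

text \<open>Realness of the form at \<open>x + y\<close> controls the imaginary parts, and at
  \<open>x + \<i> *\<^sub>C y\<close> the real parts, of the two mixed terms.\<close>

lemma positive_op_selfadj:
  assumes "positive_op X"
  shows "selfadj X"
proof -
  have X: "X \<in> bop" and real: "\<And>x. Im (cinner (X x) x) = 0"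
    using assms by (auto simp: positive_op_def complex_nonneg_Reals_iff)
  have "cinner (X x) y = cinner x (X y)" for x y
  proof -
    have "Im (cinner (X x) y) + Im (cinner (X y) x) = 0"
      using real[of "x + y"] real[of x] real[of y] by (simp add: blinfun.add_right cinner_simps)
    moreover have "Re (cinner (X x) y) = Re (cinner (X y) x)"
      using real[of "x + \<i> *\<^sub>C y"] real[of x] real[of y]
      by (simp add: blinfun.add_right cinner_simps bopD[OF X])
    moreover have "cinner x (X y) = cnj (cinner (X y) x)" by (rule cinner_commute)
    ultimately show ?thesis by (simp add: complex_eq_iff)
  qed
  then show ?thesis using X by (simp add: selfadj_def)
qed

text \<open>Approximate eigenvectors place the spectrum in the closure of the numerical range, so
  bounds on the quadratic form bound the spectrum.\<close>

lemma rspec_quadratic_form: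
  fixes T :: "'a::chilbert_space \<Rightarrow>\<^sub>L 'a"
  assumes T: "selfadj T" and t: "t \<in> rspec T" and e: "e > 0"
  shows "\<exists>x. norm x = 1 \<and> \<bar>Re (cinner (T x) x) - t\<bar> < e"
proof -
  obtain x where x: "norm x = 1" "norm (T x - t *\<^sub>R x) < e"
    using approximate_eigenvector[OF T t e] by blast
  have "Re (cinner (T x) x) - t = Re (cinner (T x - t *\<^sub>R x) x)"
    by (simp add: cinner_simps cinner_scaleR_left cinner_norm x)
  also have "\<bar>\<dots>\<bar> \<le> norm (T x - t *\<^sub>R x) * norm x"
    by (rule order_trans[OF abs_Re_le_cmod cmod_cinner_le])
  finally show ?thesis using x by (intro exI[of _ x]) auto
qed

lemma rspec_ge:
  fixes T :: "'a::chilbert_space \<Rightarrow>\<^sub>L 'a"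
  assumes T: "selfadj T" and t: "t \<in> rspec T" and m: "\<And>x. m * (norm x)\<^sup>2 \<le> Re (cinner (T x) x)"
  shows "m \<le> t"
proof (rule field_le_epsilon)
  fix e :: real assume "e > 0"
  then obtain x where "norm x = 1" "\<bar>Re (cinner (T x) x) - t\<bar> < e"
    using rspec_quadratic_form[OF T t] by blast
  then show "m \<le> t + e" using m[of x] by simp
qed

lemma rspec_le:
  fixes T :: "'a::chilbert_space \<Rightarrow>\<^sub>L 'a"
  assumes T: "selfadj T" and t: "t \<in> rspec T" and m: "\<And>x. Re (cinner (T x) x) \<le> m * (norm x)\<^sup>2"
  shows "t \<le> m"
proof (rule field_le_epsilon)
  fix e :: real assume "e > 0"
  then obtain x where "norm x = 1" "\<bar>Re (cinner (T x) x) - t\<bar> < e"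
    using rspec_quadratic_form[OF T t] by blast
  then show "t \<le> m + e" using m[of x] by simp
qed

text \<open>Existence is the projection theorem; two candidates differ by a vector of
  \<open>M\<close> that is orthogonal to itself, which makes the description in
  \<open>orth_proj\<close> definite.\<close>

lemma orth_proj:
  fixes M :: "'a::chilbert_space set"
  assumes M: "subspace M" "closed M" "\<And>c x. x \<in> M \<Longrightarrow> c *\<^sub>C x \<in> M"
  shows "orth_proj M x \<in> M \<and> x - orth_proj M x \<in> ocompl M"
  unfolding orth_proj_def
proof (rule theI')
  obtain y where y: "y \<in> M" "\<And>m. m \<in> M \<Longrightarrow> inner (x - y) m = 0"
    using projection_exists[OF M(1,2), of x] by blast
  have "x - y \<in> ocompl M"
    unfolding ocompl_def using cinner_eq_zero_if_inner[of M "x - y"] M(3) y(2) by blast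
  moreover have "z = y" if z: "z \<in> M" "x - z \<in> ocompl M" for z
  proof -
    have "z - y \<in> M" by (intro subspace_diff M(1) z y)
    then have "cinner (x - y) (z - y) = 0" "cinner (x - z) (z - y) = 0"
      using calculation z(2) by (auto simp: ocompl_def)
    then have "cinner ((x - y) - (x - z)) (z - y) = 0" by (simp only: cinner_diff_left[of "x - y"]) simp
    then show ?thesis by (simp add: cinner_norm)
  qed
  ultimately show "\<exists>!y. y \<in> M \<and> x - y \<in> ocompl M" using y(1) by blast
qed

lemma orth_proj_ident:
  fixes M :: "'a::chilbert_space set"
  assumes M: "subspace M" "closed M" "\<And>c x. x \<in> M \<Longrightarrow> c *\<^sub>C x \<in> M" and x: "x \<in> M"
  shows "orth_proj M x = x"
proof -
  have "x - orth_proj M x \<in> M" "x - orth_proj M x \<in> ocompl M"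
    using orth_proj[OF M, of x] x by (auto intro: subspace_diff M(1))
  then have "cinner (x - orth_proj M x) (x - orth_proj M x) = 0" by (auto simp: ocompl_def)
  then show ?thesis by (simp add: cinner_norm)
qed

lemma null_space_closed_subspace:
  fixes T :: "'a::complex_inner \<Rightarrow>\<^sub>L 'b::complex_inner"
  assumes T: "T \<in> bop"
  shows "subspace (null_space T)" "closed (null_space T)"
    "\<And>c x. x \<in> null_space T \<Longrightarrow> c *\<^sub>C x \<in> null_space T"
  unfolding null_space_def
  by (auto simp: subspace_def blinfun.add_right blinfun.scaleR_right bopD[OF T]
      intro!: closed_Collect_eq continuous_intros)

section \<open>The composition operator in Halmos' coordinates\<close>

locale composition_model = disk_point a for a +
  fixes X :: "'j::chilbert_space \<Rightarrow>\<^sub>L 'j" and U :: "hardy \<Rightarrow> 'j \<times> 'j"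
  assumes a0: "a \<noteq> 0"
    and model: "halmos_model (null_space (comp_op a - id_blinfun)) (null_space (comp_op a + id_blinfun)) X U"
begin

abbreviation V :: "hardy \<Rightarrow>\<^sub>L hardy" where "V \<equiv> comp_op a"
abbreviation L :: "hardy set" where "L \<equiv> null_space (V - id_blinfun)"
abbreviation N :: "hardy set" where "N \<equiv> null_space (V + id_blinfun)"
abbreviation C :: "'j \<Rightarrow>\<^sub>L 'j" where "C \<equiv> cos_op X"
abbreviation S :: "'j \<Rightarrow>\<^sub>L 'j" where "S \<equiv> sin_op X"
abbreviation H :: "'j \<Rightarrow>\<^sub>L 'j" where "H \<equiv> halmos_H X"

lemma L_iff: "x \<in> L \<longleftrightarrow> V x = x" and N_iff: "x \<in> N \<longleftrightarrow> V x = - x"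
  by (auto simp: null_space_def blinfun.diff_left blinfun.add_left eq_neg_iff_add_eq_0)

lemma in_L: "g + V g \<in> L" and in_N: "g - V g \<in> N"
  unfolding L_iff N_iff by (simp_all add: blinfun.add_right blinfun.diff_right comp_op_comp_op)

text \<open>A vector of \<open>L\<close> orthogonal to \<open>N\<close> pairs equally with
  \<open>g\<close> and \<open>V g\<close>, because \<open>g - V g\<close> lies in \<open>N\<close>,
  and so falls under \<open>isometric_vector_zero\<close>; the other mixed intersection is the same
  up to sign. The remaining two vanish for any involution.\<close>

lemma generic_part_eq_UNIV: "generic_part L N = UNIV"
proof -
  have "f = 0" if "f \<in> L \<inter> N" for f
  proof -
    have "f = - f" using that by (metis IntD1 IntD2 L_iff N_iff)
    then have "2 *\<^sub>R f = 0" by (simp add: scaleR_2 eq_neg_iff_add_eq_0)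
    then show ?thesis by simp
  qed
  moreover have "f = 0" if "f \<in> L \<inter> ocompl N" for f
  proof (rule isometric_vector_zero[OF a0])
    fix g
    have "cinner f (g - V g) = 0" using that in_N by (auto simp: ocompl_def)
    then show "cinner (V f) (V g) = cinner f g" using that by (simp add: L_iff cinner_diff_right)
  qed
  moreover have "f = 0" if "f \<in> ocompl L \<inter> N" for f
  proof (rule isometric_vector_zero[OF a0])
    fix g
    have "cinner f (g + V g) = 0" using that in_L by (auto simp: ocompl_def)
    then have "cinner f (V g) = - cinner f g"
      by (simp add: cinner_add_right eq_neg_iff_add_eq_0 add.commute)
    then show "cinner (V f) (V g) = cinner f g" using that by (simp add: N_iff)
  qed
  moreover have "f = 0" if "f \<in> ocompl L \<inter> ocompl N" for f
  proof -
    have "cinner f (f + V f) = 0" "cinner f (f - V f) = 0" using that in_L in_N by (auto simp: ocompl_def)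
    then have "2 * cinner f f = 0" by (simp add: cinner_add_right cinner_diff_right)
    then show ?thesis by (simp add: cinner_norm)
  qed
  ultimately have "(L \<inter> N) + (L \<inter> ocompl N) + (ocompl L \<inter> N) + (ocompl L \<inter> ocompl N) \<subseteq> {0}"
    unfolding set_plus_def by fastforce
  then show ?thesis unfolding generic_part_def ocompl_def by auto
qed

lemma U_unitary: "bij U" "U (x + y) = U x + U y" "U (c *\<^sub>C x) = c *\<^sub>C U x" "cinner (U x) (U y) = cinner x y"
  using model unfolding halmos_model_def generic_part_eq_UNIV unitary_iso_on_def by auto

lemma norm_U: "norm (U x) = norm x"
proof -
  have "(norm (U x))\<^sup>2 = (norm x)\<^sup>2" by (simp add: power2_norm_eq_inner inner_eq_Re_cinner U_unitary)
  then show ?thesis by (rule power2_eq_imp_eq) simp_all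
qed

lemma U_diff: "U (x - y) = U x - U y"
  using U_unitary(2)[of "x - y" y] by simp

lemma U_inj: "U x = U y \<longleftrightarrow> x = y"
  using U_unitary(1) by (auto simp: bij_def inj_def)

lemma U_surj: "\<exists>x. U x = p"
  using U_unitary(1) by (metis bij_def surjD)

sublocale X: selfadj_on X "{0..pi/2}"
proof
  have pos: "positive_op X" and norm: "norm X \<le> pi / 2" using model by (auto simp: halmos_model_def)
  show X: "selfadj X" by (rule positive_op_selfadj[OF pos])
  show "rspec X \<subseteq> {0..pi/2}"
  proof
    fix t assume t: "t \<in> rspec X"
    have "0 \<le> t"
      by (rule rspec_ge[OF X t]) (use pos in \<open>auto simp: positive_op_def complex_nonneg_Reals_iff\<close>)
    moreover have "t \<le> pi / 2"
    proof (rule rspec_le[OF X t])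
      fix x
      have "Re (cinner (X x) x) \<le> norm (X x) * norm x"
        by (rule order_trans[OF complex_Re_le_cmod cmod_cinner_le])
      also have "\<dots> \<le> norm X * norm x * norm x" by (intro mult_right_mono norm_blinfun) simp
      also have "\<dots> \<le> pi / 2 * norm x * norm x" by (intro mult_right_mono norm) simp_all
      finally show "Re (cinner (X x) x) \<le> pi / 2 * (norm x)\<^sup>2" by (simp add: power2_eq_square)
    qed
    ultimately show "t \<in> {0..pi/2}" by simp
  qed
qed simp

lemma C_eq: "C = cfc X (\<lambda>t. of_real (cos t))" and S_eq: "S = cfc X (\<lambda>t. of_real (sin t))"
  by (simp_all add: cos_op_def sin_op_def)

lemma selfadj_C: "selfadj C" and selfadj_S: "selfadj S"
  unfolding C_eq S_eq by (rule X.selfadj_cfc, intro continuous_intros)+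

lemma H_eq: "H = cfc X (\<lambda>t. of_real ((sin t)\<^sup>2))"
  unfolding halmos_H_def S_eq
  by (subst X.cfc_mult[symmetric]) (auto simp: power2_eq_square intro!: continuous_intros)

lemma S_C: "S (C x) = C (S x)"
proof -
  have "S o\<^sub>L C = C o\<^sub>L S"
    unfolding C_eq S_eq
    by (subst (1 2) X.cfc_mult[symmetric]) (auto simp: mult.commute intro!: continuous_intros)
  then show ?thesis by (metis blinfun_apply_blinfun_compose)
qed

lemma C_C_S_S: "C (C x) + S (S x) = x"
proof -
  have "(C o\<^sub>L C) + (S o\<^sub>L S) = cfc X (\<lambda>t. of_real (cos t) * of_real (cos t) + of_real (sin t) * of_real (sin t))"
    unfolding C_eq S_eq
    by (simp add: X.cfc_mult X.cfc_add continuous_intros)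
  also have "\<dots> = cfc X (\<lambda>t. 1)"
    by (intro arg_cong[of _ _ "cfc X"] ext) (simp flip: of_real_mult of_real_add)
  also have "\<dots> = id_blinfun" unfolding X.cfc_const by (rule blinfun_eqI) simp
  finally show ?thesis by (metis blinfun.add_left blinfun_apply_blinfun_compose id_apply id_blinfun.rep_eq)
qed

lemma norm_C_S: "(norm (C x))\<^sup>2 + (norm (S x))\<^sup>2 = (norm x)\<^sup>2"
proof -
  have "complex_of_real ((norm (C x))\<^sup>2 + (norm (S x))\<^sup>2) = cinner (C (C x) + S (S x)) x"
    by (simp add: cinner_norm[symmetric] selfadj_cinner[OF selfadj_C] selfadj_cinner[OF selfadj_S] cinner_add_left
      del: of_real_power)
  then show ?thesis unfolding C_C_S_S cinner_norm by (simp only: of_real_eq_iff)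
qed

lemma norm_C_le: "norm (C x) \<le> norm x" and norm_S_le: "norm (S x) \<le> norm x"
  by (rule power2_le_imp_le; use norm_C_S[of x] in \<open>simp add: flip: norm_C_S[of x]\<close>)+

lemma H_quadratic: "Re (cinner (H x) x) = (norm (S x))\<^sup>2"
  unfolding halmos_H_def by (simp add: selfadj_cinner[OF selfadj_S] cinner_norm)

lemma selfadj_H: "selfadj H"
  unfolding H_eq by (rule X.selfadj_cfc) (intro continuous_intros)

lemma rspec_H_unit: "rspec H \<subseteq> {0..1}"
proof
  fix t assume t: "t \<in> rspec H"
  have "0 \<le> t" by (rule rspec_ge[OF selfadj_H t]) (simp add: H_quadratic)
  moreover have "t \<le> 1"
    by (rule rspec_le[OF selfadj_H t]) (simp add: H_quadratic power_mono norm_S_le)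
  ultimately show "t \<in> {0..1}" by simp
qed

lemma cfc_H: "continuous_on {0..1} g \<Longrightarrow> cfc H g = cfc X (\<lambda>t. g ((sin t)\<^sup>2))"
  unfolding H_eq
  by (rule X.cfc_compose[where K' = "{0..1}"])
     (use rspec_H_unit[unfolded H_eq] in \<open>auto simp: power_le_one_iff abs_square_le_1 intro!: continuous_intros\<close>)

text \<open>On \<open>{0..pi/2}\<close> sine and cosine are nonnegative, so they are the square
  roots of \<open>(sin t)\<^sup>2\<close> and of \<open>1 - (sin t)\<^sup>2\<close>.\<close>

lemma cfc_H_sqrt: "cfc H (\<lambda>t. of_real (sqrt t)) = S"
  and cfc_H_sqrt_one_minus: "cfc H (\<lambda>t. of_real (sqrt (1 - t))) = C"
proof -
  have 1: "0 \<le> cos t" "0 \<le> sin t" if "t \<in> rspec X" for t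
    using that X.sub by (auto intro!: cos_ge_zero sin_ge_zero)
  have 2: "1 - (sin t)\<^sup>2 = (cos t)\<^sup>2" for t :: real using sin_cos_squared_add[of t] by linarith
  show "cfc H (\<lambda>t. of_real (sqrt t)) = S"
    unfolding S_eq by (subst cfc_H) (auto intro!: continuous_intros X.cfc_cong simp: 1)
  show "cfc H (\<lambda>t. of_real (sqrt (1 - t))) = C"
    unfolding C_eq by (subst cfc_H) (auto intro!: continuous_intros X.cfc_cong simp: 1 2)
qed

text \<open>The matrix of the second projection factors through the isometry
  \<open>w \<mapsto> (C w, S w)\<close> and its adjoint; the factored form exposes the
  range.\<close>

lemma U_orth_proj:
  "U (orth_proj L x) = (fst (U x), 0)"
  "U (orth_proj N x) = (C (C (fst (U x)) + S (snd (U x))), S (C (fst (U x)) + S (snd (U x))))"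
proof -
  have "U (orth_proj L x) = block_op id_blinfun 0 0 0 (fst (U x), snd (U x))"
    using model unfolding halmos_model_def generic_part_eq_UNIV by simp
  then show "U (orth_proj L x) = (fst (U x), 0)" unfolding block_op_apply by simp
  have "U (orth_proj N x) = block_op (C o\<^sub>L C) (C o\<^sub>L S) (C o\<^sub>L S) (S o\<^sub>L S) (fst (U x), snd (U x))"
    using model unfolding halmos_model_def generic_part_eq_UNIV by simp
  then show "U (orth_proj N x) = (C (C (fst (U x)) + S (snd (U x))), S (C (fst (U x)) + S (snd (U x))))"
    unfolding block_op_apply by (simp add: blinfun.add_right S_C)
qed

lemma closed_subspaces:
  "subspace L" "closed L" "\<And>c x. x \<in> L \<Longrightarrow> c *\<^sub>C x \<in> L"
  "subspace N" "closed N" "\<And>c x. x \<in> N \<Longrightarrow> c *\<^sub>C x \<in> N"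
  by (rule null_space_closed_subspace; (assumption | intro bop_intros bop_comp_op))+

lemma L_iff_U: "x \<in> L \<longleftrightarrow> snd (U x) = 0"
proof
  assume "x \<in> L"
  then have "orth_proj L x = x" by (intro orth_proj_ident closed_subspaces)
  then show "snd (U x) = 0" using U_orth_proj(1)[of x] by (metis snd_conv)
next
  assume "snd (U x) = 0"
  then have "U (orth_proj L x) = U x" unfolding U_orth_proj by (metis prod.collapse)
  then have "orth_proj L x = x" by (simp only: U_inj)
  then show "x \<in> L" using orth_proj[OF closed_subspaces(1-3), of x] by metis
qed

lemma U_in_N: 
  assumes "x \<in> N"
  shows "\<exists>w. U x = (C w, S w)"
proof -
  have "orth_proj N x = x" using assms by (intro orth_proj_ident closed_subspaces)
  then show ?thesis using U_orth_proj(2)[of x] by metis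
qed

lemma in_N_if_U:
  assumes "U x = (C w, S w)"
  shows "x \<in> N"
proof -
  have "U (orth_proj N x) = U x" unfolding U_orth_proj assms by (simp add: C_C_S_S)
  then have "orth_proj N x = x" by (simp only: U_inj)
  then show "x \<in> N" using orth_proj[OF closed_subspaces(4-6), of x] by metis
qed

text \<open>\<open>V\<close> fixes \<open>l\<close> and negates \<open>n\<close>, so the norm bound
  for \<open>V\<close> compares \<open>l - n\<close> with \<open>l + n\<close>.\<close>

lemma cinner_L_N:
  assumes l: "l \<in> L" and n: "n \<in> N"
  shows "- 2 * Re (cinner l n) \<le> cmod a * ((norm l)\<^sup>2 + (norm n)\<^sup>2)"
proof -
  have "V (l + n) = l - n" using l n by (simp add: L_iff N_iff blinfun.add_right)
  then have "(1 - cmod a) * (norm (l - n))\<^sup>2 \<le> (1 + cmod a) * (norm (l + n))\<^sup>2"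
    using norm_comp_op[of "l + n"] by simp
  then show ?thesis unfolding norm_add_square norm_diff_square by (simp add: algebra_simps)
qed

lemma norm_C_le_a: "(norm (C w))\<^sup>2 \<le> (cmod a)\<^sup>2 * (norm w)\<^sup>2"
proof -
  define r where "r = cmod a"
  have r: "r > 0" using a0 by (simp add: r_def)
  \<comment> \<open>With \<open>- x *\<^sub>R C w\<close> as first coordinate the estimate carries
    the factor \<open>2 * x - r * x\<^sup>2\<close> in front of the squared norm of
    \<open>C w\<close>; it is largest at \<open>x = 1 / r\<close>.\<close>
  obtain l where l: "U l = (- ((1 / r) *\<^sub>R C w), 0)" using U_surj by blast
  obtain n where n: "U n = (C w, S w)" using U_surj by blast
  have nn: "(norm n)\<^sup>2 = (norm w)\<^sup>2"
    unfolding norm_U[of n, symmetric] n norm_Pair using norm_C_S[of w] by simp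
  have nl: "(norm l)\<^sup>2 = (norm (C w))\<^sup>2 / r\<^sup>2"
    unfolding norm_U[of l, symmetric] l norm_Pair by (simp add: power_divide)
  have "Re (cinner l n) = - (norm (C w))\<^sup>2 / r"
    unfolding U_unitary(4)[of l n, symmetric] l n
    by (simp add: cinner_prod_def cinner_scaleR_left cinner_norm)
  moreover have "- 2 * Re (cinner l n) \<le> r * ((norm l)\<^sup>2 + (norm n)\<^sup>2)"
    unfolding r_def by (rule cinner_L_N) (simp_all add: L_iff_U l in_N_if_U[OF n])
  ultimately have "2 * (norm (C w))\<^sup>2 / r \<le> (norm (C w))\<^sup>2 / r + r * (norm w)\<^sup>2"
    unfolding nn nl using r by (simp add: power2_eq_square distrib_left)
  then have "(norm (C w))\<^sup>2 / r \<le> r * (norm w)\<^sup>2" by simp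
  then show ?thesis using r by (simp add: r_def pos_divide_le_eq power2_eq_square mult_ac)
qed

text \<open>The squares of \<open>C\<close> and \<open>S\<close> add up to the identity, so the
  bound on \<open>C\<close> is a lower bound on \<open>H\<close>.\<close>

sublocale H: selfadj_on H "{1 - (cmod a)\<^sup>2..1}"
proof
  show "rspec H \<subseteq> {1 - (cmod a)\<^sup>2..1}"
  proof
    fix t assume t: "t \<in> rspec H"
    have "1 - (cmod a)\<^sup>2 \<le> t"
    proof (rule rspec_ge[OF selfadj_H t])
      show "(1 - (cmod a)\<^sup>2) * (norm x)\<^sup>2 \<le> Re (cinner (H x) x)" for x
        unfolding H_quadratic using norm_C_le_a[of x] norm_C_S[of x] by (simp add: left_diff_distrib)
    qed
    then show "t \<in> {1 - (cmod a)\<^sup>2..1}" using rspec_H_unit t by auto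
  qed
qed (rule selfadj_H, simp)

lemma interval_pos: "t \<in> {1 - (cmod a)\<^sup>2..1} \<Longrightarrow> 0 < t"
  using s_pos by (simp add: s_def)

text \<open>The cotangent as a function of the squared sine; it is continuous because the interval
  stays away from 0.\<close>

definition k :: "real \<Rightarrow> complex"
  where "k t = of_real (sqrt ((1 - t) / t))"

lemma continuous_k: "continuous_on {1 - (cmod a)\<^sup>2..1} k"
  unfolding k_def by (intro continuous_intros) (use interval_pos in force)

definition K :: "'j \<Rightarrow>\<^sub>L 'j" where "K = cfc H k"

lemma K_S: "K (S x) = C x" and S_K: "S (K x) = C x"
proof -
  have c: "continuous_on {1 - (cmod a)\<^sup>2..1} (\<lambda>t. complex_of_real (sqrt t))" by (intro continuous_intros)
  have eq: "cfc H (\<lambda>t. k t * of_real (sqrt t)) = C"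
    unfolding cfc_H_sqrt_one_minus[symmetric]
  proof (rule H.cfc_cong)
    fix t assume "t \<in> rspec H"
    then have "0 < t" using H.sub interval_pos by blast
    then show "k t * of_real (sqrt t) = of_real (sqrt (1 - t))"
      unfolding k_def by (simp add: real_sqrt_divide)
  qed
  have "K o\<^sub>L S = C"
    unfolding K_def cfc_H_sqrt[symmetric] H.cfc_mult[OF continuous_k c, symmetric] by (rule eq)
  then show "K (S x) = C x" by (metis blinfun_apply_blinfun_compose)
  have "S o\<^sub>L K = C"
    unfolding K_def cfc_H_sqrt[symmetric] H.cfc_mult[OF c continuous_k, symmetric] mult.commute[of _ "k _"] by (rule eq)
  then show "S (K x) = C x" by (metis blinfun_apply_blinfun_compose)
qed

lemma selfadj_K: "selfadj K"
  unfolding K_def k_def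
  by (rule H.selfadj_cfc, intro continuous_intros) (use interval_pos in force)

definition VU :: "('j \<times> 'j) \<Rightarrow>\<^sub>L ('j \<times> 'j)"
  where "VU = block_op id_blinfun (- 2 *\<^sub>R K) 0 (- id_blinfun)"

lemma VU_apply: "VU p = (fst p - 2 *\<^sub>R K (snd p), - snd p)"
  using block_op_apply[of id_blinfun "- 2 *\<^sub>R K" 0 "- id_blinfun" "fst p" "snd p"]
  by (simp add: VU_def blinfun.scaleR_left blinfun.minus_left)

text \<open>The half sum and half difference of \<open>x\<close> and \<open>V x\<close> split
  \<open>x\<close> into a part \<open>(p, 0)\<close> fixed by \<open>V\<close> and a part
  \<open>(C w, S w)\<close> negated by it; the first coordinate drops by twice \<open>C w\<close>,
  which is \<open>K (S w)\<close>.\<close>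

lemma U_V: "U (V x) = VU (U x)"
proof -
  define l where "l = (1/2) *\<^sub>R (x + V x)"
  define n where "n = (1/2) *\<^sub>R (x - V x)"
  have l: "l \<in> L" unfolding l_def by (intro subspace_scale closed_subspaces in_L)
  have n: "n \<in> N" unfolding n_def by (intro subspace_scale closed_subspaces in_N)
  obtain p where p: "U l = (p, 0)" using l unfolding L_iff_U by (metis prod.collapse)
  obtain w where w: "U n = (C w, S w)" using U_in_N[OF n] by blast
  have x: "x = l + n" unfolding l_def n_def by (simp add: scaleR_add_right[symmetric] scaleR_2[symmetric])
  have Vx: "V x = l - n" unfolding l_def n_def by (simp add: scaleR_diff_right[symmetric] scaleR_2[symmetric])
  have Ux: "U x = (p + C w, S w)" unfolding x U_unitary(2) p w by simp
  have "U (V x) = (p - C w, - S w)" unfolding Vx U_diff p w by simp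
  also have "\<dots> = VU (U x)" unfolding VU_apply Ux by (simp add: K_S scaleR_2)
  finally show ?thesis .
qed

lemma U_cadj_V: "U (cadj V x) = (fst (U x), - (2 *\<^sub>R K (fst (U x))) - snd (U x))"
proof (rule cinner_ext)
  fix q :: "'j \<times> 'j"
  obtain z where z: "U z = q" using U_surj by blast
  have "cinner q (U (cadj V x)) = cinner (VU q) (U x)"
    unfolding z[symmetric] U_V[symmetric] U_unitary(4) by (simp add: cinner_cadj[OF bop_comp_op])
  also have "\<dots> = cinner q (fst (U x), - (2 *\<^sub>R K (fst (U x))) - snd (U x))"
    unfolding VU_apply cinner_prod_def
    by (simp add: cinner_simps scaleR_scaleC selfadj_cinner[OF selfadj_K])
  finally show "cinner q (U (cadj V x)) = cinner q (fst (U x), - (2 *\<^sub>R K (fst (U x))) - snd (U x))" .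
qed

text \<open>If 1 were outside the spectrum, the difference of \<open>H\<close> and the identity,
  which is minus \<open>C\<close> squared, would be bounded below. By \<open>S_K\<close> so would
  \<open>K\<close>, and with it the off-diagonal difference of \<open>V\<close> and its
  adjoint.\<close>

lemma one_in_rspec_H: "1 \<in> rspec H"
proof (rule ccontr)
  assume "1 \<notin> rspec H"
  then have "\<not> (\<forall>e>0. \<exists>x. x \<noteq> 0 \<and> norm (H x - 1 *\<^sub>R x) < e * norm x)"
    using in_rspecI[of H 1] by blast
  then obtain e where e: "e > 0" "\<And>x. x \<noteq> 0 \<Longrightarrow> e * norm x \<le> norm (H x - x)"
    by (auto simp: not_less)
  have K: "e * norm x \<le> norm (K x)" for x
  proof (cases "x = 0")
    case False
    have "H x - x = - C (C x)" using C_C_S_S[of x] by (simp add: halmos_H_def algebra_simps)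
    then have "e * norm x \<le> norm (C (C x))" using e(2)[OF False] by simp
    also have "\<dots> \<le> norm (C x)" by (rule norm_C_le)
    also have "\<dots> \<le> norm (K x)" unfolding S_K[symmetric] by (rule norm_S_le)
    finally show ?thesis .
  qed simp
  obtain f where f: "norm (V f - cadj V f) < 2 * e * norm f"
    using comp_op_minus_adjoint_not_bounded_below[OF a0, of "2 * e"] e(1) by auto
  obtain u v where uv: "U f = (u, v)" by (cases "U f")
  have "U (V f - cadj V f) = (- (2 *\<^sub>R K v), 2 *\<^sub>R K u)"
    unfolding U_diff U_V VU_apply U_cadj_V uv by simp
  then have "(norm (V f - cadj V f))\<^sup>2 = 4 * ((norm (K v))\<^sup>2 + (norm (K u))\<^sup>2)"
    unfolding norm_U[of "V f - _", symmetric] by (simp add: norm_Pair power_mult_distrib)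
  moreover have "(norm f)\<^sup>2 = (norm u)\<^sup>2 + (norm v)\<^sup>2"
    unfolding norm_U[of f, symmetric] uv by (simp add: norm_Pair)
  moreover have "(e * norm u)\<^sup>2 \<le> (norm (K u))\<^sup>2" "(e * norm v)\<^sup>2 \<le> (norm (K v))\<^sup>2"
    using K e(1) by (auto intro!: power_mono)
  ultimately have "(2 * e * norm f)\<^sup>2 \<le> (norm (V f - cadj V f))\<^sup>2"
    by (simp add: power_mult_distrib algebra_simps)
  then have "2 * e * norm f \<le> norm (V f - cadj V f)" by (rule power2_le_imp_le) simp
  then show False using f by simp
qed

end

section \<open>Block operators and the model algebra\<close>

lemma block_op_apply': "block_op A B C D p = (A (fst p) + B (snd p), C (fst p) + D (snd p))"
  using block_op_apply[of A B C D "fst p" "snd p"] by simp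

lemma block_op_add: "block_op A B C D + block_op A' B' C' D' = block_op (A + A') (B + B') (C + C') (D + D')"
  by (rule blinfun_eqI) (simp add: block_op_apply' blinfun.add_left)

lemma block_op_compose:
  "block_op A B C D o\<^sub>L block_op A' B' C' D' =
     block_op ((A o\<^sub>L A') + (B o\<^sub>L C')) ((A o\<^sub>L B') + (B o\<^sub>L D')) ((C o\<^sub>L A') + (D o\<^sub>L C')) ((C o\<^sub>L B') + (D o\<^sub>L D'))"
  by (rule blinfun_eqI) (simp add: block_op_apply' blinfun.add_left blinfun.add_right)

lemma block_op_scaleC: "c *\<^sub>C block_op A B C D = block_op (c *\<^sub>C A) (c *\<^sub>C B) (c *\<^sub>C C) (c *\<^sub>C D)"
  by (rule blinfun_eqI) (simp add: block_op_apply' scaleC_prod_def scaleC_add_right)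

lemma bop_block_op:
  assumes "A \<in> bop" "B \<in> bop" "C \<in> bop" "D \<in> bop"
  shows "block_op A B C D \<in> bop"
  using assms by (auto simp: bop_def block_op_apply' scaleC_prod_def scaleC_add_right)

lemma cadj_block_op:
  fixes A B C D :: "'j::chilbert_space \<Rightarrow>\<^sub>L 'j"
  assumes "A \<in> bop" "B \<in> bop" "C \<in> bop" "D \<in> bop"
  shows "cadj (block_op A B C D) = block_op (cadj A) (cadj C) (cadj B) (cadj D)"
  by (rule cadj_eqI)
     (simp add: block_op_apply' cinner_prod_def cinner_simps cinner_cadj assms)

definition inl_op :: "'j::complex_inner \<Rightarrow>\<^sub>L ('j \<times> 'j)" where "inl_op = Blinfun (\<lambda>x. (x, 0))"
definition inr_op :: "'j::complex_inner \<Rightarrow>\<^sub>L ('j \<times> 'j)" where "inr_op = Blinfun (\<lambda>x. (0, x))"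

lemma inl_op_apply [simp]: "inl_op x = (x, 0)" and inr_op_apply [simp]: "inr_op x = (0, x)"
  unfolding inl_op_def inr_op_def
  by (subst bounded_linear_Blinfun_apply; auto intro!: bounded_linear_Pair bounded_linear_ident bounded_linear_zero)+

text \<open>\<open>True\<close> stands for the second coordinate. Entries taken by composition
  depend continuously on the operator, so closedness can be checked entry by entry.\<close>

definition entry :: "bool \<Rightarrow> bool \<Rightarrow> ('j::complex_inner \<times> 'j) \<Rightarrow>\<^sub>L ('j \<times> 'j) \<Rightarrow> 'j \<Rightarrow>\<^sub>L 'j"
  where "entry i j T = (if i then snd_blinfun else fst_blinfun) o\<^sub>L T o\<^sub>L (if j then inr_op else inl_op)"

lemma entry_block_op:
  "entry False False (block_op A B C D) = A" "entry False True (block_op A B C D) = B"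
  "entry True False (block_op A B C D) = C" "entry True True (block_op A B C D) = D"
  by (auto intro!: blinfun_eqI simp: entry_def block_op_apply')

lemma block_op_entry:
  "block_op (entry False False T) (entry False True T) (entry True False T) (entry True True T) = T"
proof (rule blinfun_eqI)
  fix p :: "'a \<times> 'a"
  have "T p = T (fst p, 0) + T (0, snd p)" by (simp flip: blinfun.add_right)
  then show "block_op (entry False False T) (entry False True T) (entry True False T) (entry True True T) p = T p"
    by (simp add: block_op_apply' entry_def prod_eq_iff)
qed

lemma tendsto_blinfun_compose:
  assumes "(f \<longlongrightarrow> a) F" "(g \<longlongrightarrow> b) F"
  shows "((\<lambda>x. f x o\<^sub>L g x) \<longlongrightarrow> (a o\<^sub>L b)) F"
  by (rule bounded_bilinear.tendsto[OF bounded_bilinear_blinfun_compose assms])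

lemma tendsto_entry: "(f \<longlongrightarrow> T) F \<Longrightarrow> ((\<lambda>x. entry i j (f x)) \<longlongrightarrow> entry i j T) F"
  unfolding entry_def by (intro tendsto_blinfun_compose tendsto_const)

lemma tendsto_block_op:
  fixes a :: "'a::complex_inner \<Rightarrow>\<^sub>L 'a"
  assumes "(A \<longlongrightarrow> a) F" "(B \<longlongrightarrow> b) F" "(C \<longlongrightarrow> c) F" "(D \<longlongrightarrow> d) F"
  shows "((\<lambda>x. block_op (A x) (B x) (C x) (D x)) \<longlongrightarrow> block_op a b c d) F"
proof -
  have "block_op A B C D = (inl_op o\<^sub>L A o\<^sub>L fst_blinfun) + (inl_op o\<^sub>L B o\<^sub>L snd_blinfun)
      + (inr_op o\<^sub>L C o\<^sub>L fst_blinfun) + (inr_op o\<^sub>L D o\<^sub>L snd_blinfun)" for A B C D :: "'a \<Rightarrow>\<^sub>L 'a"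
    by (rule blinfun_eqI) (simp add: block_op_apply' blinfun.add_left)
  then show ?thesis by (simp only:) (intro tendsto_add tendsto_blinfun_compose tendsto_const assms)
qed

lemma cstar_subalgebraD:
  assumes "cstar_subalgebra A"
  shows "A \<subseteq> bop" "closed A" "0 \<in> A" "S \<in> A \<Longrightarrow> T \<in> A \<Longrightarrow> S + T \<in> A"
    "S \<in> A \<Longrightarrow> T \<in> A \<Longrightarrow> S o\<^sub>L T \<in> A" "T \<in> A \<Longrightarrow> c *\<^sub>C T \<in> A" "T \<in> A \<Longrightarrow> cadj T \<in> A"
  using assms unfolding cstar_subalgebra_def by auto

text \<open>The identity \<open>u (w x) = x\<close> makes the conjugation multiplicative, and the
  adjoint relations make it respect adjoints. It is applied in both directions, the generated
  algebra being an intersection.\<close>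

lemma cstar_subalgebra_conjugate:
  fixes u :: "'a::chilbert_space \<Rightarrow>\<^sub>L 'b::chilbert_space" and w :: "'b \<Rightarrow>\<^sub>L 'a"
  assumes u: "u \<in> bop" "w \<in> bop" "\<And>x. u (w x) = x" and adj: "cadj u = w" "cadj w = u"
    and A: "cstar_subalgebra A"
  shows "cstar_subalgebra {T \<in> bop. w o\<^sub>L T o\<^sub>L u \<in> A}"
  unfolding cstar_subalgebra_def
proof (intro conjI ballI allI)
  note A = cstar_subalgebraD[OF A]
  show "closed {T \<in> bop. w o\<^sub>L T o\<^sub>L u \<in> A}"
    unfolding closed_sequential_limits
  proof (intro allI impI, elim conjE)
    fix T t assume T: "\<forall>n. T n \<in> {T \<in> bop. w o\<^sub>L T o\<^sub>L u \<in> A}" and lim: "T \<longlonglongrightarrow> t"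
    have "t \<in> bop" by (rule closed_sequentially[OF closed_bop _ lim]) (use T in blast)
    moreover have "(\<lambda>n. w o\<^sub>L T n o\<^sub>L u) \<longlonglongrightarrow> (w o\<^sub>L t o\<^sub>L u)"
      by (intro tendsto_blinfun_compose tendsto_const lim)
    then have "w o\<^sub>L t o\<^sub>L u \<in> A" by (rule closed_sequentially[OF A(2), rotated]) (use T in blast)
    ultimately show "t \<in> {T \<in> bop. w o\<^sub>L T o\<^sub>L u \<in> A}" by blast
  qed
  have "w o\<^sub>L 0 o\<^sub>L u = 0" by (rule blinfun_eqI) simp
  then show "0 \<in> {T \<in> bop. w o\<^sub>L T o\<^sub>L u \<in> A}" using A(3) by (simp add: bop_zero)
  fix S T assume S: "S \<in> {T \<in> bop. w o\<^sub>L T o\<^sub>L u \<in> A}" and T: "T \<in> {T \<in> bop. w o\<^sub>L T o\<^sub>L u \<in> A}"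
  have "w o\<^sub>L (S + T) o\<^sub>L u = (w o\<^sub>L S o\<^sub>L u) + (w o\<^sub>L T o\<^sub>L u)"
    by (rule blinfun_eqI) (simp add: blinfun.add_left blinfun.add_right)
  then show "S + T \<in> {T \<in> bop. w o\<^sub>L T o\<^sub>L u \<in> A}" using S T A(4) by (simp add: bop_add)
  have "w o\<^sub>L (S o\<^sub>L T) o\<^sub>L u = (w o\<^sub>L S o\<^sub>L u) o\<^sub>L (w o\<^sub>L T o\<^sub>L u)"
    by (rule blinfun_eqI) (simp add: u)
  then show "S o\<^sub>L T \<in> {T \<in> bop. w o\<^sub>L T o\<^sub>L u \<in> A}" using S T A(5) by (simp add: bop_compose)
next
  note A = cstar_subalgebraD[OF A]
  fix c T assume T: "T \<in> {T \<in> bop. w o\<^sub>L T o\<^sub>L u \<in> A}"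
  have "w o\<^sub>L (c *\<^sub>C T) o\<^sub>L u = c *\<^sub>C (w o\<^sub>L T o\<^sub>L u)"
    by (rule blinfun_eqI) (simp add: bopD[OF u(2)])
  then show "c *\<^sub>C T \<in> {T \<in> bop. w o\<^sub>L T o\<^sub>L u \<in> A}" using T A(6) by (simp add: bop_scaleC)
next
  note A = cstar_subalgebraD[OF A]
  fix T assume T: "T \<in> {T \<in> bop. w o\<^sub>L T o\<^sub>L u \<in> A}"
  then have "T \<in> bop" by blast
  then have "cadj (w o\<^sub>L T o\<^sub>L u) = w o\<^sub>L cadj T o\<^sub>L u"
    by (intro cadj_eqI) (simp add: cinner_cadj u adj)
  then show "cadj T \<in> {T \<in> bop. w o\<^sub>L T o\<^sub>L u \<in> A}" using T A(7) bop_cadj by fastforce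
qed auto

section \<open>Matrices of functions of \<open>H\<close> and the model algebra\<close>

context composition_model
begin

abbreviation I :: "real set" where "I \<equiv> {1 - (cmod a)\<^sup>2..1}"

text \<open>Sums, products and adjoints of such operators are those of the matrices of functions on
  \<open>I\<close>, which reduces identities in the algebra to scalar ones.\<close>

definition blk :: "(real \<Rightarrow> complex) \<Rightarrow> (real \<Rightarrow> complex) \<Rightarrow> (real \<Rightarrow> complex) \<Rightarrow> (real \<Rightarrow> complex) \<Rightarrow>
    ('j \<times> 'j) \<Rightarrow>\<^sub>L ('j \<times> 'j)"
  where "blk f g h i = block_op (cfc H f) (cfc H g) (cfc H h) (cfc H i)"

lemma one_in_I: "1 \<in> I"
  by simp

lemma blk_cong:
  assumes "\<And>t. t \<in> I \<Longrightarrow> f t = f' t" "\<And>t. t \<in> I \<Longrightarrow> g t = g' t"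
    "\<And>t. t \<in> I \<Longrightarrow> h t = h' t" "\<And>t. t \<in> I \<Longrightarrow> i t = i' t"
  shows "blk f g h i = blk f' g' h' i'"
  unfolding blk_def using assms H.sub by (intro arg_cong4[where f = block_op] H.cfc_cong) blast+

lemma blk_add:
  assumes "continuous_on I f" "continuous_on I g" "continuous_on I h" "continuous_on I i"
    "continuous_on I f'" "continuous_on I g'" "continuous_on I h'" "continuous_on I i'"
  shows "blk f g h i + blk f' g' h' i' = blk (\<lambda>t. f t + f' t) (\<lambda>t. g t + g' t) (\<lambda>t. h t + h' t) (\<lambda>t. i t + i' t)"
  unfolding blk_def block_op_add using assms by (simp add: H.cfc_add)

lemma blk_compose:
  assumes "continuous_on I f" "continuous_on I g" "continuous_on I h" "continuous_on I i"
    "continuous_on I f'" "continuous_on I g'" "continuous_on I h'" "continuous_on I i'"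
  shows "blk f g h i o\<^sub>L blk f' g' h' i' =
    blk (\<lambda>t. f t * f' t + g t * h' t) (\<lambda>t. f t * g' t + g t * i' t)
        (\<lambda>t. h t * f' t + i t * h' t) (\<lambda>t. h t * g' t + i t * i' t)"
  unfolding blk_def block_op_compose using assms by (simp add: H.cfc_add H.cfc_mult continuous_on_mult)

lemma blk_scaleC:
  assumes "continuous_on I f" "continuous_on I g" "continuous_on I h" "continuous_on I i"
  shows "c *\<^sub>C blk f g h i = blk (\<lambda>t. c * f t) (\<lambda>t. c * g t) (\<lambda>t. c * h t) (\<lambda>t. c * i t)"
  unfolding blk_def block_op_scaleC using assms by (simp add: H.cfc_cmult)

lemma bop_blk:
  assumes "continuous_on I f" "continuous_on I g" "continuous_on I h" "continuous_on I i"
  shows "blk f g h i \<in> bop"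
  unfolding blk_def by (intro bop_block_op H.bop_cfc assms)

lemma cadj_blk:
  assumes "continuous_on I f" "continuous_on I g" "continuous_on I h" "continuous_on I i"
  shows "cadj (blk f g h i) = blk (\<lambda>t. cnj (f t)) (\<lambda>t. cnj (h t)) (\<lambda>t. cnj (g t)) (\<lambda>t. cnj (i t))"
  unfolding blk_def using assms by (simp add: cadj_block_op H.bop_cfc H.cadj_cfc)

lemma blk_tendsto:
  assumes "\<And>n. continuous_on I (f n)" "\<And>n. continuous_on I (g n)" "\<And>n. continuous_on I (h n)" "\<And>n. continuous_on I (i n)"
    "continuous_on I f'" "continuous_on I g'" "continuous_on I h'" "continuous_on I i'"
    "uniform_limit I f f' sequentially" "uniform_limit I g g' sequentially"
    "uniform_limit I h h' sequentially" "uniform_limit I i i' sequentially"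
  shows "(\<lambda>n. blk (f n) (g n) (h n) (i n)) \<longlonglongrightarrow> blk f' g' h' i'"
  unfolding blk_def
  by (intro tendsto_block_op H.cfc_tendsto assms uniform_limit_on_subset[OF _ H.sub])

abbreviation M :: "(complex \<times> (('j \<times> 'j) \<Rightarrow>\<^sub>L ('j \<times> 'j))) set"
  where "M \<equiv> model_algebra a H"

lemma model_iff:
  "p \<in> M \<longleftrightarrow> (\<exists>f g h i. continuous_on I f \<and> continuous_on I g \<and> continuous_on I h \<and> continuous_on I i \<and>
     g 1 = 0 \<and> h 1 = 0 \<and> p = (f 1, blk f g h i))"
  unfolding model_algebra_def blk_def by auto

lemma model_closed_under_operations:
  assumes p: "p \<in> M" and q: "q \<in> M"
  shows "p + q \<in> M" "pair_mult p q \<in> M" "c *\<^sub>C p \<in> M" "pair_star p \<in> M"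
proof -
  obtain f g h i where f: "continuous_on I f" "continuous_on I g" "continuous_on I h" "continuous_on I i"
    "g 1 = 0" "h 1 = 0" "p = (f 1, blk f g h i)" using p unfolding model_iff by blast
  obtain f' g' h' i' where f': "continuous_on I f'" "continuous_on I g'" "continuous_on I h'" "continuous_on I i'"
    "g' 1 = 0" "h' 1 = 0" "q = (f' 1, blk f' g' h' i')" using q unfolding model_iff by blast
  show "p + q \<in> M"
    unfolding model_iff
    by (intro exI[of _ "\<lambda>t. f t + f' t"] exI[of _ "\<lambda>t. g t + g' t"] exI[of _ "\<lambda>t. h t + h' t"] exI[of _ "\<lambda>t. i t + i' t"])
       (use f f' in \<open>simp add: blk_add continuous_on_add\<close>)
  show "pair_mult p q \<in> M"
    unfolding model_iff
    by (intro exI[of _ "\<lambda>t. f t * f' t + g t * h' t"] exI[of _ "\<lambda>t. f t * g' t + g t * i' t"]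
          exI[of _ "\<lambda>t. h t * f' t + i t * h' t"] exI[of _ "\<lambda>t. h t * g' t + i t * i' t"])
       (use f f' in \<open>simp add: pair_mult_def blk_compose continuous_on_add continuous_on_mult\<close>)
  show "c *\<^sub>C p \<in> M"
    unfolding model_iff
    by (intro exI[of _ "\<lambda>t. c * f t"] exI[of _ "\<lambda>t. c * g t"] exI[of _ "\<lambda>t. c * h t"] exI[of _ "\<lambda>t. c * i t"])
       (use f in \<open>simp add: scaleC_prod_def scaleC_complex_def blk_scaleC continuous_on_mult\<close>)
  show "pair_star p \<in> M"
    unfolding model_iff
    by (intro exI[of _ "\<lambda>t. cnj (f t)"] exI[of _ "\<lambda>t. cnj (h t)"] exI[of _ "\<lambda>t. cnj (g t)"] exI[of _ "\<lambda>t. cnj (i t)"])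
       (use f in \<open>simp add: pair_star_def cadj_blk continuous_on_cnj\<close>)
qed

text \<open>The block operator determines the upper left function on the spectrum of
  \<open>H\<close>, and 1 belongs to it.\<close>

lemma model_scalar_unique:
  assumes "(\<alpha>, T) \<in> M" "(\<beta>, T) \<in> M"
  shows "\<alpha> = \<beta>"
proof -
  obtain f g h i where f: "continuous_on I f" "\<alpha> = f 1" "T = blk f g h i" using assms(1) unfolding model_iff by blast
  obtain f' g' h' i' where f': "continuous_on I f'" "\<beta> = f' 1" "T = blk f' g' h' i'" using assms(2) unfolding model_iff by blast
  have "cfc H f = cfc H f'"
    using f(3) f'(3) by (metis blk_def entry_block_op(1))
  then have "cfc H (\<lambda>t. f t - f' t) = 0" using f(1) f'(1) by (simp add: H.cfc_diff)
  moreover have "cmod (f 1 - f' 1) \<le> norm (cfc H (\<lambda>t. f t - f' t))"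
    using f(1) f'(1) by (intro H.cmod_le_norm_cfc[where f = "\<lambda>t. f t - f' t"] one_in_rspec_H continuous_intros)
  ultimately show ?thesis using f(2) f'(2) by simp
qed

text \<open>The premises \<open>False\<close> and \<open>True\<close> are the two values of the flag
  in \<open>closed_range_cfc\<close>, which then applies to each entry.\<close>

lemma snd_model_eq:
  "snd ` M = {T. entry False False T \<in> {cfc H f | f. continuous_on I f \<and> (False \<longrightarrow> f 1 = 0)} \<and>
    entry False True T \<in> {cfc H f | f. continuous_on I f \<and> (True \<longrightarrow> f 1 = 0)} \<and>
    entry True False T \<in> {cfc H f | f. continuous_on I f \<and> (True \<longrightarrow> f 1 = 0)} \<and>
    entry True True T \<in> {cfc H f | f. continuous_on I f \<and> (False \<longrightarrow> f 1 = 0)}}" (is "_ = ?R")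
proof
  show "snd ` M \<subseteq> ?R"
  proof
    fix T assume "T \<in> snd ` M"
    then obtain f g h i where "continuous_on I f" "continuous_on I g" "continuous_on I h" "continuous_on I i"
      "g 1 = 0" "h 1 = 0" "T = blk f g h i" unfolding image_iff Bex_def model_iff by auto
    then show "T \<in> ?R" unfolding blk_def by (auto simp: entry_block_op)
  qed
  show "?R \<subseteq> snd ` M"
  proof
    fix T assume "T \<in> ?R"
    then obtain f g h i where "continuous_on I f" "continuous_on I g" "continuous_on I h" "continuous_on I i"
      "g 1 = 0" "h 1 = 0" and e: "entry False False T = cfc H f" "entry False True T = cfc H g"
      "entry True False T = cfc H h" "entry True True T = cfc H i" by auto
    moreover have "T = blk f g h i" unfolding blk_def e[symmetric] by (rule block_op_entry[symmetric])
    ultimately have "(f 1, T) \<in> M" unfolding model_iff by blast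
    then show "T \<in> snd ` M" by force
  qed
qed

lemma closed_snd_model: "closed (snd ` M)"
  unfolding closed_sequential_limits
proof (intro allI impI, elim conjE)
  fix T t assume T: "\<forall>n. T n \<in> snd ` M" and lim: "T \<longlonglongrightarrow> t"
  have e: "entry i j t \<in> {cfc H f | f. continuous_on I f \<and> (z \<longrightarrow> f 1 = 0)}"
    if "\<And>n. entry i j (T n) \<in> {cfc H f | f. continuous_on I f \<and> (z \<longrightarrow> f 1 = 0)}" for i j z
    by (rule closed_sequentially[OF H.closed_range_cfc[OF one_in_rspec_H] that tendsto_entry[OF lim]])
  show "t \<in> snd ` M" using T unfolding snd_model_eq mem_Collect_eq[of t] by (intro conjI e) blast+
qed

lemma cstar_subalgebra_snd_model: "cstar_subalgebra (snd ` M)"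
  unfolding cstar_subalgebra_def
proof (intro conjI ballI allI)
  show "closed (snd ` M)" by (rule closed_snd_model)
  show sub: "snd ` M \<subseteq> bop"
    unfolding image_subset_iff Ball_def model_iff by (auto intro: bop_blk)
  have "(0, 0) \<in> M"
    unfolding model_iff
    by (intro exI[of _ "\<lambda>t. 0"]) (auto simp: blk_def H.cfc_const block_op_apply' zero_prod_def intro!: blinfun_eqI)
  then show "0 \<in> snd ` M" by force
  fix S T c assume "S \<in> snd ` M" and T: "T \<in> snd ` M"
  then obtain p q where pq: "p \<in> M" "q \<in> M" "S = snd p" "T = snd q" by blast
  note m = model_closed_under_operations[OF pq(1,2)] model_closed_under_operations[OF pq(2,2)]
  show "S + T \<in> snd ` M" by (rule image_eqI[OF _ m(1)]) (simp add: pq)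
  show "S o\<^sub>L T \<in> snd ` M" by (rule image_eqI[OF _ m(2)]) (simp add: pq pair_mult_def)
next
  fix T c assume "T \<in> snd ` M"
  then obtain q where q: "q \<in> M" "T = snd q" by blast
  note m = model_closed_under_operations[OF q(1,1)]
  show "c *\<^sub>C T \<in> snd ` M" by (rule image_eqI[OF _ m(3)]) (simp add: q scaleC_prod_def)
  show "cadj T \<in> snd ` M" by (rule image_eqI[OF _ m(4)]) (simp add: q pair_star_def)
qed

lemma VU_eq_blk: "VU = blk (\<lambda>t. 1) (\<lambda>t. - 2 * k t) (\<lambda>t. 0) (\<lambda>t. - 1)"
  unfolding VU_def blk_def H.cfc_const H.cfc_cmult[OF continuous_k]
  by (rule blinfun_eqI)
     (simp add: K_def block_op_apply' scaleR_scaleC blinfun.scaleR_left blinfun.minus_left)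

lemma k_one: "k 1 = 0"
  by (simp add: k_def)

lemma VU_in_model: "(1, VU) \<in> M"
  unfolding model_iff VU_eq_blk
  by (intro exI[of _ "\<lambda>t. 1"] exI[of _ "\<lambda>t. - 2 * k t"] exI[of _ "\<lambda>t. 0"] exI[of _ "\<lambda>t. - 1"])
     (auto intro!: continuous_intros continuous_k simp: k_one)

lemma k_square:
  assumes "t \<in> I"
  shows "k t * k t = of_real ((1 - t) / t)" "cnj (k t) = k t"
proof -
  have "(1 - t) / t \<ge> 0" using assms interval_pos[OF assms] by simp
  then show "k t * k t = of_real ((1 - t) / t)"
    unfolding k_def of_real_mult[symmetric] real_sqrt_mult_self by (simp only: abs_of_nonneg)
  show "cnj (k t) = k t" by (simp add: k_def)
qed

text \<open>The difference of \<open>VU\<close> and its adjoint is off-diagonal with entries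
  multiples of \<open>k\<close>. A product of two such matrices is diagonal with the injective
  function \<open>m\<close>, the square of \<open>k\<close>, which generates all functions on the
  diagonal. Off the diagonal, limits of multiples of \<open>k\<close> exhaust the functions
  vanishing at 1.\<close>

lemma snd_model_least:
  assumes A: "cstar_subalgebra A" and VU: "VU \<in> A"
  shows "snd ` M \<subseteq> A"
proof -
  note A = cstar_subalgebraD[OF A]
  note [continuous_intros] = continuous_k
  define m where "m t = (1 - t) / t" for t :: real
  have cm: "continuous_on I m"
    unfolding m_def by (intro continuous_intros) (use interval_pos in force)
  note [continuous_intros] = cm
  have kk: "k t * k t = of_real (m t)" "k t * (k t * z) = of_real (m t) * z" "cnj (k t) = k t"
    "of_real (m t) * of_real t = 1 - complex_of_real t" "of_real t + of_real (m t) * of_real t = (1 :: complex)"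
    if "t \<in> I" for t z
  proof -
    show "k t * k t = of_real (m t)" "cnj (k t) = k t" using k_square[OF that] by (simp_all add: m_def)
    then show "k t * (k t * z) = of_real (m t) * z" by (simp add: mult.assoc[symmetric])
    have "m t * t = 1 - t" using interval_pos[OF that] by (simp add: m_def)
    then show "of_real (m t) * of_real t = 1 - complex_of_real t" by (metis of_real_1 of_real_diff of_real_mult)
    then show "of_real t + of_real (m t) * of_real t = (1 :: complex)" by simp
  qed
  have add: "blk f g h i \<in> A"
    if "P \<in> A" "Q \<in> A" "blk f g h i = P + Q" for P Q f g h i using A(4) that by metis
  have mult: "blk f g h i \<in> A"
    if "P \<in> A" "Q \<in> A" "blk f g h i = P o\<^sub>L Q" for P Q f g h i using A(5) that by metis
  have scale: "blk f g h i \<in> A"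
    if "P \<in> A" "blk f g h i = c *\<^sub>C P" for P c f g h i using A(6) that by metis
  have V0: "blk (\<lambda>t. 1) (\<lambda>t. - 2 * k t) (\<lambda>t. 0) (\<lambda>t. - 1) \<in> A" using VU unfolding VU_eq_blk .
  have V1: "blk (\<lambda>t. 1) (\<lambda>t. 0) (\<lambda>t. - 2 * k t) (\<lambda>t. - 1) \<in> A"
  proof -
    have "cadj (blk (\<lambda>t. 1) (\<lambda>t. - 2 * k t) (\<lambda>t. 0) (\<lambda>t. - 1)) = blk (\<lambda>t. 1) (\<lambda>t. 0) (\<lambda>t. - 2 * k t) (\<lambda>t. - 1)"
      by (subst cadj_blk) (auto intro!: continuous_intros blk_cong simp: kk)
    then show ?thesis using A(7)[OF V0] by simp
  qed
  have id: "blk (\<lambda>t. 1) (\<lambda>t. 0) (\<lambda>t. 0) (\<lambda>t. 1) \<in> A"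
    by (rule mult[OF V0 V0]) (subst blk_compose; auto intro!: continuous_intros blk_cong)
  have V1m: "blk (\<lambda>t. - 1) (\<lambda>t. 0) (\<lambda>t. 2 * k t) (\<lambda>t. 1) \<in> A"
    by (rule scale[OF V1, of _ _ _ _ "- 1"]) (subst blk_scaleC; auto intro!: continuous_intros blk_cong)
  have D: "blk (\<lambda>t. 0) (\<lambda>t. - 2 * k t) (\<lambda>t. 2 * k t) (\<lambda>t. 0) \<in> A"
    by (rule add[OF V0 V1m]) (subst blk_add; auto intro!: continuous_intros blk_cong)
  have D': "blk (\<lambda>t. 0) (\<lambda>t. k t) (\<lambda>t. - k t) (\<lambda>t. 0) \<in> A"
    by (rule scale[OF D, of _ _ _ _ "- 1/2"]) (subst blk_scaleC; auto intro!: continuous_intros blk_cong)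
  have Dm: "blk (\<lambda>t. 0) (\<lambda>t. - k t) (\<lambda>t. k t) (\<lambda>t. 0) \<in> A"
    by (rule scale[OF D, of _ _ _ _ "1/2"]) (subst blk_scaleC; auto intro!: continuous_intros blk_cong)
  have Z: "blk (\<lambda>t. of_real (m t)) (\<lambda>t. 0) (\<lambda>t. 0) (\<lambda>t. of_real (m t)) \<in> A"
    by (rule mult[OF D' Dm]) (subst blk_compose; auto intro!: continuous_intros blk_cong simp: kk)
  have poly: "blk (\<lambda>t. poly p (of_real (m t))) (\<lambda>t. 0) (\<lambda>t. 0) (\<lambda>t. poly p (of_real (m t))) \<in> A" for p
  proof (induction p)
    case 0
    have "blk (\<lambda>t. 0) (\<lambda>t. 0) (\<lambda>t. 0) (\<lambda>t. 0) \<in> A"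
      by (rule scale[OF id, of _ _ _ _ 0]) (subst blk_scaleC; auto intro!: continuous_intros blk_cong)
    then show ?case by simp
  next
    case (pCons c p)
    have 1: "blk (\<lambda>t. c) (\<lambda>t. 0) (\<lambda>t. 0) (\<lambda>t. c) \<in> A"
      by (rule scale[OF id, of _ _ _ _ c]) (subst blk_scaleC; auto intro!: continuous_intros blk_cong)
    have 2: "blk (\<lambda>t. of_real (m t) * poly p (of_real (m t))) (\<lambda>t. 0) (\<lambda>t. 0) (\<lambda>t. of_real (m t) * poly p (of_real (m t))) \<in> A"
      by (rule mult[OF Z pCons.IH]) (subst blk_compose; auto intro!: continuous_intros blk_cong)
    show ?case
      by (rule add[OF 1 2]) (subst blk_add; auto intro!: continuous_intros blk_cong)
  qed
  have diag: "blk f (\<lambda>t. 0) (\<lambda>t. 0) f \<in> A" if f: "continuous_on I f" for f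
  proof -
    define b where "b = m (1 - (cmod a)\<^sup>2)"
    \<comment> \<open>\<open>m\<close> maps \<open>I\<close> onto \<open>{0..b}\<close> with inverse
      \<open>1 / (1 + x)\<close>, so approximating \<open>f (1 / (1 + x))\<close> by polynomials in
      \<open>x\<close> approximates \<open>f\<close> by polynomials in \<open>m\<close>.\<close>
    have m_inv: "1 / (1 + m t) = t" if "t \<in> I" for t
      using interval_pos[OF that] by (simp add: m_def field_simps)
    have lo: "0 < 1 - (cmod a)\<^sup>2" using s_pos by (simp add: s_def)
    have m_range: "m t \<in> {0..b}" if "t \<in> I" for t
    proof -
      have "m t = 1 / t - 1" if "t > 0" for t using that by (simp add: m_def diff_divide_distrib)
      then have "m t = 1 / t - 1" "b = 1 / (1 - (cmod a)\<^sup>2) - 1"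
        unfolding b_def using interval_pos[OF that] lo by blast+
      moreover have "1 / t \<le> 1 / (1 - (cmod a)\<^sup>2)" "1 \<le> 1 / t"
        using that lo interval_pos[OF that] by (auto intro!: divide_left_mono)
      ultimately show ?thesis by simp
    qed
    have "continuous_on {0..b} (\<lambda>x. f (1 / (1 + x)))"
    proof (rule continuous_on_compose2[OF f])
      show "continuous_on {0..b} (\<lambda>x. 1 / (1 + x))" by (intro continuous_intros) auto
      show "(\<lambda>x. 1 / (1 + x)) ` {0..b} \<subseteq> I"
      proof
        fix y assume "y \<in> (\<lambda>x. 1 / (1 + x)) ` {0..b}"
        then obtain x where x: "0 \<le> x" "x \<le> b" "y = 1 / (1 + x)" by auto
        have "1 / (1 + b) = 1 - (cmod a)\<^sup>2" unfolding b_def by (rule m_inv) simp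
        moreover have "1 / (1 + b) \<le> 1 / (1 + x)" using x by (intro divide_left_mono) auto
        ultimately show "y \<in> I" using x by simp
      qed
    qed
    then obtain p where p: "uniform_limit {0..b} (\<lambda>n x. poly (p n) (of_real x)) (\<lambda>x. f (1 / (1 + x))) sequentially"
      using complex_polynomial_approximation[of "{0..b}"] by auto
    have ul: "uniform_limit I (\<lambda>n t. poly (p n) (of_real (m t))) f sequentially"
    proof (rule uniform_limitI)
      fix e :: real assume "e > 0"
      from uniform_limitD[OF p this]
      show "\<forall>\<^sub>F n in sequentially. \<forall>t\<in>I. dist (poly (p n) (of_real (m t))) (f t) < e"
      proof eventually_elim
        case (elim n)
        show ?case
        proof
          fix t assume t: "t \<in> I"
          show "dist (poly (p n) (of_real (m t))) (f t) < e"
            using bspec[OF elim m_range[OF t]] m_inv[OF t] by simp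
        qed
      qed
    qed
    have "(\<lambda>n. blk (\<lambda>t. poly (p n) (of_real (m t))) (\<lambda>t. 0) (\<lambda>t. 0) (\<lambda>t. poly (p n) (of_real (m t))))
       \<longlonglongrightarrow> blk f (\<lambda>t. 0) (\<lambda>t. 0) f"
      by (rule blk_tendsto) (auto intro!: continuous_intros f ul uniform_limit_const)
    then show ?thesis by (rule closed_sequentially[OF A(2), rotated]) (rule poly)
  qed
  \<comment> \<open>\<open>Q\<close> and \<open>R\<close> add up to the diagonal matrix of
    \<open>1 + m\<close> and its negative. As \<open>(1 + m t) * t = 1\<close>, the function
    \<open>t\<close> turns it into the reflection \<open>G\<close>, which separates the two diagonal
    entries.\<close>
  have Q: "blk (\<lambda>t. 1) (\<lambda>t. - k t) (\<lambda>t. - k t) (\<lambda>t. - 1) \<in> A"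
  proof -
    have "blk (\<lambda>t. 2) (\<lambda>t. - 2 * k t) (\<lambda>t. - 2 * k t) (\<lambda>t. - 2) \<in> A"
      by (rule add[OF V0 V1]) (subst blk_add; auto intro!: continuous_intros blk_cong)
    then show ?thesis
      by (rule scale[of _ _ _ _ _ "1/2"]) (subst blk_scaleC; auto intro!: continuous_intros blk_cong)
  qed
  have R: "blk (\<lambda>t. of_real (m t)) k k (\<lambda>t. - of_real (m t)) \<in> A"
    by (rule mult[OF Q D']) (subst blk_compose; auto intro!: continuous_intros blk_cong simp: kk)
  have "blk (\<lambda>t. 1 + of_real (m t)) (\<lambda>t. 0) (\<lambda>t. 0) (\<lambda>t. - 1 - of_real (m t)) \<in> A"
    by (rule add[OF Q R]) (subst blk_add; auto intro!: continuous_intros blk_cong)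
  moreover have "blk of_real (\<lambda>t. 0) (\<lambda>t. 0) of_real \<in> A"
    by (rule diag) (rule continuous_on_of_real[OF continuous_on_id])
  ultimately have G: "blk (\<lambda>t. 1) (\<lambda>t. 0) (\<lambda>t. 0) (\<lambda>t. - 1) \<in> A"
  proof (rule mult)
    have "(1 + of_real (m t)) * complex_of_real t = 1" "(- 1 - of_real (m t)) * complex_of_real t = - 1"
      if "t \<in> I" for t
      using kk(5)[OF that] by (simp_all add: distrib_right left_diff_distrib) (metis add.inverse_distrib_swap add.commute uminus_add_conv_diff)
    then show "blk (\<lambda>t. 1) (\<lambda>t. 0) (\<lambda>t. 0) (\<lambda>t. - 1) = blk (\<lambda>t. 1 + of_real (m t)) (\<lambda>t. 0) (\<lambda>t. 0)
        (\<lambda>t. - 1 - of_real (m t)) o\<^sub>L blk of_real (\<lambda>t. 0) (\<lambda>t. 0) of_real"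
      by (subst blk_compose) (auto intro!: continuous_intros continuous_on_of_real[OF continuous_on_id] blk_cong)
  qed
  have diag': "blk f (\<lambda>t. 0) (\<lambda>t. 0) i \<in> A" if f: "continuous_on I f" and i: "continuous_on I i" for f i
  proof -
    \<comment> \<open>The half sum enters as a multiple of the identity, the half difference as a
      multiple of the reflection \<open>G\<close>.\<close>
    define p where "p t = (f t + i t) / 2" for t
    define q where "q t = (f t - i t) / 2" for t
    have cp: "continuous_on I p" and cq: "continuous_on I q"
      unfolding p_def q_def by (intro continuous_intros f i; simp)+
    have pq: "p t + q t = f t" "p t - q t = i t" for t
      by (simp_all add: p_def q_def add_divide_distrib diff_divide_distrib)
    have 1: "blk q (\<lambda>t. 0) (\<lambda>t. 0) (\<lambda>t. - q t) \<in> A"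
      by (rule mult[OF G diag[OF cq]]) (subst blk_compose; auto intro!: continuous_intros cq blk_cong)
    show ?thesis
      by (rule add[OF diag[OF cp] 1]) (subst blk_add; auto intro!: continuous_intros cp cq blk_cong simp: pq)
  qed
  have E0: "blk (\<lambda>t. 1) (\<lambda>t. 0) (\<lambda>t. 0) (\<lambda>t. 0) \<in> A" and E1: "blk (\<lambda>t. 0) (\<lambda>t. 0) (\<lambda>t. 0) (\<lambda>t. 1) \<in> A"
    by (intro diag' continuous_intros)+
  have K01: "blk (\<lambda>t. 0) k (\<lambda>t. 0) (\<lambda>t. 0) \<in> A"
    by (rule mult[OF E0 D']) (subst blk_compose; auto intro!: continuous_intros blk_cong)
  have K10: "blk (\<lambda>t. 0) (\<lambda>t. 0) k (\<lambda>t. 0) \<in> A"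
    by (rule mult[OF E1 Dm]) (subst blk_compose; auto intro!: continuous_intros blk_cong)
  have off: "blk (\<lambda>t. 0) g (\<lambda>t. 0) (\<lambda>t. 0) \<in> A \<and> blk (\<lambda>t. 0) (\<lambda>t. 0) g (\<lambda>t. 0) \<in> A"
    if g: "continuous_on I g" "g 1 = 0" for g
  proof -
    obtain p where p: "uniform_limit I (\<lambda>n t. poly (p n) (of_real t)) g sequentially"
      using complex_polynomial_approximation[OF _ g(1)] by auto
    \<comment> \<open>Subtracting the value at 1 keeps the uniform limit, since
      \<open>g 1 = 0\<close>, and makes the polynomials divisible by \<open>t - 1\<close>.\<close>
    define q where "q n = p n - [:poly (p n) 1:]" for n
    have "(\<lambda>n. poly (p n) (of_real 1)) \<longlonglongrightarrow> g 1" by (rule tendsto_uniform_limitI[OF p one_in_I])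
    then have "uniform_limit I (\<lambda>n _. poly (p n) 1) (\<lambda>_. 0) sequentially"
      using g(2) by (simp add: uniform_limit_iff tendsto_iff)
    from uniform_limit_minus[OF p this]
    have ul: "uniform_limit I (\<lambda>n t. poly (q n) (of_real t)) g sequentially" by (simp add: q_def)
    have "poly (q n) 1 = 0" for n by (simp add: q_def)
    then have "\<exists>r. q n = r * [:- 1, 1:]" for n by (metis poly_eq_0_iff_dvd dvd_def mult.commute)
    then obtain r where r: "\<And>n. q n = r n * [:- 1, 1:]" by metis
    \<comment> \<open>The quotient of \<open>q n\<close> by the square of \<open>k\<close>: on
      \<open>I\<close>, \<open>t - 1\<close> is \<open>- t\<close> times that square.\<close>
    define h where "h n t = - (of_real t * poly (r n) (of_real t))" for n t
    have ch: "continuous_on I (h n)" for n unfolding h_def by (intro continuous_intros)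
    note [continuous_intros] = ch
    have kh: "k t * (k t * h n t) = poly (q n) (of_real t)" if "t \<in> I" for n t
    proof -
      have "k t * (k t * h n t) = (of_real (m t) * of_real t) * - poly (r n) (of_real t)"
        using that by (simp add: kk h_def)
      then show ?thesis unfolding kk(4)[OF that] r by (simp add: algebra_simps)
    qed
    have hk: "blk (\<lambda>t. k t * h n t) (\<lambda>t. 0) (\<lambda>t. 0) (\<lambda>t. k t * h n t) \<in> A" for n
      by (intro diag continuous_intros)
    have 1: "blk (\<lambda>t. 0) (\<lambda>t. poly (q n) (of_real t)) (\<lambda>t. 0) (\<lambda>t. 0) \<in> A" for n
      by (rule mult[OF K01 hk[of n]]) (subst blk_compose; auto intro!: continuous_intros blk_cong simp: kh)
    have 2: "(\<lambda>n. blk (\<lambda>t. 0) (\<lambda>t. poly (q n) (of_real t)) (\<lambda>t. 0) (\<lambda>t. 0)) \<longlonglongrightarrow> blk (\<lambda>t. 0) g (\<lambda>t. 0) (\<lambda>t. 0)"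
      by (rule blk_tendsto) (auto intro!: continuous_intros g ul uniform_limit_const)
    have 3: "blk (\<lambda>t. 0) (\<lambda>t. 0) (\<lambda>t. poly (q n) (of_real t)) (\<lambda>t. 0) \<in> A" for n
      by (rule mult[OF K10 hk[of n]]) (subst blk_compose; auto intro!: continuous_intros blk_cong simp: kh)
    have 4: "(\<lambda>n. blk (\<lambda>t. 0) (\<lambda>t. 0) (\<lambda>t. poly (q n) (of_real t)) (\<lambda>t. 0)) \<longlonglongrightarrow> blk (\<lambda>t. 0) (\<lambda>t. 0) g (\<lambda>t. 0)"
      by (rule blk_tendsto) (auto intro!: continuous_intros g ul uniform_limit_const)
    show ?thesis
      using closed_sequentially[OF A(2) 1 2] closed_sequentially[OF A(2) 3 4] by simp
  qed
  show ?thesis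
  proof
    fix T assume "T \<in> snd ` M"
    then obtain f g h i where f: "continuous_on I f" "continuous_on I g" "continuous_on I h" "continuous_on I i"
      "g 1 = 0" "h 1 = 0" "T = blk f g h i" unfolding image_iff Bex_def model_iff by auto
    have 1: "blk (\<lambda>t. 0) g h (\<lambda>t. 0) \<in> A"
      by (rule add[OF conjunct1[OF off[OF f(2,5)]] conjunct2[OF off[OF f(3,6)]]])
         (subst blk_add; auto intro!: continuous_intros f blk_cong)
    show "T \<in> A" unfolding f(7)
      by (rule add[OF 1 diag'[OF f(1,4)]]) (subst blk_add; auto intro!: continuous_intros f blk_cong)
  qed
qed

section \<open>Transport by the unitary and the isomorphism\<close>

lemma conjugation:
  obtains u :: "hardy \<Rightarrow>\<^sub>L ('j \<times> 'j)" and w :: "('j \<times> 'j) \<Rightarrow>\<^sub>L hardy"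
  where "u \<in> bop" "w \<in> bop" "\<And>x. u (w x) = x" "\<And>x. w (u x) = x" "cadj u = w" "cadj w = u" "\<And>x. u x = U x"
proof
  define u where "u = Blinfun U"
  have "bounded_linear U"
    by (rule bounded_linear_intro[where K = 1]) (simp_all add: U_unitary scaleR_scaleC norm_U)
  then have u: "u x = U x" for x by (simp add: u_def bounded_linear_Blinfun_apply)
  show bu: "u \<in> bop" by (simp add: bop_def u U_unitary)
  define w where "w = cadj u"
  show "w \<in> bop" unfolding w_def by (rule bop_cadj[OF bu])
  show "cadj u = w" "cadj w = u" unfolding w_def by (simp_all add: cadj_cadj bu)
  show wu: "w (u x) = x" for x
    by (rule cinner_ext) (simp add: w_def cinner_cadj[OF bu, symmetric] u U_unitary)
  show "u (w p) = p" for p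
  proof -
    obtain x where "u x = p" using U_surj u by metis
    then show ?thesis using wu by metis
  qed
  show "u x = U x" for x by (rule u)
qed

lemma star_isomorphic_model: "star_isomorphic (cstar_generated V) (o\<^sub>L) cadj M pair_mult pair_star"
proof -
  obtain u :: "hardy \<Rightarrow>\<^sub>L ('j \<times> 'j)" and w where u: "u \<in> bop" "w \<in> bop" "\<And>x. u (w x) = x" "\<And>x. w (u x) = x"
    "cadj u = w" "cadj w = u" "\<And>x. u x = U x" using conjugation by blast
  define G where "G = cstar_generated V"
  define F where "F T = u o\<^sub>L T o\<^sub>L w" for T
  define F' where "F' T = w o\<^sub>L T o\<^sub>L u" for T
  have FF': "F (F' T) = T" and F'F: "F' (F T') = T'" for T T'
    by (auto simp: F_def F'_def u(3,4) intro: blinfun_eqI)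
  have FV: "F V = VU"
    by (rule blinfun_eqI) (metis F_def U_V blinfun_apply_blinfun_compose u(3,7))
  have V_bop: "V \<in> bop" by (rule bop_comp_op)
  have sub: "F T \<in> snd ` M" and G_bop: "T \<in> bop" if "T \<in> G" for T
  proof -
    \<comment> \<open>The preimage of the model's block operators is a subalgebra containing
      \<open>V\<close>, hence contains everything that \<open>V\<close> generates.\<close>
    have "cstar_subalgebra {T \<in> bop. F T \<in> snd ` M}"
      unfolding F_def by (rule cstar_subalgebra_conjugate) (use u cstar_subalgebra_snd_model in auto)
    moreover have "V \<in> {T \<in> bop. F T \<in> snd ` M}" using VU_in_model FV V_bop by force
    ultimately have "G \<subseteq> {T \<in> bop. F T \<in> snd ` M}" unfolding G_def cstar_generated_def by blast
    then show "F T \<in> snd ` M" "T \<in> bop" using that by auto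
  qed
  have sup: "F' T \<in> G" if T: "T \<in> snd ` M" for T
    unfolding G_def cstar_generated_def
  proof (rule InterI, clarify)
    fix A assume A: "cstar_subalgebra A" "V \<in> A"
    \<comment> \<open>Conversely, a competing \<open>A\<close> transported to the coordinates
      contains \<open>VU\<close>, so \<open>snd_model_least\<close> places the block operators of
      the model in it.\<close>
    have "cstar_subalgebra {T \<in> bop. F' T \<in> A}"
      unfolding F'_def by (rule cstar_subalgebra_conjugate) (use u A in auto)
    moreover have "VU \<in> {T \<in> bop. F' T \<in> A}"
      using A(2) F'F[of V] cstar_subalgebraD(1)[OF cstar_subalgebra_snd_model] VU_in_model by (force simp: FV)
    ultimately show "F' T \<in> A" using snd_model_least T by blast
  qed
  \<comment> \<open>The scalar is the one that \<open>model_scalar_unique\<close> attaches to the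
    block operator; each algebra rule for \<open>\<Phi>\<close> then follows from membership in
    \<open>M\<close> and the block operators alone.\<close>
  define \<Phi> where "\<Phi> T = (THE p. p \<in> M \<and> snd p = F T)" for T
  have \<Phi>_eq: "\<Phi> T = p" if "p \<in> M" "snd p = F T" for T p
    unfolding \<Phi>_def
  proof (rule the_equality)
    fix q assume "q \<in> M \<and> snd q = F T"
    then show "q = p" using that model_scalar_unique by (metis prod.collapse)
  qed (use that in blast)
  have \<Phi>: "\<Phi> T \<in> M" "snd (\<Phi> T) = F T" if "T \<in> G" for T
  proof -
    obtain p where p: "p \<in> M" "snd p = F T" using sub[OF \<open>T \<in> G\<close>] by (metis imageE)
    then show "\<Phi> T \<in> M" "snd (\<Phi> T) = F T" using \<Phi>_eq by metis+
  qed
  have F_add: "F (S + T) = F S + F T" for S T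
    unfolding F_def by (rule blinfun_eqI) (simp add: blinfun.add_left blinfun.add_right)
  have F_compose: "F (S o\<^sub>L T) = F S o\<^sub>L F T" for S T
    unfolding F_def by (rule blinfun_eqI) (simp add: u(4))
  have F_scaleC: "F (c *\<^sub>C T) = c *\<^sub>C F T" for c T
    unfolding F_def by (rule blinfun_eqI) (simp add: bopD[OF u(1)])
  have F_cadj: "F (cadj T) = cadj (F T)" if "T \<in> bop" for T
    unfolding F_def by (rule cadj_eqI[symmetric]) (simp add: cinner_cadj u(1,2,5,6) that)
  note ops = model_closed_under_operations
  have "bij_betw \<Phi> G M"
  proof (rule bij_betw_imageI)
    show "inj_on \<Phi> G"
    proof (rule inj_onI)
      fix S T assume "S \<in> G" "T \<in> G" "\<Phi> S = \<Phi> T"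
      then have "F S = F T" using \<Phi>(2) by metis
      then show "S = T" using F'F by metis
    qed
    show "\<Phi> ` G = M"
    proof
      show "\<Phi> ` G \<subseteq> M" using \<Phi>(1) by blast
      show "M \<subseteq> \<Phi> ` G"
      proof
        fix p assume p: "p \<in> M"
        have "\<Phi> (F' (snd p)) = p" by (rule \<Phi>_eq[OF p]) (simp add: FF')
        then show "p \<in> \<Phi> ` G" using sup[of "snd p"] p by (metis imageI)
      qed
    qed
  qed
  moreover have "\<Phi> (S + T) = \<Phi> S + \<Phi> T \<and> \<Phi> (S o\<^sub>L T) = pair_mult (\<Phi> S) (\<Phi> T)" if "S \<in> G" "T \<in> G" for S T
    using ops(1,2)[OF \<Phi>(1)[OF that(1)] \<Phi>(1)[OF that(2)]] \<Phi>(2)[OF that(1)] \<Phi>(2)[OF that(2)]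
    by (auto intro!: \<Phi>_eq simp: F_add F_compose pair_mult_def)
  moreover have "\<Phi> (c *\<^sub>C S) = c *\<^sub>C \<Phi> S" if "S \<in> G" for c S
    using ops(3)[OF \<Phi>(1)[OF that] \<Phi>(1)[OF that]] \<Phi>(2)[OF that]
    by (auto intro!: \<Phi>_eq simp: F_scaleC scaleC_prod_def)
  moreover have "\<Phi> (cadj S) = pair_star (\<Phi> S)" if "S \<in> G" for S
    using ops(4)[OF \<Phi>(1)[OF that] \<Phi>(1)[OF that]] \<Phi>(2)[OF that] G_bop[OF that]
    by (auto intro!: \<Phi>_eq simp: F_cadj pair_star_def)
  ultimately show ?thesis unfolding star_isomorphic_def G_def by blast
qed

end

theorem theorem5p1:
  fixes a :: complex
    and X :: "'j::chilbert_space \<Rightarrow>\<^sub>L 'j"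
    and U :: "hardy \<Rightarrow> 'j \<times> 'j"
  assumes "a \<in> ball 0 1" and "a \<noteq> 0"
    and "halmos_model (null_space (comp_op a - id_blinfun)) (null_space (comp_op a + id_blinfun)) X U"
  shows "star_isomorphic (cstar_generated (comp_op a)) (o\<^sub>L) cadj
           (model_algebra a (halmos_H X)) pair_mult pair_star"
proof -
  interpret composition_model a X U
    by unfold_locales (use assms in auto)
  show ?thesis by (rule star_isomorphic_model)
qed

end
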